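(* Let $e$ be a string composed of the characters $\mathtt f$, $\mathtt g$, and $\mathtt h$, and $o$ one of the characters $\mathtt g$ and $\mathtt h$. Then both the fundamental direction cycle $\Phi(e)$ and the second fundamental direction cycle $\Phi^{\mathrm{II}}_o(e)$ are dual direction graphs. Each of them is a complement of the other, the duality matrix of $\Phi^{\mathrm{II}}_o(e)$ being $A_eA_o$ and that of $\Phi(e)$ its inverse.
   Context: Matrices. $A_{\mathtt f}=\begin{pmatrix}1&0\\2&1\end{pmatrix}$, $A_{\mathtt g}=\begin{pmatrix}0&1\\-1&2\end{pmatrix}$, $A_{\mathtt h}=\begin{pmatrix}0&1\\1&2\end{pmatrix}$, and $A_{e_1e_2\ldots e_l}=A_{e_1}A_{e_2}\cdots A_{e_l}$ (the unit matrix for the empty string). Leapers. A square is a unit square of the infinite chessboard. A $(p,q)$-leaper is a piece that moves from a square $a$ to any of $a+(\pm p,\pm q)$, $a+(\pm q,\pm p)$. The leaper graph of $L$ over a set of squares $B$ has the squares of $B$ as vertices, two being adjacent when a move of $L$ joins them; a cycle of $L$ within $B$ is a simple cycle in this graph. The leaper is basic if $p+q$ is odd and $\gcd(p,q)=1$, and skew if $p,q$ are nonzero and distinct. Frames. Let $m<n$ be coprime positive integers with $m+n$ odd. Identify squares with their centers, the centers being the points of $\mathbb Z^2$. The $(m,n)$-frame $F$ is the set of squares $(x,y)$ with $\frac{n-m}2<\max(|x|,|y|)<\frac{m+n}2$, i.e. an $(m+n)\times(m+n)$ board with an $(n-m)\times(n-m)$ central hole. Its section $F_{\mathtt E}$ consists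 of the squares with $\frac{n-m}2<x<\frac{m+n}2$, $|y|<\frac{n-m}2$; its section $F_{\mathtt{NE}}$ of those with $\frac{n-m}2<x,y<\frac{m+n}2$; the sections $F_{\mathtt N},F_{\mathtt{NW}},F_{\mathtt W},F_{\mathtt{SW}},F_{\mathtt S},F_{\mathtt{SE}}$ are obtained by counterclockwise rotations by multiples of $90^\circ$ about the origin. In the leaper graph of the $(m,n)$-leaper over the $(m+n)\times(m+n)$ board the squares of the hole are isolated and all squares of $F$ have degree two, so a cycle is determined by its vertex set. Lifting. The lifting transformations $\mathtt f,\mathtt g,\mathtt h$ take $S\subseteq F$ to the disjoint union of $(S+v_i)\cap H_i$ over the eight directions $i$, where $H$ is respectively the $(m,2m+n)$-, $(n,2n-m)$-, $(n,m+2n)$-frame, and for $\mathtt f$: $v_{\mathtt E}=(m+n,0)$, $v_{\mathtt{NE}}=(m,m)$; for $\mathtt g$: $v_{\mathtt E}=(n-m,0)$, $v_{\mathtt{NE}}=(n,n)$; for $\mathtt h$: $v_{\mathtt E}=(m+n,0)$, $v_{\mathtt{NE}}=(n,n)$; the other $v_i$ are obtained by $90^\circ$ rotations. Each maps the vertex set of a cycle of the $(m,n)$-leaper within $F$ to the vertex set of a cycle of the leaper with the proportions of $H$ within $H$; this defines the lift of a cycle. Shell. Let $n\le3m$. If $2m\ge n$, the shell of $F$ is the union of eight $(n-m)\times(n-m)$ subboards: the four corners of $F$ and the four adjacent by side to the central hole. If $2m\le n\le3m$, it is the union of eight $(3m-n)\times(3m-n)$ subboards: one in the middle of each outer side and four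 adjacent by corner to the central hole. (When $n=2m$ both give all of $F$.) The shell is a union of eight-square cycles of the $(m,n)$-leaper, called shell cycles; each visits exactly one square in each section. Descents. The descent of a skew basic $(p,q)$-leaper, $p<q$, is the unique string $e_1\ldots e_l$ of characters $\mathtt f,\mathtt g,\mathtt h$ such that successively applying lifting transformations of types $e_l,\ldots,e_1$ to a $(1,2)$-frame gives a $(p,q)$-frame. The descent of a cycle $C$ of $L$ within a $(p+q)\times(p+q)$ board is the prefix $e_1\ldots e_j$ of the descent of $L$ such that $C$ is obtained from a shell cycle $C'$ of the frame $F'$ whose leaper has descent $e_{j+1}\ldots e_l$ by successively applying lifting transformations of types $e_j,\ldots,e_1$. Either $j=l$ and $F'$ is a $(1,2)$-frame, or $j<l$ and $e_{j+1}\in\{\mathtt g,\mathtt h\}$. Canonical second leaper cycles. Let $L$ be a skew basic $(p,q)$-leaper, $p<q$, of descent $e_1\ldots e_l$, let $C$ be a cycle of $L$ of descent $e_1\ldots e_j$ within a $(p+q)\times(p+q)$ board, let $F'$ be the frame whose leaper has descent $e_{j+1}\ldots e_l$, and let $C'$ be the shell cycle of $F'$ from which $C$ is obtained by successively applying lifting transformations of types $e_j,\ldots,e_1$. The canonical second leaper $M$ associated with $C$ is the $(0,1)$-leaper if $j=l$, and the skew basic leaper of descent $e_{j+2}\ldots e_l$ if $j<l$. The canonical second leaper cycle over the squares of $C'$ is the cycle of $M$ visiting the eight squares of $C'$ in the order of their sections $\mathtt E,\mathtt{NE},\mathtt N,\mathtt{NW},\mathtt W,\mathtt{SW},\mathtt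 S,\mathtt{SE}$, written as a concatenation $a_0a_1\ldots a_7$ of eight one-square paths. Number the directions $\mathtt E,\mathtt{NE},\ldots,\mathtt{SE}$ by $0,\ldots,7$ modulo $8$, let $u_0=(1,0)$, $u_1=(1,1)$, $u_2=(0,1)$, $u_3=(-1,1)$, $u_{i+4}=-u_i$, and let $-w$ be the path $w$ traversed backwards. A cycle $a_0a_1\ldots a_7$ of $M$ within an $(m,n)$-frame, split into eight paths with $a_i$ in the section of direction $i$, is lifted to $b_0b_1\ldots b_7$ within the larger frame by the rules: $\mathtt f$: $b_i=(-a_{i+5})(-a_{i+4})(-a_{i+3})+(m+n)u_i$ for $i$ even, $b_i=a_i+mu_i$ for $i$ odd; $\mathtt g$: $b_i=a_i+(n-m)u_i$ for $i$ even, $b_i=(-a_{i+5})(-a_{i+4})(-a_{i+3})+nu_i$ for $i$ odd; $\mathtt h$: $b_i=(-a_{i+6})(-a_{i+5})(-a_{i+4})(-a_{i+3})(-a_{i+2})+(m+n)u_i$ for $i$ even, $b_i=a_{i-1}a_ia_{i+1}+nu_i$ for $i$ odd. The canonical second leaper cycle $D$ over the squares of $C$ is obtained from the one over the squares of $C'$ by successively applying the lifts of types $e_j,\ldots,e_1$; it is a Hamiltonian cycle of $M$ over the squares of $C$. When $M$ is skew (so $j<l$), the descent of $D$ is $e_1\ldots e_j$ and the origin of $D$ is $e_{j+1}\in\{\mathtt g,\mathtt h\}$. Direction graphs. Let $A_1=\begin{pmatrix}0&1\\1&0\end{pmatrix}$, $A_2=\begin{pmatrix}1&0\\0&1\end{pmatrix}$,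 $A_3=\begin{pmatrix}-1&0\\0&1\end{pmatrix}$, $A_4=\begin{pmatrix}0&-1\\1&0\end{pmatrix}$, and $A_{i+4}=-A_i$ for $i=1,\ldots,4$; these eight are the direction matrices. A move of a skew $(r,s)$-leaper, $r<s$, by a translation $v$ has (skew) direction $i\in\{1,\ldots,8\}$ if $v^T=A_i\binom rs$. A direction graph is a symmetric directed graph whose arcs are labeled with skew directions so that the sum of the associated direction matrices over every simple directed cycle (including two-cycles) is zero. Direction graphs are considered up to label-preserving isomorphism. The direction graph extracted from a cycle of a skew leaper whose direction matrices sum to zero has the squares of the cycle as vertices and, for each pair of consecutive squares $a,b$, an arc from $a$ to $b$ and an arc from $b$ to $a$, each labeled with the direction of the corresponding move. Fundamental direction cycles. $\Phi(e)$ is the direction graph extracted from a cycle of descent $e$ of a skew basic $(p,q)$-leaper within a $(p+q)\times(p+q)$ chessboard; it exists and depends only on $e$. For $o\in\{\mathtt g,\mathtt h\}$, $\Phi^{\mathrm{II}}_o(e)$ is the direction graph extracted from a canonical second leaper cycle of descent $e$ and origin $o$ of a skew basic canonical second leaper; it exists and depends only on $e$ and $o$. Duality. For vertices $x,y$ in the same connected component of a direction graph, the distance from $x$ to $y$ is the sum of the direction matrices along any path from $x$ to $y$ (it does not depend on the path). A direction graph is coherent if, for all such $x,y$, the distance from $x$ to $y$ is the zero matrix if and only if $x=y$, and is a direction matrix if and only if $x$ and $y$ are joined by an arc. A direction graph $\Phi$ is dual if there exist a direction graph $\Phi'$ (a complement of $\Phi$), a one-to-one mapping $\eta$ between the vertex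 sets of $\Phi$ and $\Phi'$, and a real $2\times2$ matrix $A_{\mathrm{Dual}}$ (the duality matrix), distinct from all direction matrices, such that: $\Phi$ and $\Phi'$ are coherent and connected; the unlabeled symmetric directed graphs underlying $\Phi$ and $\Phi'$ are isomorphic; and for every arc from $\eta(a)$ to $\eta(b)$ labeled $i$ in $\Phi'$, the distance from $a$ to $b$ in $\Phi$ equals $A_iA_{\mathrm{Dual}}$. *)

theory Defs
  imports "HOL-Analysis.Analysis" "Graph_Theory.Graph_Theory"
begin

datatype lifting = Lf | Lg | Lh

abbreviation mat2 :: "real \<Rightarrow> real \<Rightarrow> real \<Rightarrow> real \<Rightarrow> real^2^2" where
  "mat2 a b c d \<equiv> vector [vector [a, b], vector [c, d]]"

fun lifting_matrix :: "lifting \<Rightarrow> real^2^2" where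
  "lifting_matrix Lf = mat2 1 0 2 1"
| "lifting_matrix Lg = mat2 0 1 (-1) 2"
| "lifting_matrix Lh = mat2 0 1 1 2"

definition string_matrix :: "lifting list \<Rightarrow> real^2^2" where
  "string_matrix e = foldr (\<lambda>x M. lifting_matrix x ** M) e (mat 1)"

fun lift_proportions :: "lifting \<Rightarrow> int \<times> int \<Rightarrow> int \<times> int" where
  "lift_proportions Lf (m, n) = (m, 2 * m + n)"
| "lift_proportions Lg (m, n) = (n, 2 * n - m)"
| "lift_proportions Lh (m, n) = (n, m + 2 * n)"

text \<open>The head of a string is applied last; \<open>(1, 2)\<close> is the proportions of the empty descent.\<close>

definition proportions :: "lifting list \<Rightarrow> int \<times> int" where
  "proportions d = foldr lift_proportions d (1, 2)"

type_synonym square = "int \<times> int"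

definition leaper_moves :: "int \<Rightarrow> int \<Rightarrow> square set" where
  "leaper_moves p q =
     {v. \<exists>a \<in> {1, -1}. \<exists>b \<in> {1, -1}. v = (a * p, b * q) \<or> v = (a * q, b * p)}"

definition leaper_graph :: "int \<Rightarrow> int \<Rightarrow> square set \<Rightarrow> square pair_pre_digraph" where
  "leaper_graph p q B =
     \<lparr>pverts = B, parcs = {(a, b). a \<in> B \<and> b \<in> B \<and> b - a \<in> leaper_moves p q}\<rparr>"

definition leaper_cycle :: "int \<Rightarrow> int \<Rightarrow> square set \<Rightarrow> square list \<Rightarrow> bool" where
  "leaper_cycle p q B c \<longleftrightarrow>
     3 \<le> length c \<and> distinct c \<and> set c \<subseteq> pverts (leaper_graph p q B) \<and>
     (\<forall>i < length c. (c ! i, c ! (Suc i mod length c)) \<in> parcs (leaper_graph p q B))"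

definition basic_leaper :: "int \<Rightarrow> int \<Rightarrow> bool" where
  "basic_leaper p q \<longleftrightarrow> 0 \<le> p \<and> 0 \<le> q \<and> odd (p + q) \<and> coprime p q"

definition skew_leaper :: "int \<Rightarrow> int \<Rightarrow> bool" where
  "skew_leaper p q \<longleftrightarrow> p \<noteq> 0 \<and> q \<noteq> 0 \<and> p \<noteq> q"

definition leaper_descent :: "int \<Rightarrow> int \<Rightarrow> lifting list \<Rightarrow> bool" where
  "leaper_descent p q d \<longleftrightarrow>
     basic_leaper p q \<and> skew_leaper p q \<and> p < q \<and> proportions d = (p, q)"

text \<open>
  Boards and frames are centred at the origin and squares are identified with their
  centres.  Bounds that are halves of odd integers are cleared of denominators.
\<close>

definition board :: "int \<Rightarrow> int \<Rightarrow> square set" where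
  "board p q = {(x, y). 2 * max \<bar>x\<bar> \<bar>y\<bar> < p + q}"

fun frame :: "int \<times> int \<Rightarrow> square set" where
  "frame (m, n) = {(x, y). n - m < 2 * max \<bar>x\<bar> \<bar>y\<bar> \<and> 2 * max \<bar>x\<bar> \<bar>y\<bar> < m + n}"

fun rot90 :: "square \<Rightarrow> square" where
  "rot90 (x, y) = (- y, x)"

text \<open>Directions E, NE, N, NW, W, SW, S, SE are numbered 0 to 7.\<close>

fun frame_section :: "int \<times> int \<Rightarrow> nat \<Rightarrow> square set" where
  "frame_section (m, n) i = (rot90 ^^ (i div 2)) `
     (if even i then {(x, y). n - m < 2 * x \<and> 2 * x < m + n \<and> 2 * \<bar>y\<bar> < n - m}
      else {(x, y). n - m < 2 * x \<and> 2 * x < m + n \<and> n - m < 2 * y \<and> 2 * y < m + n})"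

definition direction_unit :: "nat \<Rightarrow> square" where
  "direction_unit i = (rot90 ^^ (i div 2)) (if even i then (1, 0) else (1, 1))"

fun lift_coeff :: "lifting \<Rightarrow> int \<times> int \<Rightarrow> nat \<Rightarrow> int" where
  "lift_coeff Lf (m, n) i = (if even i then m + n else m)"
| "lift_coeff Lg (m, n) i = (if even i then n - m else n)"
| "lift_coeff Lh (m, n) i = (if even i then m + n else n)"

definition lift_vec :: "lifting \<Rightarrow> int \<times> int \<Rightarrow> nat \<Rightarrow> square" where
  "lift_vec x P i =
     (lift_coeff x P i * fst (direction_unit i), lift_coeff x P i * snd (direction_unit i))"

definition lift_set :: "lifting \<Rightarrow> int \<times> int \<Rightarrow> square set \<Rightarrow> square set" where
  "lift_set x P S =
     (\<Union>i<8. ((\<lambda>z. z + lift_vec x P i) ` S) \<inter> frame_section (lift_proportions x P) i)"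

text \<open>
  In the iterated lifts below, \<open>t\<close> is the descent of the frame one starts from
  and \<open>e\<close> lists the lifting types, the last one being applied first.
\<close>

primrec lift_sets :: "lifting list \<Rightarrow> lifting list \<Rightarrow> square set \<Rightarrow> square set" where
  "lift_sets [] t S = S"
| "lift_sets (x # e) t S = lift_set x (proportions (e @ t)) (lift_sets e t S)"

text \<open>
  Case \<open>n \<le> 2 m\<close>: side \<open>n - m\<close>, four subboards side-adjacent to the hole and four corners.
  Otherwise: side \<open>3 m - n\<close>, four in the middle of the outer sides and four
  corner-adjacent to the hole.
\<close>

fun shell :: "int \<times> int \<Rightarrow> square set" where
  "shell (m, n) = (\<Union>k<4. (rot90 ^^ k) `
     (if n \<le> 2 * m then
        {(x, y). n - m < 2 * x \<and> 2 * x < 3 * (n - m) \<and> 2 * \<bar>y\<bar> < n - m} \<union>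
        {(x, y). 3 * m - n < 2 * x \<and> 2 * x < m + n \<and> 3 * m - n < 2 * y \<and> 2 * y < m + n}
      else
        {(x, y). 3 * n - 5 * m < 2 * x \<and> 2 * x < m + n \<and> 2 * \<bar>y\<bar> < 3 * m - n} \<union>
        {(x, y). n - m < 2 * x \<and> 2 * x < 5 * m - n \<and> n - m < 2 * y \<and> 2 * y < 5 * m - n}))"

fun shell_cycle :: "int \<times> int \<Rightarrow> square list \<Rightarrow> bool" where
  "shell_cycle (m, n) c \<longleftrightarrow>
     n \<le> 3 * m \<and> leaper_cycle m n (frame (m, n)) c \<and> length c = 8 \<and> set c \<subseteq> shell (m, n)"

text \<open>
  \<open>c\<close> is a cycle of the \<open>(p, q)\<close>-leaper of descent \<open>e @ t\<close>, obtained by lifts of types \<open>e\<close>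
  from the shell cycle \<open>c'\<close> of the frame of descent \<open>t\<close>; so \<open>c\<close> has descent \<open>e\<close>.
  The lift of a cycle is determined by its vertex set.
\<close>

definition lifted_shell_cycle ::
    "int \<Rightarrow> int \<Rightarrow> lifting list \<Rightarrow> lifting list \<Rightarrow> square list \<Rightarrow> square list \<Rightarrow> bool" where
  "lifted_shell_cycle p q e t c' c \<longleftrightarrow>
     leaper_descent p q (e @ t) \<and> shell_cycle (proportions t) c' \<and>
     leaper_cycle p q (board p q) c \<and> set c = lift_sets e t (set c')"

definition cycle_descent :: "int \<Rightarrow> int \<Rightarrow> square list \<Rightarrow> lifting list \<Rightarrow> bool" where
  "cycle_descent p q c e \<longleftrightarrow> (\<exists>t c'. lifted_shell_cycle p q e t c' c)"

definition shift_path :: "square \<Rightarrow> square list \<Rightarrow> square list" where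
  "shift_path v w = map (\<lambda>z. z + v) w"

fun lift_path :: "lifting \<Rightarrow> int \<times> int \<Rightarrow> (nat \<Rightarrow> square list) \<Rightarrow> nat \<Rightarrow> square list" where
  "lift_path Lf P a i = shift_path (lift_vec Lf P i)
     (if even i
      then rev (a ((i + 5) mod 8)) @ rev (a ((i + 4) mod 8)) @ rev (a ((i + 3) mod 8))
      else a i)"
| "lift_path Lg P a i = shift_path (lift_vec Lg P i)
     (if even i then a i
      else rev (a ((i + 5) mod 8)) @ rev (a ((i + 4) mod 8)) @ rev (a ((i + 3) mod 8)))"
| "lift_path Lh P a i = shift_path (lift_vec Lh P i)
     (if even i
      then rev (a ((i + 6) mod 8)) @ rev (a ((i + 5) mod 8)) @ rev (a ((i + 4) mod 8))
           @ rev (a ((i + 3) mod 8)) @ rev (a ((i + 2) mod 8))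
      else a ((i + 7) mod 8) @ a i @ a ((i + 1) mod 8))"

primrec lift_paths ::
    "lifting list \<Rightarrow> lifting list \<Rightarrow> (nat \<Rightarrow> square list) \<Rightarrow> nat \<Rightarrow> square list" where
  "lift_paths [] t a = a"
| "lift_paths (x # e) t a = lift_path x (proportions (e @ t)) (lift_paths e t a)"

text \<open>A shell cycle visits each section exactly once.\<close>

definition shell_paths :: "int \<times> int \<Rightarrow> square list \<Rightarrow> nat \<Rightarrow> square list" where
  "shell_paths P c' i = [THE z. z \<in> set c' \<and> z \<in> frame_section P i]"

text \<open>
  \<open>D\<close> is the canonical second leaper cycle, of descent \<open>e\<close> and origin \<open>ot\<close>, of the skew
  basic \<open>(r, s)\<close>-leaper over the squares of some cycle \<open>c\<close> of descent \<open>e\<close>.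
\<close>

definition canonical_second_cycle ::
    "lifting list \<Rightarrow> lifting \<Rightarrow> int \<Rightarrow> int \<Rightarrow> square list \<Rightarrow> bool" where
  "canonical_second_cycle e ot r s D \<longleftrightarrow>
     (\<exists>p q t c' c. lifted_shell_cycle p q e (ot # t) c' c \<and> leaper_descent r s t \<and>
        D = concat (map (lift_paths e (ot # t) (shell_paths (proportions (ot # t)) c')) [0..<8]))"

definition dirmat :: "nat \<Rightarrow> real^2^2" where
  "dirmat i =
     [mat2 0 1 1 0, mat2 1 0 0 1, mat2 (-1) 0 0 1, mat2 0 (-1) 1 0,
      - mat2 0 1 1 0, - mat2 1 0 0 1, - mat2 (-1) 0 0 1, - mat2 0 (-1) 1 0] ! (i - 1)"

definition skew_direction :: "int \<Rightarrow> int \<Rightarrow> square \<Rightarrow> nat \<Rightarrow> bool" where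
  "skew_direction r s v i \<longleftrightarrow> i \<in> {1..8} \<and>
     (vector [real_of_int (fst v), real_of_int (snd v)] :: real^2) =
       dirmat i *v vector [real_of_int r, real_of_int s]"

record 'v labeled_digraph =
  graph_of :: "'v pair_pre_digraph"
  label_of :: "'v \<times> 'v \<Rightarrow> nat"

definition walk_sum :: "'v labeled_digraph \<Rightarrow> ('v \<times> 'v) list \<Rightarrow> real^2^2" where
  "walk_sum \<Gamma> w = sum_list (map (\<lambda>a. dirmat (label_of \<Gamma> a)) w)"

text \<open>The cycles of \<open>pre_digraph\<close> are the simple directed cycles, including two-cycles.\<close>

definition direction_graph :: "'v labeled_digraph \<Rightarrow> bool" where
  "direction_graph \<Gamma> \<longleftrightarrow>
     pair_sym_digraph (graph_of \<Gamma>) \<and>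
     (\<forall>a \<in> parcs (graph_of \<Gamma>). label_of \<Gamma> a \<in> {1..8}) \<and>
     (\<forall>w. pre_digraph.cycle (with_proj (graph_of \<Gamma>)) w \<longrightarrow> walk_sum \<Gamma> w = 0)"

text \<open>
  Extraction is total; that the result is a direction graph (equivalently, that the
  direction matrices of the moves sum to zero) is not built into it.
\<close>

definition extracted :: "int \<Rightarrow> int \<Rightarrow> square list \<Rightarrow> square labeled_digraph" where
  "extracted r s c =
     \<lparr>graph_of =
        \<lparr>pverts = set c,
         parcs = {(a, b). \<exists>i < length c. {a, b} = {c ! i, c ! (Suc i mod length c)}}\<rparr>,
      label_of = (\<lambda>(a, b). THE i. skew_direction r s (b - a) i)\<rparr>"

text \<open>
  Fundamental direction cycles are defined up to label-preserving isomorphism; the following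
  predicates characterize their representatives extracted from actual leaper cycles.
\<close>

definition fundamental_direction_cycle ::
    "lifting list \<Rightarrow> square labeled_digraph \<Rightarrow> bool" where
  "fundamental_direction_cycle e \<Gamma> \<longleftrightarrow>
     (\<exists>p q c. cycle_descent p q c e \<and> \<Gamma> = extracted p q c)"

definition second_fundamental_direction_cycle ::
    "lifting \<Rightarrow> lifting list \<Rightarrow> square labeled_digraph \<Rightarrow> bool" where
  "second_fundamental_direction_cycle ot e \<Gamma> \<longleftrightarrow>
     (\<exists>r s D. canonical_second_cycle e ot r s D \<and> \<Gamma> = extracted r s D)"

text \<open>In a direction graph the sum does not depend on the path.\<close>

definition distance :: "'v labeled_digraph \<Rightarrow> 'v \<Rightarrow> 'v \<Rightarrow> real^2^2" where
  "distance \<Gamma> x y =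
     (THE M. \<exists>w. pre_digraph.apath (with_proj (graph_of \<Gamma>)) x w y \<and> M = walk_sum \<Gamma> w)"

definition coherent :: "'v labeled_digraph \<Rightarrow> bool" where
  "coherent \<Gamma> \<longleftrightarrow>
     (\<forall>x y. x \<rightarrow>\<^sup>*\<^bsub>with_proj (graph_of \<Gamma>)\<^esub> y \<longrightarrow>
        (distance \<Gamma> x y = 0 \<longleftrightarrow> x = y) \<and>
        (distance \<Gamma> x y \<in> dirmat ` {1..8} \<longleftrightarrow> (x, y) \<in> parcs (graph_of \<Gamma>)))"

text \<open>\<open>\<Gamma>'\<close> is a complement of \<open>\<Gamma>\<close>, the duality matrix of \<open>\<Gamma>\<close> being \<open>A\<close>.\<close>

definition complement_with ::
    "real^2^2 \<Rightarrow> 'v labeled_digraph \<Rightarrow> 'w labeled_digraph \<Rightarrow> bool" where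
  "complement_with A \<Gamma> \<Gamma>' \<longleftrightarrow>
     direction_graph \<Gamma> \<and> direction_graph \<Gamma>' \<and> A \<notin> dirmat ` {1..8} \<and>
     coherent \<Gamma> \<and> coherent \<Gamma>' \<and>
     Digraph_Component.connected (with_proj (graph_of \<Gamma>)) \<and>
     Digraph_Component.connected (with_proj (graph_of \<Gamma>')) \<and>
     digraph_iso (with_proj (graph_of \<Gamma>)) (with_proj (graph_of \<Gamma>')) \<and>
     (\<exists>\<eta>. bij_betw \<eta> (pverts (graph_of \<Gamma>)) (pverts (graph_of \<Gamma>')) \<and>
        (\<forall>a \<in> pverts (graph_of \<Gamma>). \<forall>b \<in> pverts (graph_of \<Gamma>).
           (\<eta> a, \<eta> b) \<in> parcs (graph_of \<Gamma>') \<longrightarrow>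
           distance \<Gamma> a b = dirmat (label_of \<Gamma>' (\<eta> a, \<eta> b)) ** A))"

text \<open>
  As the vertex sets are in bijection, the complement may be taken to have the same
  vertex type.
\<close>

definition dual_graph :: "'v labeled_digraph \<Rightarrow> bool" where
  "dual_graph \<Gamma> \<longleftrightarrow> (\<exists>(\<Gamma>' :: 'v labeled_digraph) A. complement_with A \<Gamma> \<Gamma>')"

end

theory Submission
  imports Defs
begin

text \<open>A square of a cycle of descent \<open>e\<close> that is lifted from a shell cycle in a frame of proportions
  \<open>(m, n)\<close> has the form \<open>c + N (m, n)\<close>, where \<open>c\<close> depends on the shell cycle only and \<open>N\<close> is an
  integer matrix: the lifting vectors are linear in the proportions, and the proportions are
  linear in \<open>(m, n)\<close>.  The list of the matrices \<open>N\<close>, in the order of the canonical second leaper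
  cycle, depends on \<open>e\<close> alone; it is called \<open>word e\<close> below.  The leaper of the cycle has proportions
  \<open>(p, q) = A\<^sub>e (m, n)\<close>, and \<open>(m, n) = A\<^sub>o (r, s)\<close> where \<open>(r, s)\<close> is the second leaper.  Hence
  \<open>N A\<^sub>e\<^sup>-\<^sup>1\<close> is a potential for the distances of the fundamental direction cycle, and \<open>N A\<^sub>o\<close> is
  one for those of the second fundamental direction cycle.  Matching vertices with equal \<open>N\<close> makes
  \<open>A\<^sub>e A\<^sub>o\<close> and its inverse the duality matrices.  What has to be proved is that in both graphs the arcs
  are exactly the pairs whose potentials differ by a direction matrix.

  For the first leaper, a square in a given section of the frame has only two moves that stay in the
  frame.  The set of all \<open>N\<close> is closed under the symbolic versions of these two moves
  (\<open>strands_closed\<close>), so every leaper move inside the cycle has the expected symbolic difference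
  (\<open>fundamental_potential\<close>).  This also gives the Hamiltonicity of lifted vertex sets:
  they are two-regular, and connectedness is inherited by lifts (\<open>connected_lift_strand\<close>,
  \<open>two_regular_connected_cycle\<close>).

  For the second leaper, consecutive elements of \<open>word e\<close> differ by a symbolic move
  (\<open>steps_in_strands\<close>).  Conversely, a symbolic move becomes a unit step when \<open>(r, s)\<close>
  is specialised to \<open>(0, 1)\<close>, that is, when \<open>(m, n) = (1, 2)\<close>.  For this specialisation it is shown by
  induction on \<open>e\<close> that two squares of the cycle at unit distance are consecutive
  (\<open>tight_and_sectioned\<close>).  Inside a section this is inherited from the smaller frame.
  When the unit step crosses the border of two sections, undoing the lift separates its two
  ends by a leaper move and a unit step; since the leaper move ends in the smaller cycle again, the
  unit step joins two squares of the smaller cycle and crosses a border there, so there is only one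
  candidate, and the links between the ends of the strands (\<open>linked\<close>) identify it with the
  desired pair.\<close>

section \<open>Lifting over an abelian group\<close>

text \<open>Lifts are formulated for squares with coordinates in an abelian group.  The integers give
  the squares of the chessboard, and \<open>int \<times> int\<close>, read as the linear forms in two
  indeterminates, gives symbolic squares, which are then \<open>2 \<times> 2\<close> integer matrices.\<close>

\<comment> \<open>Indices of sections stay numerals, so that \<open>1\<close> must not be rewritten to \<open>Suc 0\<close>.\<close>
declare One_nat_def [simp del] add_2_eq_Suc [simp del] add_2_eq_Suc' [simp del]

text \<open>The quarter turn about the origin, counterclockwise.\<close>

definition turn :: "'a::ab_group_add \<times> 'a \<Rightarrow> 'a \<times> 'a" where
  "turn z = (- snd z, fst z)"

text \<open>The proportions of the frame obtained by one lift, and by the lifts of a string whose last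
  character is applied first.\<close>

fun next_prop :: "lifting \<Rightarrow> 'a::ab_group_add \<times> 'a \<Rightarrow> 'a \<times> 'a" where
  "next_prop Lf (P, Q) = (P, P + P + Q)"
| "next_prop Lg (P, Q) = (Q, Q + Q - P)"
| "next_prop Lh (P, Q) = (Q, P + Q + Q)"

primrec props :: "lifting list \<Rightarrow> 'a::ab_group_add \<times> 'a \<Rightarrow> 'a \<times> 'a" where
  "props [] B = B"
| "props (x # e) B = next_prop x (props e B)"

text \<open>The lift translates by \<open>offset_coeff\<close> along the direction \<open>i\<close>; directions are numbered
  counterclockwise from \<open>0\<close> (east) to \<open>7\<close> (south-east).\<close>

fun offset_coeff :: "lifting \<Rightarrow> 'a::ab_group_add \<times> 'a \<Rightarrow> nat \<Rightarrow> 'a" where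
  "offset_coeff Lf (P, Q) i = (if even i then P + Q else P)"
| "offset_coeff Lg (P, Q) i = (if even i then Q - P else Q)"
| "offset_coeff Lh (P, Q) i = (if even i then P + Q else Q)"

definition along :: "nat \<Rightarrow> 'a::ab_group_add \<Rightarrow> 'a \<times> 'a" where
  "along i c = (turn ^^ (i div 2)) (if even i then (c, 0) else (c, c))"

definition offset :: "lifting \<Rightarrow> 'a::ab_group_add \<times> 'a \<Rightarrow> nat \<Rightarrow> 'a \<times> 'a" where
  "offset x B i = along i (offset_coeff x B i)"

text \<open>The sections \<open>sources x i\<close> of the small frame are the ones whose squares are translated into
  section \<open>i\<close> of the lifted frame, in the order in which a canonical second leaper cycle visits
  the copies.  They are traversed backwards if \<open>reversing x i\<close>.\<close>

fun sources :: "lifting \<Rightarrow> nat \<Rightarrow> nat list" where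
  "sources Lf i = (if even i then [(i + 5) mod 8, (i + 4) mod 8, (i + 3) mod 8] else [i])"
| "sources Lg i = (if even i then [i] else [(i + 5) mod 8, (i + 4) mod 8, (i + 3) mod 8])"
| "sources Lh i = (if even i
     then [(i + 6) mod 8, (i + 5) mod 8, (i + 4) mod 8, (i + 3) mod 8, (i + 2) mod 8]
     else [(i + 7) mod 8, i, (i + 1) mod 8])"

definition reversing :: "lifting \<Rightarrow> nat \<Rightarrow> bool" where
  "reversing x i \<longleftrightarrow> (even i \<longleftrightarrow> x \<noteq> Lg)"

definition lift_strand ::
    "lifting \<Rightarrow> 'a::ab_group_add \<times> 'a \<Rightarrow> (nat \<Rightarrow> ('a \<times> 'a) list) \<Rightarrow> nat \<Rightarrow> ('a \<times> 'a) list" where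
  "lift_strand x B a i = map (\<lambda>z. z + offset x B i)
     (concat (map (\<lambda>j. if reversing x i then rev (a j) else a j) (sources x i)))"

text \<open>The squares of a shell cycle relative to its centre, and the eight paths obtained from them
  by lifting.\<close>

fun start :: "'a::ab_group_add \<times> 'a \<Rightarrow> nat \<Rightarrow> 'a \<times> 'a" where
  "start (P, Q) i = along i (if even i then Q - P else P)"

primrec strands ::
    "lifting list \<Rightarrow> 'a::ab_group_add \<times> 'a \<Rightarrow> nat \<Rightarrow> ('a \<times> 'a) list" where
  "strands [] B = (\<lambda>i. [start B i])"
| "strands (x # e) B = lift_strand x (props e B) (strands e B)"

lemma turn_Pair [simp]: "turn (x, y) = (- y, x)"
  by (simp add: turn_def)

lemma turn_add: "turn (z + w) = turn z + turn w"
  by (simp add: turn_def prod_eq_iff)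

lemma turn_diff: "turn (z - w) = turn z - turn w"
  by (simp add: turn_def prod_eq_iff)

lemma turn_eq_iff [simp]: "turn z = turn w \<longleftrightarrow> z = w"
  by (auto simp: turn_def prod_eq_iff)

lemma turn_4 [simp]: "turn (turn (turn (turn z))) = z"
  by (simp add: turn_def)

lemma less_8_cases:
  fixes i :: nat
  assumes "i < 8"
  shows "i = 0 \<or> i = 1 \<or> i = 2 \<or> i = 3 \<or> i = 4 \<or> i = 5 \<or> i = 6 \<or> i = 7"
  using assms by linarith

lemma lessThan_8: "{..<8} = {0, 1, 2, 3, 4, 5, 6, 7::nat}"
  using less_8_cases by auto

lemma all_less_8:
  "(\<forall>i<8. P i) \<longleftrightarrow> P 0 \<and> P 1 \<and> P 2 \<and> P 3 \<and> P 4 \<and> P 5 \<and> P 6 \<and> P (7::nat)"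
proof -
  have "(\<forall>i<8. P i) \<longleftrightarrow> (\<forall>i\<in>{..<8}. P i)" by (auto simp: Ball_def)
  then show ?thesis unfolding lessThan_8 by simp
qed

lemma ex_less_8:
  "(\<exists>i<8. P i) \<longleftrightarrow> P 0 \<or> P 1 \<or> P 2 \<or> P 3 \<or> P 4 \<or> P 5 \<or> P 6 \<or> P (7::nat)"
  using all_less_8 [of "\<lambda>i. \<not> P i"] by blast

lemma turn_induct [consumes 1, case_names even odd turn]:
  fixes i :: nat
  assumes "i < 8" "P 0" "P 1" "\<And>i. i < 8 \<Longrightarrow> P i \<Longrightarrow> P ((i + 2) mod 8)"
  shows "P i"
proof -
  have "P 2" "P 3" using assms(4)[of 0] assms(4)[of 1] assms by auto
  moreover have "P 4" "P 5" using assms(4)[of 2] assms(4)[of 3] calculation by auto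
  moreover have "P 6" "P 7" using assms(4)[of 4] assms(4)[of 5] calculation by auto
  ultimately show ?thesis using less_8_cases [OF \<open>i < 8\<close>] assms(2,3) by auto
qed

lemma funpow_turn [simp]:
  "(turn ^^ 1) z = turn z" "(turn ^^ 2) z = turn (turn z)" "(turn ^^ 3) z = turn (turn (turn z))"
  by (simp_all add: numeral_eq_Suc One_nat_def)

lemma along_simps [simp]:
  "along 0 c = (c, 0)" "along 1 c = (c, c)" "along 2 c = (0, c)" "along 3 c = (- c, c)"
  "along 4 c = (- c, 0)" "along 5 c = (- c, - c)" "along 6 c = (0, - c)" "along 7 c = (c, - c)"
  by (simp_all add: along_def)

lemma turn_along: "i < 8 \<Longrightarrow> along ((i + 2) mod 8) c = turn (along i c)"
  by (drule less_8_cases) auto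

lemma turn_offset: "i < 8 \<Longrightarrow> offset x B ((i + 2) mod 8) = turn (offset x B i)"
proof -
  assume i: "i < 8"
  have "offset_coeff x B ((i + 2) mod 8) = offset_coeff x B i"
    by (cases x; cases B) (use less_8_cases [OF i] in auto)
  then show ?thesis by (simp add: offset_def turn_along i)
qed

lemma sources_turn:
  "i < 8 \<Longrightarrow> sources x ((i + 2) mod 8) = map (\<lambda>j. (j + 2) mod 8) (sources x i)"
  by (drule less_8_cases; cases x) auto

lemma sources_less: "i < 8 \<Longrightarrow> j \<in> set (sources x i) \<Longrightarrow> j < 8"
  by (cases x) (auto split: if_splits)

lemma reversing_turn: "reversing x ((i + 2) mod 8) = reversing x i"
proof -
  have "even ((i + 2) mod 8) = even i" by presburger
  then show ?thesis by (simp add: reversing_def)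
qed

text \<open>Invariance of eight paths under the quarter turn.\<close>

definition turning :: "(nat \<Rightarrow> ('a::ab_group_add \<times> 'a) list) \<Rightarrow> bool" where
  "turning a \<longleftrightarrow> (\<forall>i<8. a ((i + 2) mod 8) = map turn (a i))"

lemma turning_lift_strand:
  assumes "turning a"
  shows "turning (lift_strand x B a)"
  unfolding turning_def
proof (intro allI impI)
  fix i :: nat assume i: "i < 8"
  have "concat (map (\<lambda>j. if reversing x ((i + 2) mod 8) then rev (a j) else a j) (sources x ((i + 2) mod 8)))
     = map turn (concat (map (\<lambda>j. if reversing x i then rev (a j) else a j) (sources x i)))"
    using assms sources_less [OF i, of _ x]
    by (auto simp: turning_def sources_turn i reversing_turn map_concat rev_map comp_def
        intro!: arg_cong [where f = concat] map_cong)
  then show "lift_strand x B a ((i + 2) mod 8) = map turn (lift_strand x B a i)"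
    by (simp add: lift_strand_def turn_offset i comp_def turn_add)
qed

lemma turning_strands: "turning (strands e B)"
proof (induction e)
  case Nil
  have "start B ((i + 2) mod 8) = turn (start B i)" if "i < 8" for i
    by (cases B) (use less_8_cases [OF that] in auto)
  then show ?case by (simp add: turning_def)
qed (simp add: turning_lift_strand)

lemma strands_ne:
  assumes "i < 8"
  shows "strands e B i \<noteq> []"
  using assms
proof (induction e arbitrary: i)
  case (Cons x e)
  have "\<exists>j\<in>set (sources x i). j < 8"
    using Cons.prems by (cases x) auto
  then show ?case using Cons.IH
    by (auto simp: lift_strand_def split: if_splits)
qed simp

text \<open>The moves of the leaper with proportions \<open>B\<close>, as vectors.\<close>

definition moves :: "'a::ab_group_add \<times> 'a \<Rightarrow> ('a \<times> 'a) set" where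
  "moves B = (\<lambda>(P, Q). {(P, Q), (P, - Q), (- P, Q), (- P, - Q), (Q, P), (Q, - P), (- Q, P), (- Q, - P)}) B"

lemma turn_moves: "d \<in> moves B \<Longrightarrow> turn d \<in> moves B"
  by (auto simp: moves_def split: prod.splits)

lemma uminus_moves: "d \<in> moves B \<Longrightarrow> - d \<in> moves B"
  by (auto simp: moves_def split: prod.splits)

text \<open>The two moves from section \<open>i\<close> that stay within the frame.  The left one ends in
  section \<open>i + 3\<close> or \<open>i + 4\<close>, the right one in section \<open>i + 4\<close> or \<open>i + 5\<close>.\<close>

definition left_move :: "'a::ab_group_add \<times> 'a \<Rightarrow> nat \<Rightarrow> 'a \<times> 'a" where
  "left_move B i = (turn ^^ (i div 2)) (- snd B, if even i then fst B else - fst B)"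

definition right_move :: "'a::ab_group_add \<times> 'a \<Rightarrow> nat \<Rightarrow> 'a \<times> 'a" where
  "right_move B i = (turn ^^ (i div 2)) (if even i then (- snd B, - fst B) else (- fst B, - snd B))"

lemma left_move_simps [simp]:
  "left_move (P, Q) 0 = (- Q, P)" "left_move (P, Q) 1 = (- Q, - P)"
  "left_move (P, Q) 2 = (- P, - Q)" "left_move (P, Q) 3 = (P, - Q)"
  "left_move (P, Q) 4 = (Q, - P)" "left_move (P, Q) 5 = (Q, P)"
  "left_move (P, Q) 6 = (P, Q)" "left_move (P, Q) 7 = (- P, Q)"
  by (simp_all add: left_move_def)

lemma right_move_simps [simp]:
  "right_move (P, Q) 0 = (- Q, - P)" "right_move (P, Q) 1 = (- P, - Q)"
  "right_move (P, Q) 2 = (P, - Q)" "right_move (P, Q) 3 = (Q, - P)"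
  "right_move (P, Q) 4 = (Q, P)" "right_move (P, Q) 5 = (P, Q)"
  "right_move (P, Q) 6 = (- P, Q)" "right_move (P, Q) 7 = (- Q, P)"
  by (simp_all add: right_move_def)

lemma turn_left_move: "i < 8 \<Longrightarrow> left_move B ((i + 2) mod 8) = turn (left_move B i)"
  and turn_right_move: "i < 8 \<Longrightarrow> right_move B ((i + 2) mod 8) = turn (right_move B i)"
  by (drule less_8_cases; cases B; auto)+

lemma left_move_in_moves: "i < 8 \<Longrightarrow> left_move B i \<in> moves B"
  and right_move_in_moves: "i < 8 \<Longrightarrow> right_move B i \<in> moves B"
  by (drule less_8_cases; cases B; auto simp: moves_def)+

definition closed_strands ::
    "'a::ab_group_add \<times> 'a \<Rightarrow> (nat \<Rightarrow> ('a \<times> 'a) list) \<Rightarrow> bool" where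
  "closed_strands B a \<longleftrightarrow> (\<forall>i<8. \<forall>z\<in>set (a i).
     z + left_move B i \<in> set (a ((i + 3) mod 8)) \<union> set (a ((i + 4) mod 8)) \<and>
     z + right_move B i \<in> set (a ((i + 4) mod 8)) \<union> set (a ((i + 5) mod 8)))"

lemma turning_mem:
  assumes "turning a" "i < 8"
  shows "turn z \<in> set (a ((i + 2) mod 8)) \<longleftrightarrow> z \<in> set (a i)"
  using assms by (simp add: turning_def inj_image_mem_iff inj_def)

lemma mem_lift_strand:
  "z \<in> set (lift_strand x B a i) \<longleftrightarrow> (\<exists>j\<in>set (sources x i). z - offset x B i \<in> set (a j))"
proof -
  have "z \<in> set (lift_strand x B a i) \<longleftrightarrow>
      (\<exists>j\<in>set (sources x i). \<exists>w\<in>set (a j). z = w + offset x B i)"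
    by (auto simp: lift_strand_def)
  then show ?thesis by (metis add_diff_cancel diff_add_cancel)
qed

lemma offset_simps [simp]:
  "offset x B 0 = (offset_coeff x B 0, 0)"
  "offset x B 1 = (offset_coeff x B 1, offset_coeff x B 1)"
  "offset x B 2 = (0, offset_coeff x B 0)"
  "offset x B 3 = (- offset_coeff x B 1, offset_coeff x B 1)"
  "offset x B 4 = (- offset_coeff x B 0, 0)"
  "offset x B 5 = (- offset_coeff x B 1, - offset_coeff x B 1)"
  "offset x B 6 = (0, - offset_coeff x B 0)"
  "offset x B 7 = (offset_coeff x B 1, - offset_coeff x B 1)"
  by (cases x; cases B; simp add: offset_def)+

text \<open>Undoing the lift, the end of a move from a copy of \<open>w\<close> is another copy of \<open>w\<close>
  or a copy of a neighbour of \<open>w\<close>.  By symmetry it suffices to consider the sections \<open>0\<close> and \<open>1\<close>.\<close>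

lemma closed_lift_strand:
  assumes t: "turning a" and c: "closed_strands (P, Q) a"
  shows "closed_strands (next_prop x (P, Q)) (lift_strand x (P, Q) a)"
  unfolding closed_strands_def
proof (intro allI impI)
  fix i :: nat
  let ?b = "lift_strand x (P, Q) a" and ?B = "next_prop x (P, Q)"
  let ?C = "\<lambda>i. \<forall>z\<in>set (?b i).
    z + left_move ?B i \<in> set (?b ((i + 3) mod 8)) \<union> set (?b ((i + 4) mod 8)) \<and>
    z + right_move ?B i \<in> set (?b ((i + 4) mod 8)) \<union> set (?b ((i + 5) mod 8))"
  have c': "\<And>i. i < 8 \<Longrightarrow> z \<in> set (a i) \<Longrightarrow>
     z + left_move (P, Q) i \<in> set (a ((i + 3) mod 8)) \<union> set (a ((i + 4) mod 8)) \<and>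
     z + right_move (P, Q) i \<in> set (a ((i + 4) mod 8)) \<union> set (a ((i + 5) mod 8))" for z
    using c unfolding closed_strands_def by blast
  assume "i < 8"
  then show "?C i"
  proof (induction rule: turn_induct)
    case even
    show ?case
    proof
      fix z assume "z \<in> set (?b 0)"
      then obtain j w where j: "j \<in> set (sources x 0)" and w: "w \<in> set (a j)"
          and z: "z = w + offset x (P, Q) 0"
        by (auto simp: lift_strand_def split: if_splits)
      show "z + left_move ?B 0 \<in> set (?b ((0 + 3) mod 8)) \<union> set (?b ((0 + 4) mod 8)) \<and>
        z + right_move ?B 0 \<in> set (?b ((0 + 4) mod 8)) \<union> set (?b ((0 + 5) mod 8))"
      proof (cases x)
        case Lf
        have e0: "z + left_move ?B 0 - offset x (P, Q) 3 = w"
          by (simp add: z Lf prod_eq_iff)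
        have e1: "z + left_move ?B 0 - offset x (P, Q) 4 = w + (Q, P)"
          by (simp add: z Lf prod_eq_iff)
        have e2: "z + right_move ?B 0 - offset x (P, Q) 5 = w"
          by (simp add: z Lf prod_eq_iff)
        have e3: "z + right_move ?B 0 - offset x (P, Q) 4 = w + (Q, - P)"
          by (simp add: z Lf prod_eq_iff)
        have m: "z + left_move ?B 0 \<in> set (?b 3) \<longleftrightarrow> (\<exists>j\<in>set (sources x 3). w \<in> set (a j))" "z + left_move ?B 0 \<in> set (?b 4) \<longleftrightarrow> (\<exists>j\<in>set (sources x 4). w + (Q, P) \<in> set (a j))" "z + right_move ?B 0 \<in> set (?b 5) \<longleftrightarrow> (\<exists>j\<in>set (sources x 5). w \<in> set (a j))" "z + right_move ?B 0 \<in> set (?b 4) \<longleftrightarrow> (\<exists>j\<in>set (sources x 4). w + (Q, - P) \<in> set (a j))"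
          by (simp_all only: mem_lift_strand e0 e1 e2 e3)
        have "j \<in> {3, 4, 5}" using j Lf by auto
        then show ?thesis using w c' [of j w] m Lf by auto
      next
        case Lg
        have e0: "z + left_move ?B 0 - offset x (P, Q) 3 = w"
          by (simp add: z Lg prod_eq_iff)
        have e2: "z + right_move ?B 0 - offset x (P, Q) 5 = w"
          by (simp add: z Lg prod_eq_iff)
        have m: "z + left_move ?B 0 \<in> set (?b 3) \<longleftrightarrow> (\<exists>j\<in>set (sources x 3). w \<in> set (a j))" "z + right_move ?B 0 \<in> set (?b 5) \<longleftrightarrow> (\<exists>j\<in>set (sources x 5). w \<in> set (a j))"
          by (simp_all only: mem_lift_strand e0 e2)
        have "j \<in> {0}" using j Lg by auto
        then show ?thesis using w c' [of j w] m Lg by auto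
      next
        case Lh
        have e0: "z + left_move ?B 0 - offset x (P, Q) 3 = w"
          by (simp add: z Lh prod_eq_iff)
        have e1: "z + left_move ?B 0 - offset x (P, Q) 4 = w + (P, Q)"
          by (simp add: z Lh prod_eq_iff)
        have e2: "z + right_move ?B 0 - offset x (P, Q) 5 = w"
          by (simp add: z Lh prod_eq_iff)
        have e3: "z + right_move ?B 0 - offset x (P, Q) 4 = w + (P, - Q)"
          by (simp add: z Lh prod_eq_iff)
        have m: "z + left_move ?B 0 \<in> set (?b 3) \<longleftrightarrow> (\<exists>j\<in>set (sources x 3). w \<in> set (a j))" "z + left_move ?B 0 \<in> set (?b 4) \<longleftrightarrow> (\<exists>j\<in>set (sources x 4). w + (P, Q) \<in> set (a j))" "z + right_move ?B 0 \<in> set (?b 5) \<longleftrightarrow> (\<exists>j\<in>set (sources x 5). w \<in> set (a j))" "z + right_move ?B 0 \<in> set (?b 4) \<longleftrightarrow> (\<exists>j\<in>set (sources x 4). w + (P, - Q) \<in> set (a j))"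
          by (simp_all only: mem_lift_strand e0 e1 e2 e3)
        have "j \<in> {2, 3, 4, 5, 6}" using j Lh by auto
        then show ?thesis using w c' [of j w] m Lh by auto
      qed
    qed
  next
    case odd
    show ?case
    proof
      fix z assume "z \<in> set (?b 1)"
      then obtain j w where j: "j \<in> set (sources x 1)" and w: "w \<in> set (a j)"
          and z: "z = w + offset x (P, Q) 1"
        by (auto simp: lift_strand_def split: if_splits)
      show "z + left_move ?B 1 \<in> set (?b ((1 + 3) mod 8)) \<union> set (?b ((1 + 4) mod 8)) \<and>
        z + right_move ?B 1 \<in> set (?b ((1 + 4) mod 8)) \<union> set (?b ((1 + 5) mod 8))"
      proof (cases x)
        case Lf
        have e0: "z + left_move ?B 1 - offset x (P, Q) 4 = w"
          by (simp add: z Lf prod_eq_iff)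
        have e2: "z + right_move ?B 1 - offset x (P, Q) 6 = w"
          by (simp add: z Lf prod_eq_iff)
        have m: "z + left_move ?B 1 \<in> set (?b 4) \<longleftrightarrow> (\<exists>j\<in>set (sources x 4). w \<in> set (a j))" "z + right_move ?B 1 \<in> set (?b 6) \<longleftrightarrow> (\<exists>j\<in>set (sources x 6). w \<in> set (a j))"
          by (simp_all only: mem_lift_strand e0 e2)
        have "j \<in> {1}" using j Lf by auto
        then show ?thesis using w c' [of j w] m Lf by auto
      next
        case Lg
        have e0: "z + left_move ?B 1 - offset x (P, Q) 4 = w"
          by (simp add: z Lg prod_eq_iff)
        have e1: "z + left_move ?B 1 - offset x (P, Q) 5 = w + (P, Q)"
          by (simp add: z Lg prod_eq_iff)
        have e2: "z + right_move ?B 1 - offset x (P, Q) 6 = w"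
          by (simp add: z Lg prod_eq_iff)
        have e3: "z + right_move ?B 1 - offset x (P, Q) 5 = w + (Q, P)"
          by (simp add: z Lg prod_eq_iff)
        have m: "z + left_move ?B 1 \<in> set (?b 4) \<longleftrightarrow> (\<exists>j\<in>set (sources x 4). w \<in> set (a j))" "z + left_move ?B 1 \<in> set (?b 5) \<longleftrightarrow> (\<exists>j\<in>set (sources x 5). w + (P, Q) \<in> set (a j))" "z + right_move ?B 1 \<in> set (?b 6) \<longleftrightarrow> (\<exists>j\<in>set (sources x 6). w \<in> set (a j))" "z + right_move ?B 1 \<in> set (?b 5) \<longleftrightarrow> (\<exists>j\<in>set (sources x 5). w + (Q, P) \<in> set (a j))"
          by (simp_all only: mem_lift_strand e0 e1 e2 e3)
        have "j \<in> {4, 5, 6}" using j Lg by auto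
        then show ?thesis using w c' [of j w] m Lg by auto
      next
        case Lh
        have e0: "z + left_move ?B 1 - offset x (P, Q) 4 = w"
          by (simp add: z Lh prod_eq_iff)
        have e2: "z + right_move ?B 1 - offset x (P, Q) 6 = w"
          by (simp add: z Lh prod_eq_iff)
        have m: "z + left_move ?B 1 \<in> set (?b 4) \<longleftrightarrow> (\<exists>j\<in>set (sources x 4). w \<in> set (a j))" "z + right_move ?B 1 \<in> set (?b 6) \<longleftrightarrow> (\<exists>j\<in>set (sources x 6). w \<in> set (a j))"
          by (simp_all only: mem_lift_strand e0 e2)
        have "j \<in> {0, 1, 2}" using j Lh by auto
        then show ?thesis using w c' [of j w] m Lh by auto
      qed
    qed
  next
    case (turn i)
    note tb = turning_lift_strand [OF t, of x "(P, Q)"]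
    have *: "(((i + 2) mod 8 + k) mod 8) = ((i + k) mod 8 + 2) mod 8" for k
      by (simp add: mod_simps ac_simps)
    show ?case
    proof
      fix z assume "z \<in> set (?b ((i + 2) mod 8))"
      then obtain w where w: "z = turn w" "w \<in> set (?b i)"
        using tb turn by (auto simp: turning_def)
      then show "z + left_move ?B ((i + 2) mod 8) \<in> set (?b (((i + 2) mod 8 + 3) mod 8)) \<union> set (?b (((i + 2) mod 8 + 4) mod 8)) \<and>
        z + right_move ?B ((i + 2) mod 8) \<in> set (?b (((i + 2) mod 8 + 4) mod 8)) \<union> set (?b (((i + 2) mod 8 + 5) mod 8))"
        using turn by (simp only: * turn_left_move turn_right_move flip: turn_add)
          (simp add: turning_mem [OF tb])
    qed
  qed
qed


lemma strands_closed: "closed_strands (props e B) (strands e B)"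
proof (induction e)
  case Nil
  show ?case
    by (cases B) (auto simp: closed_strands_def dest!: less_8_cases)
next
  case (Cons x e)
  then show ?case
    by (cases "props e B") (simp add: closed_lift_strand turning_strands)
qed

text \<open>The ends of the eight paths are joined by leaper moves: the left move leads from the last
  square of path \<open>i\<close> to the first square of path \<open>i + 3\<close>, and the right move from the first square of
  path \<open>i\<close> to the last square of path \<open>i + 5\<close>.\<close>

definition linked ::
    "'a::ab_group_add \<times> 'a \<Rightarrow> (nat \<Rightarrow> ('a \<times> 'a) list) \<Rightarrow> bool" where
  "linked B a \<longleftrightarrow> (\<forall>i<8.
     hd (a ((i + 3) mod 8)) = last (a i) + left_move B i \<and>
     last (a ((i + 5) mod 8)) = hd (a i) + right_move B i)"

lemma hd_lift_strand:
  assumes "\<And>j. j < 8 \<Longrightarrow> a j \<noteq> []" "i < 8"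
  shows "hd (lift_strand x B a i) =
    (if reversing x i then last (a (hd (sources x i))) else hd (a (hd (sources x i)))) + offset x B i"
proof -
  obtain j js where s: "sources x i = j # js" by (cases "sources x i"; cases x) (auto split: if_splits)
  then have "a j \<noteq> []" using assms sources_less [OF assms(2), of j x] by auto
  then show ?thesis by (auto simp: lift_strand_def s hd_append hd_map hd_rev)
qed

lemma last_lift_strand:
  assumes "\<And>j. j < 8 \<Longrightarrow> a j \<noteq> []" "i < 8"
  shows "last (lift_strand x B a i) =
    (if reversing x i then hd (a (last (sources x i))) else last (a (last (sources x i)))) + offset x B i"
proof -
  obtain j js where s: "sources x i = js @ [j]"
    by (cases "sources x i" rule: rev_cases; cases x) (auto split: if_splits)
  then have "a j \<noteq> []" using assms sources_less [OF assms(2), of j x] by auto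
  then show ?thesis by (auto simp: lift_strand_def s last_map last_rev)
qed

text \<open>A lift creates the links by itself; those of \<open>a\<close> play no role.\<close>

lemma linked_lift_strand:
  assumes "\<And>j. j < 8 \<Longrightarrow> a j \<noteq> []"
  shows "linked (next_prop x (P, Q)) (lift_strand x (P, Q) a)"
  unfolding linked_def
proof (intro allI impI)
  fix i :: nat assume "i < 8"
  then show "hd (lift_strand x (P, Q) a ((i + 3) mod 8)) =
           last (lift_strand x (P, Q) a i) + left_move (next_prop x (P, Q)) i \<and>
         last (lift_strand x (P, Q) a ((i + 5) mod 8)) =
           hd (lift_strand x (P, Q) a i) + right_move (next_prop x (P, Q)) i"
    using less_8_cases [OF \<open>i < 8\<close>]
    by (cases x; elim disjE; simp add: hd_lift_strand [OF assms] last_lift_strand [OF assms]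
        reversing_def add.assoc)
qed

lemma linked_strands: "linked (props e B) (strands e B)"
proof (cases e)
  case Nil
  then show ?thesis
    by (cases B) (auto simp: linked_def dest!: less_8_cases)
next
  case (Cons x e')
  then show ?thesis
    by (cases "props e' B") (simp add: linked_lift_strand strands_ne)
qed

text \<open>All steps of the closed path formed by eight paths, including those from one path to the
  next, belong to \<open>S\<close>.\<close>

definition steps_in ::
    "('a::ab_group_add \<times> 'a) set \<Rightarrow> (nat \<Rightarrow> ('a \<times> 'a) list) \<Rightarrow> bool" where
  "steps_in S a \<longleftrightarrow> (\<forall>i<8. successively (\<lambda>z w. w - z \<in> S) (a i) \<and>
     hd (a ((i + 1) mod 8)) - last (a i) \<in> S)"

text \<open>The step from one lifted path to the next is a translate of such a step of the original
  closed path.\<close>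

lemma joint_lift_strand:
  assumes "\<And>j. j < 8 \<Longrightarrow> a j \<noteq> []" "linked (P, Q) a" "i < 8"
  shows "\<exists>k<8. hd (lift_strand x (P, Q) a ((i + 1) mod 8)) - last (lift_strand x (P, Q) a i) =
    hd (a ((k + 1) mod 8)) - last (a k)"
proof -
  define k where "k = (if x \<noteq> Lh then i else if even i then (i + 7) mod 8 else (i + 1) mod 8)"
  have l: "\<And>i. i < 8 \<Longrightarrow> hd (a ((i + 3) mod 8)) = last (a i) + left_move (P, Q) i"
    "\<And>i. i < 8 \<Longrightarrow> last (a ((i + 5) mod 8)) = hd (a i) + right_move (P, Q) i"
    using assms(2) by (auto simp: linked_def)
  note ends = hd_lift_strand [OF assms(1)] last_lift_strand [OF assms(1)] reversing_def
  have "hd (lift_strand x (P, Q) a ((i + 1) mod 8)) - last (lift_strand x (P, Q) a i) =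
    hd (a ((k + 1) mod 8)) - last (a k)"
  proof (cases "even i")
    case True
    then have i': "i = 0 \<or> i = 2 \<or> i = 4 \<or> i = 6" using less_8_cases [OF \<open>i < 8\<close>] by auto
    show ?thesis
    proof (cases x)
      case Lf
      then show ?thesis using i' l(1) [of i]
        by (auto simp: k_def ends prod_eq_iff)
    next
      case Lg
      then show ?thesis using i' l(2) [of "(i + 1) mod 8"]
        by (auto simp: k_def ends prod_eq_iff)
    next
      case Lh
      then show ?thesis using i' l(1) [of "(i + 7) mod 8"]
        by (auto simp: k_def ends prod_eq_iff)
    qed
  next
    case False
    then have i': "i = 1 \<or> i = 3 \<or> i = 5 \<or> i = 7" using less_8_cases [OF \<open>i < 8\<close>] by auto
    show ?thesis
    proof (cases x)
      case Lf
      then show ?thesis using i' l(2) [of "(i + 1) mod 8"]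
        by (auto simp: k_def ends prod_eq_iff)
    next
      case Lg
      then show ?thesis using i' l(1) [of i]
        by (auto simp: k_def ends prod_eq_iff)
    next
      case Lh
      then show ?thesis using i' l(2) [of "(i + 2) mod 8"]
        by (auto simp: k_def ends prod_eq_iff)
    qed
  qed
  moreover have "k < 8" using \<open>i < 8\<close> by (simp add: k_def)
  ultimately show ?thesis by blast
qed

lemma steps_in_lift_strand:
  assumes ne: "\<And>j. j < 8 \<Longrightarrow> a j \<noteq> []" and l: "linked (P, Q) a"
    and S: "\<And>d. d \<in> S \<Longrightarrow> - d \<in> S" and s: "steps_in S a"
  shows "steps_in S (lift_strand x (P, Q) a)"
  unfolding steps_in_def
proof (intro allI impI conjI)
  fix i :: nat assume i: "i < 8"
  have Sm: "w - z \<in> S \<longleftrightarrow> z - w \<in> S" for z w using S by (metis minus_diff_eq)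
  have s': "\<And>i. i < 8 \<Longrightarrow> successively (\<lambda>z w. w - z \<in> S) (a i)"
    "\<And>i. i < 8 \<Longrightarrow> hd (a ((i + 1) mod 8)) - last (a i) \<in> S"
    using s by (auto simp: steps_in_def)
  have r: "\<And>i. i < 8 \<Longrightarrow> successively (\<lambda>z w. z - w \<in> S) (a i)"
    "\<And>i. i < 8 \<Longrightarrow> last (a i) - hd (a ((i + 1) mod 8)) \<in> S"
    using s' Sm by simp_all
  have s'': "\<forall>i<8. hd (a ((i + 1) mod 8)) - last (a i) \<in> S"
    and r'': "\<forall>i<8. last (a i) - hd (a ((i + 1) mod 8)) \<in> S"
    using s'(2) r(2) by blast+
  show "successively (\<lambda>z w. w - z \<in> S) (lift_strand x (P, Q) a i)"
    using less_8_cases [OF \<open>i < 8\<close>] s'' r'' unfolding all_less_8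
    by (cases x) (auto simp: lift_strand_def successively_map successively_append_iff
        s'(1) r(1) hd_append last_append hd_rev last_rev ne reversing_def)
  show "hd (lift_strand x (P, Q) a ((i + 1) mod 8)) - last (lift_strand x (P, Q) a i) \<in> S"
    using joint_lift_strand [OF ne l i, of x] s'(2) by metis
qed

text \<open>The move set is the one of the second leaper: if \<open>(P, Q) = A\<^sub>o (r, s)\<close>, then
  \<open>(2 P - Q, P)\<close> is \<open>(r, s)\<close> for the origin \<open>g\<close> and \<open>(- r, s)\<close> for the origin \<open>h\<close>.\<close>

lemma steps_in_strands:
  "steps_in (moves (P + P - Q, P)) (strands e (P, Q))"
proof (induction e)
  case Nil
  show ?case
    by (auto simp: steps_in_def moves_def dest!: less_8_cases)
next
  case (Cons x e)
  then show ?case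
    using linked_strands [of e "(P, Q)"]
    by (cases "props e (P, Q)") (simp add: steps_in_lift_strand strands_ne uminus_moves)
qed

text \<open>Connectedness is expressed by predicates: a predicate that is preserved by the moves is
  constant.\<close>

definition invariant_along ::
    "'a::ab_group_add \<times> 'a \<Rightarrow> (nat \<Rightarrow> ('a \<times> 'a) list) \<Rightarrow> ('a \<times> 'a \<Rightarrow> bool) \<Rightarrow> bool" where
  "invariant_along B a T \<longleftrightarrow> (\<forall>i<8. \<forall>z\<in>set (a i).
     (T z \<longleftrightarrow> T (z + left_move B i)) \<and> (T z \<longleftrightarrow> T (z + right_move B i)))"

definition connected_strands ::
    "'a::ab_group_add \<times> 'a \<Rightarrow> (nat \<Rightarrow> ('a \<times> 'a) list) \<Rightarrow> bool" where
  "connected_strands B a \<longleftrightarrow> (\<forall>T. invariant_along B a T \<longrightarrow>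
     (\<forall>i<8. \<forall>j<8. \<forall>z\<in>set (a i). \<forall>w\<in>set (a j). T z \<longleftrightarrow> T w))"

lemma offset_moves:
  assumes "i < 8"
  shows "offset x (P, Q) i + left_move (next_prop x (P, Q)) i = offset x (P, Q) ((i + 3) mod 8)"
    and "offset x (P, Q) i + right_move (next_prop x (P, Q)) i = offset x (P, Q) ((i + 5) mod 8)"
  using less_8_cases [OF assms] by (cases x; auto)+

text \<open>The copies of one square are connected by moves, because \<open>offset_moves\<close> turns a copy for
  direction \<open>i\<close> into those for \<open>i + 3\<close> and \<open>i + 5\<close>.\<close>

lemma copies_equal:
  fixes U :: "nat \<Rightarrow> 'c"
  assumes "j < 8" "i < 8" "k < 8" "j \<in> set (sources x i)" "j \<in> set (sources x k)"
    and "\<forall>i<8. j \<in> set (sources x i) \<longrightarrow> U i = U ((i + 3) mod 8) \<and> U i = U ((i + 5) mod 8)"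
  shows "U i = U k"
proof -
  have U: "U ((i + 3) mod 8) = U i" "U ((i + 5) mod 8) = U i" if "i < 8" "j \<in> set (sources x i)" for i
    using assms(6) that by auto
  consider "x = Lf \<and> even j \<or> x = Lg \<and> odd j"
    | "x = Lf \<and> odd j \<or> x = Lg \<and> even j \<or> x = Lh \<and> odd j" | "x = Lh" "even j"
    by (cases x) auto
  then show ?thesis
  proof cases
    case 1
    then have "i = (j + 4) mod 8" if "i < 8" "j \<in> set (sources x i)" for i
      using less_8_cases [OF that(1)] that(2) by auto
    then show ?thesis using assms(2-5) by metis
  next
    case 2
    then have "j \<in> set (sources x j)" by auto
    moreover have "i = j \<or> i = (j + 3) mod 8 \<or> i = (j + 5) mod 8" if "i < 8" "j \<in> set (sources x i)" for i
      using less_8_cases [OF that(1)] that(2) 2 by auto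
    ultimately show ?thesis using U [of j] assms(1-5) by metis
  next
    case 3
    have "i = (j + 1) mod 8 \<or> i = (j + 2) mod 8 \<or> i = (j + 4) mod 8 \<or> i = (j + 6) mod 8 \<or> i = (j + 7) mod 8"
      if "i < 8" "j \<in> set (sources x i)" for i
      using less_8_cases [OF that(1)] that(2) 3 by auto
    moreover have "U ((j + 1) mod 8) = U ((j + 4) mod 8)" "U ((j + 6) mod 8) = U ((j + 4) mod 8)"
        "U ((j + 7) mod 8) = U ((j + 4) mod 8)" "U ((j + 2) mod 8) = U ((j + 4) mod 8)"
      using U [of "(j + 1) mod 8"] U [of "(j + 7) mod 8"] less_8_cases [OF \<open>j < 8\<close>] 3 by auto
    ultimately show ?thesis using assms(2-5) by metis
  qed
qed

text \<open>A move in the small frame lifts to a move from some copy of its source to some copy of its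
  target; the copies can be chosen in opposite directions \<open>i\<close> and \<open>i + 4\<close>.\<close>

lemma lifted_left_move:
  assumes "j < 8"
  shows "\<exists>i<8. j \<in> set (sources x i) \<and> {(j + 3) mod 8, (j + 4) mod 8} \<subseteq> set (sources x ((i + 4) mod 8)) \<and>
    offset x (P, Q) ((i + 4) mod 8) + left_move (P, Q) j - offset x (P, Q) i
      \<in> {left_move (next_prop x (P, Q)) i, right_move (next_prop x (P, Q)) i}"
proof (intro exI conjI)
  let ?i = "(case x of Lf \<Rightarrow> if even j then j + 4 else j + 3 | Lg \<Rightarrow> if even j then j + 3 else j + 4
      | Lh \<Rightarrow> if even j then j + 2 else j + 5) mod 8"
  show "?i < 8" by simp
  show "j \<in> set (sources x ?i)"
    using less_8_cases [OF assms] by (cases x; elim disjE; simp)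
  show "{(j + 3) mod 8, (j + 4) mod 8} \<subseteq> set (sources x ((?i + 4) mod 8))"
    using less_8_cases [OF assms] by (cases x; elim disjE; simp)
  show "offset x (P, Q) ((?i + 4) mod 8) + left_move (P, Q) j - offset x (P, Q) ?i
      \<in> {left_move (next_prop x (P, Q)) ?i, right_move (next_prop x (P, Q)) ?i}"
    using less_8_cases [OF assms] by (cases x; elim disjE; simp)
qed

lemma lifted_right_move:
  assumes "j < 8"
  shows "\<exists>i<8. j \<in> set (sources x i) \<and> {(j + 4) mod 8, (j + 5) mod 8} \<subseteq> set (sources x ((i + 4) mod 8)) \<and>
    offset x (P, Q) ((i + 4) mod 8) + right_move (P, Q) j - offset x (P, Q) i
      \<in> {left_move (next_prop x (P, Q)) i, right_move (next_prop x (P, Q)) i}"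
proof (intro exI conjI)
  let ?i = "(case x of Lf \<Rightarrow> if even j then j + 4 else j + 5 | Lg \<Rightarrow> if even j then j + 5 else j + 4
      | Lh \<Rightarrow> if even j then j + 6 else j + 3) mod 8"
  show "?i < 8" by simp
  show "j \<in> set (sources x ?i)"
    using less_8_cases [OF assms] by (cases x; elim disjE; simp)
  show "{(j + 4) mod 8, (j + 5) mod 8} \<subseteq> set (sources x ((?i + 4) mod 8))"
    using less_8_cases [OF assms] by (cases x; elim disjE; simp)
  show "offset x (P, Q) ((?i + 4) mod 8) + right_move (P, Q) j - offset x (P, Q) ?i
      \<in> {left_move (next_prop x (P, Q)) ?i, right_move (next_prop x (P, Q)) ?i}"
    using less_8_cases [OF assms] by (cases x; elim disjE; simp)
qed

lemma connected_lift_strand: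
  assumes c: "closed_strands (P, Q) a" and conn: "connected_strands (P, Q) a"
    and disj: "\<And>i j z. i < 8 \<Longrightarrow> j < 8 \<Longrightarrow> z \<in> set (a i) \<Longrightarrow> z \<in> set (a j) \<Longrightarrow> i = j"
  shows "connected_strands (next_prop x (P, Q)) (lift_strand x (P, Q) a)"
  unfolding connected_strands_def
proof (intro allI impI ballI)
  let ?B = "next_prop x (P, Q)" and ?b = "lift_strand x (P, Q) a" and ?o = "offset x (P, Q)"
  fix T' and i j :: nat and z w
  assume inv: "invariant_along ?B ?b T'" and i: "i < 8" "z \<in> set (?b i)" and j: "j < 8" "w \<in> set (?b j)"
  have b: "w + ?o i \<in> set (?b i)" if "j \<in> set (sources x i)" "w \<in> set (a j)" for w i j
    using that by (auto simp: mem_lift_strand)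
  have inv': "T' (w + ?o i) \<longleftrightarrow> T' (w + ?o i + left_move ?B i)"
     "T' (w + ?o i) \<longleftrightarrow> T' (w + ?o i + right_move ?B i)"
    if "i < 8" "j \<in> set (sources x i)" "w \<in> set (a j)" for w i j
    using inv b [OF that(2,3)] that(1) unfolding invariant_along_def by blast+
  have same: "T' (w + ?o i) = T' (w + ?o k)"
    if "i < 8" "k < 8" "j \<in> set (sources x i)" "j \<in> set (sources x k)" "w \<in> set (a j)" for w i j k
  proof (rule copies_equal [where j = j and x = x and U = "\<lambda>i. T' (w + ?o i)"])
    show "\<forall>i<8. j \<in> set (sources x i) \<longrightarrow>
        T' (w + ?o i) = T' (w + ?o ((i + 3) mod 8)) \<and> T' (w + ?o i) = T' (w + ?o ((i + 5) mod 8))"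
      using inv' that(5) by (simp add: add.assoc offset_moves)
  qed (use that sources_less in auto)
  \<comment> \<open>the value of \<open>T'\<close> at any copy of \<open>w\<close>\<close>
  define T where "T w \<longleftrightarrow> (\<exists>i<8. \<exists>j\<in>set (sources x i). w \<in> set (a j) \<and> T' (w + ?o i))" for w
  have T: "T w \<longleftrightarrow> T' (w + ?o i)"
    if ij: "i < 8" "j \<in> set (sources x i)" "w \<in> set (a j)" for w i j
  proof
    assume "T w"
    then obtain k j' where k: "k < 8" "j' \<in> set (sources x k)" "w \<in> set (a j')" "T' (w + ?o k)"
      unfolding T_def by blast
    then have "j' = j" using disj ij sources_less by blast
    then show "T' (w + ?o i)" using same ij k by blast
  qed (use ij T_def in blast)
  have step: "T w \<longleftrightarrow> T (w + d)"
    if "i < 8" "j \<in> set (sources x i)" "w \<in> set (a j)"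
      "l \<in> set (sources x ((i + 4) mod 8))" "w + d \<in> set (a l)"
      "?o ((i + 4) mod 8) + d - ?o i \<in> {left_move ?B i, right_move ?B i}" for i j l w d
  proof -
    have "T w \<longleftrightarrow> T' (w + ?o i)" using T that by blast
    also have "\<dots> \<longleftrightarrow> T' (w + ?o i + (?o ((i + 4) mod 8) + d - ?o i))"
      using inv' [OF that(1-3)] that(6) by (metis insertE singletonD)
    also have "w + ?o i + (?o ((i + 4) mod 8) + d - ?o i) = w + d + ?o ((i + 4) mod 8)"
      by simp
    also have "T' \<dots> \<longleftrightarrow> T (w + d)"
      using T [of "(i + 4) mod 8" l "w + d"] that by simp
    finally show ?thesis .
  qed
  have "invariant_along (P, Q) a T"
    unfolding invariant_along_def
  proof (intro allI impI ballI conjI)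
    fix j :: nat and w assume j: "j < 8" and w: "w \<in> set (a j)"
    have cl: "w + left_move (P, Q) j \<in> set (a ((j + 3) mod 8)) \<union> set (a ((j + 4) mod 8))"
      "w + right_move (P, Q) j \<in> set (a ((j + 4) mod 8)) \<union> set (a ((j + 5) mod 8))"
      using c j w unfolding closed_strands_def by blast+
    show "T w \<longleftrightarrow> T (w + left_move (P, Q) j)"
      using lifted_left_move [OF j, of x P Q] step cl(1) w by blast
    show "T w \<longleftrightarrow> T (w + right_move (P, Q) j)"
      using lifted_right_move [OF j, of x P Q] step cl(2) w by blast
  qed
  then have "T z' \<longleftrightarrow> T w'" if "i' < 8" "j' < 8" "z' \<in> set (a i')" "w' \<in> set (a j')" for i' j' z' w'
    using conn that unfolding connected_strands_def by blast
  moreover obtain i' where i': "i' \<in> set (sources x i)" "z - ?o i \<in> set (a i')"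
    using i by (auto simp: mem_lift_strand)
  moreover obtain j' where j': "j' \<in> set (sources x j)" "w - ?o j \<in> set (a j')"
    using j by (auto simp: mem_lift_strand)
  ultimately have "T (z - ?o i) \<longleftrightarrow> T (w - ?o j)"
    using sources_less i(1) j(1) by blast
  then show "T' z \<longleftrightarrow> T' w"
    using T [OF i(1) i'] T [OF j(1) j'] by simp
qed

lemma connected_start:
  "connected_strands B (strands [] B)"
  unfolding connected_strands_def
proof (intro allI impI)
  fix T i j
  assume inv: "invariant_along B (strands [] B) T" and i: "i < (8::nat)" and j: "j < (8::nat)"
  have *: "T (start B i) \<longleftrightarrow> T (start B ((i + 3) mod 8))" if "i < 8" for i
  proof -
    have "start B i + left_move B i = start B ((i + 3) mod 8)"
      using less_8_cases [OF that] by (cases B) auto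
    then show ?thesis using inv that by (auto simp: invariant_along_def)
  qed
  have c0: "T (start B 0) \<longleftrightarrow> T (start B 3)" using * [of 0] by simp
  have c3: "T (start B 3) \<longleftrightarrow> T (start B 6)" using * [of 3] by simp
  have c6: "T (start B 6) \<longleftrightarrow> T (start B 1)" using * [of 6] by simp
  have c1: "T (start B 1) \<longleftrightarrow> T (start B 4)" using * [of 1] by simp
  have c4: "T (start B 4) \<longleftrightarrow> T (start B 7)" using * [of 4] by simp
  have c7: "T (start B 7) \<longleftrightarrow> T (start B 2)" using * [of 7] by simp
  have c2: "T (start B 2) \<longleftrightarrow> T (start B 5)" using * [of 2] by simp
  have *: "T (start B i) \<longleftrightarrow> T (start B 0)" if "i < 8" for i
    using less_8_cases [OF that] by (elim disjE) (simp_all only: c0 c3 c6 c1 c4 c7 c2)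
  show "\<forall>z\<in>set (strands [] B i). \<forall>w\<in>set (strands [] B j). T z \<longleftrightarrow> T w"
    using * [OF i] * [OF j] by simp
qed

section \<open>Frames and their sections\<close>

lemma rot90_eq_turn: "rot90 = turn"
  by (auto simp: turn_def)

lemma lift_proportions_eq: "lift_proportions = next_prop"
proof (intro ext)
  show "lift_proportions x B = next_prop x B" for x B by (cases x; cases B) auto
qed

lemma lift_vec_eq: "i < 8 \<Longrightarrow> lift_vec x B i = offset x B i"
proof -
  assume i: "i < 8"
  have "lift_coeff x B i = offset_coeff x B i" by (cases x; cases B) auto
  then show ?thesis
    using less_8_cases [OF i] by (elim disjE) (auto simp: lift_vec_def direction_unit_def rot90_eq_turn
      offset_def)
qed

lemma proportions_append: "proportions (e @ t) = props e (proportions t)"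
  by (induction e) (simp_all add: proportions_def lift_proportions_eq)

lemma proportions_props: "proportions e = props e (1, 2)"
  using proportions_append [of e "[]"] by (simp add: proportions_def)

lemma lift_path_eq: "i < 8 \<Longrightarrow> lift_path x B a i = lift_strand x B a i"
  by (cases x) (simp_all add: lift_strand_def shift_path_def lift_vec_eq reversing_def)

text \<open>The proportions of a skew basic leaper, the smaller one first.\<close>

definition proper :: "int \<times> int \<Rightarrow> bool" where
  "proper B \<longleftrightarrow> 0 < fst B \<and> fst B < snd B \<and> odd (fst B + snd B) \<and> coprime (fst B) (snd B)"

lemma proper_next_prop: "proper B \<Longrightarrow> proper (next_prop x B)"
proof (cases x; cases B)
  fix m n assume "proper B" "B = (m, n)"
  then have *: "0 < m" "m < n" "odd (m + n)" "coprime m n" by (auto simp: proper_def)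
  have "gcd m (2 * m + n) = gcd m n" using gcd_add_mult [of m 2 n] by simp
  moreover have "gcd n (2 * n - m) = gcd m n"
    using gcd_add_mult [of n 2 "- m"] by (simp add: mult.commute gcd.commute)
  moreover have "gcd n (2 * n + m) = gcd m n"
    by (simp add: gcd_add_mult [of n 2 m] gcd.commute)
  ultimately have "coprime m (2 * m + n)" "coprime n (2 * n - m)" "coprime n (2 * n + m)"
    using * by (simp_all add: coprime_iff_gcd_eq_1)
  moreover have "m + m + n = 2 * m + n" "n + n - m = 2 * n - m" "m + n + n = 2 * n + m" by auto
  ultimately show "proper (next_prop x B)" if "x = Lf" using that * \<open>B = (m, n)\<close>
    by (auto simp: proper_def)
  show "proper (next_prop x B)" if "x = Lg" using that * \<open>B = (m, n)\<close> \<open>coprime n (2 * n - m)\<close>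
    by (auto simp: proper_def)
  show "proper (next_prop x B)" if "x = Lh"
    using that * \<open>B = (m, n)\<close> \<open>coprime n (2 * n + m)\<close> \<open>m + n + n = 2 * n + m\<close>
    by (auto simp: proper_def)
qed

lemma proper_proportions: "proper (proportions e)"
  unfolding proportions_props
  by (induction e) (auto simp: proper_next_prop, simp add: proper_def)

lemma leaper_descentD: "leaper_descent p q d \<Longrightarrow> proportions d = (p, q)"
  by (simp add: leaper_descent_def)

lemma leaper_descent_proportions: "proportions d = (p, q) \<Longrightarrow> leaper_descent p q d"
  using proper_proportions [of d]
  by (auto simp: leaper_descent_def proper_def basic_leaper_def skew_leaper_def)

lemma mem_turn_image: "(x, y) \<in> turn ` S \<longleftrightarrow> (y, - x) \<in> S" for x :: "'a::ab_group_add"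
  by (force simp: turn_def image_iff)

lemma mem_funpow_turn_image:
  fixes x y :: "'a::ab_group_add"
  shows "(x, y) \<in> (turn ^^ 1) ` S \<longleftrightarrow> (y, - x) \<in> S"
    and "(x, y) \<in> (turn ^^ 2) ` S \<longleftrightarrow> (- x, - y) \<in> S"
    and "(x, y) \<in> (turn ^^ 3) ` S \<longleftrightarrow> (- y, x) \<in> S"
  by (force simp: image_iff)+

lemma mem_frame_section:
  fixes x y :: int
  shows "(x, y) \<in> frame_section (m, n) 0 \<longleftrightarrow> n - m < 2 * x \<and> 2 * x < m + n \<and> m - n < 2 * y \<and> 2 * y < n - m"
    and "(x, y) \<in> frame_section (m, n) 1 \<longleftrightarrow> n - m < 2 * x \<and> 2 * x < m + n \<and> n - m < 2 * y \<and> 2 * y < m + n"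
    and "(x, y) \<in> frame_section (m, n) 2 \<longleftrightarrow> m - n < 2 * x \<and> 2 * x < n - m \<and> n - m < 2 * y \<and> 2 * y < m + n"
    and "(x, y) \<in> frame_section (m, n) 3 \<longleftrightarrow> - m - n < 2 * x \<and> 2 * x < m - n \<and> n - m < 2 * y \<and> 2 * y < m + n"
    and "(x, y) \<in> frame_section (m, n) 4 \<longleftrightarrow> - m - n < 2 * x \<and> 2 * x < m - n \<and> m - n < 2 * y \<and> 2 * y < n - m"
    and "(x, y) \<in> frame_section (m, n) 5 \<longleftrightarrow> - m - n < 2 * x \<and> 2 * x < m - n \<and> - m - n < 2 * y \<and> 2 * y < m - n"
    and "(x, y) \<in> frame_section (m, n) 6 \<longleftrightarrow> m - n < 2 * x \<and> 2 * x < n - m \<and> - m - n < 2 * y \<and> 2 * y < m - n"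
    and "(x, y) \<in> frame_section (m, n) 7 \<longleftrightarrow> n - m < 2 * x \<and> 2 * x < m + n \<and> - m - n < 2 * y \<and> 2 * y < m - n"
  by (auto simp: rot90_eq_turn mem_funpow_turn_image mem_turn_image simp del: funpow_turn)

lemma turn_frame_section:
  assumes "i < 8"
  shows "frame_section B ((i + 2) mod 8) = turn ` frame_section B i"
  using less_8_cases [OF assms]
  by (cases B) (auto simp: mem_frame_section mem_turn_image set_eq_iff simp del: frame_section.simps)

declare frame_section.simps [simp del]

lemma turn_mem_frame_section:
  assumes "i < 8"
  shows "turn z \<in> frame_section B ((i + 2) mod 8) \<longleftrightarrow> z \<in> frame_section B i"
  by (simp add: turn_frame_section [OF assms] inj_image_mem_iff inj_def)

lemma frame_section_disjoint:
  assumes "m < n" "i < 8" "j < 8" "z \<in> frame_section (m, n) i" "z \<in> frame_section (m, n) j"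
  shows "i = j"
proof (cases z)
  case (Pair x y)
  show ?thesis
    using less_8_cases [OF assms(2)] less_8_cases [OF assms(3)] assms(1,4,5)
    unfolding Pair by (elim disjE; simp add: mem_frame_section)
qed

lemma mem_frame:
  "(x, y) \<in> frame (m, n) \<longleftrightarrow>
    (n - m < 2 * x \<or> 2 * x < m - n \<or> n - m < 2 * y \<or> 2 * y < m - n) \<and>
    2 * x < m + n \<and> - m - n < 2 * x \<and> 2 * y < m + n \<and> - m - n < 2 * y"
  by auto

lemma frame_eq_sections:
  assumes "0 < m" "m < n" "odd (m + n)"
  shows "frame (m, n) = (\<Union>i<8. frame_section (m, n) i)"
proof -
  have o: "2 * x \<noteq> n - m" "2 * x \<noteq> m - n" for x using assms(3) by presburger+
  have "(x, y) \<in> frame (m, n) \<longleftrightarrow> (\<exists>i<8. (x, y) \<in> frame_section (m, n) i)" for x y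
  proof -
    consider "2 * x < m - n" | "m - n < 2 * x" "2 * x < n - m" | "n - m < 2 * x"
      using o [of x] by linarith
    moreover consider "2 * y < m - n" | "m - n < 2 * y" "2 * y < n - m" | "n - m < 2 * y"
      using o [of y] by linarith
    ultimately show ?thesis
      unfolding mem_frame ex_less_8 mem_frame_section using assms(1,2)
      by (smt (verit))
  qed
  then show ?thesis by auto
qed

text \<open>The section of a square determines into which sections of the lifted frame it is
  translated; this identifies the lift of a vertex set with the lift of the eight paths.\<close>

lemma lift_frame_section:
  assumes B: "0 < m" "m < n" and i: "i < 8" and "j < 8" "z \<in> frame_section (m, n) j"
  shows "z + offset x (m, n) i \<in> frame_section (next_prop x (m, n)) i \<longleftrightarrow> j \<in> set (sources x i)"
  using i assms(4,5)
proof (induction arbitrary: z j rule: turn_induct)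
  case even
  show ?case
  proof (cases z)
    case (Pair u v)
    show ?thesis
      using less_8_cases [OF even(1)] B even(2)
      unfolding Pair by (elim disjE; cases x; simp add: mem_frame_section; linarith)
  qed
next
  case odd
  show ?case
  proof (cases z)
    case (Pair u v)
    show ?thesis
      using less_8_cases [OF odd(1)] B odd(2)
      unfolding Pair by (elim disjE; cases x; simp add: mem_frame_section; linarith)
  qed
next
  case (turn i)
  define w where "w = turn (turn (turn z))"
  define k where "k = (j + 6) mod 8"
  have z: "z = turn w" and j: "j = (k + 2) mod 8" "k < 8"
    using turn by (auto simp: w_def k_def mod_simps)
  have "w \<in> frame_section (m, n) k"
    using turn(4) turn_mem_frame_section [OF j(2), of w "(m, n)"] by (simp add: z j(1))
  then have "w + offset x (m, n) i \<in> frame_section (next_prop x (m, n)) i \<longleftrightarrow> k \<in> set (sources x i)"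
    using turn j(2) by blast
  moreover have "z + offset x (m, n) ((i + 2) mod 8) = turn (w + offset x (m, n) i)"
    by (simp add: z turn_offset turn turn_add)
  moreover have "k \<in> set (sources x i) \<longleftrightarrow> j \<in> set (sources x ((i + 2) mod 8))"
  proof -
    have "inj_on (\<lambda>j::nat. (j + 2) mod 8) {..<8}"
    proof (rule inj_on_inverseI [where g = "\<lambda>j. (j + 6) mod 8"])
      fix j :: nat assume "j \<in> {..<8}"
      then have "j < 8" by simp
      then show "((j + 2) mod 8 + 6) mod 8 = j"
        using less_8_cases [OF \<open>j < 8\<close>] by (elim disjE; simp)
    qed
    moreover have "set (sources x i) \<subseteq> {..<8}" using sources_less turn(1) by auto
    ultimately show ?thesis
      using j inj_on_image_mem_iff [of "\<lambda>j::nat. (j + 2) mod 8" "{..<8}" k "set (sources x i)"]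
      by (simp add: sources_turn turn(1))
  qed
  ultimately show ?case by (simp add: turn_mem_frame_section turn(1))
qed

text \<open>All squares of a frame have degree at most two in the leaper graph over the frame.\<close>

lemma moves_within_frame:
  assumes "0 < m" "m < n" "i < 8" "z \<in> frame_section (m, n) i"
    and "d \<in> moves (m, n)" "z + d \<in> frame (m, n)"
  shows "d = left_move (m, n) i \<or> d = right_move (m, n) i"
proof (cases z)
  case (Pair x y)
  have "2 * (x + fst d) < m + n" "- m - n < 2 * (x + fst d)" "2 * (y + snd d) < m + n" "- m - n < 2 * (y + snd d)"
    using assms(6) unfolding Pair
    by (cases d; simp only: add_Pair mem_frame fst_conv snd_conv)+
  moreover have "d = (m, n) \<or> d = (m, - n) \<or> d = (- m, n) \<or> d = (- m, - n) \<or>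
     d = (n, m) \<or> d = (n, - m) \<or> d = (- n, m) \<or> d = (- n, - m)"
    using assms(5) by (auto simp: moves_def)
  ultimately show ?thesis
    using less_8_cases [OF assms(3)] assms(1,2,4)
    unfolding Pair by (elim disjE; simp add: mem_frame_section)
qed


text \<open>Path \<open>i\<close> lies in section \<open>i\<close> of the frame.\<close>

definition sectioned :: "int \<times> int \<Rightarrow> (nat \<Rightarrow> square list) \<Rightarrow> bool" where
  "sectioned B a \<longleftrightarrow> (\<forall>i<8. set (a i) \<subseteq> frame_section B i)"

lemma sectioned_disjoint:
  assumes "proper B" "sectioned B a" "i < 8" "j < 8" "z \<in> set (a i)" "z \<in> set (a j)"
  shows "i = j"
  using frame_section_disjoint [of "fst B" "snd B" i j z] assms
  by (auto simp: sectioned_def proper_def)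

lemma sectioned_lift_strand:
  assumes "proper B" "sectioned B a"
  shows "sectioned (next_prop x B) (lift_strand x B a)"
  unfolding sectioned_def
proof (intro allI impI subsetI)
  fix i z assume i: "i < (8::nat)" and z: "z \<in> set (lift_strand x B a i)"
  then obtain j where j: "j \<in> set (sources x i)" "z - offset x B i \<in> set (a j)"
    by (auto simp: mem_lift_strand)
  have "j < 8" using j sources_less i by blast
  then show "z \<in> frame_section (next_prop x B) i"
    using lift_frame_section [of "fst B" "snd B" i j "z - offset x B i" x] j i assms
    by (auto simp: sectioned_def proper_def)
qed

lemma lift_set_strands:
  assumes "proper B" "sectioned B a"
  shows "lift_set x B (\<Union>i<8. set (a i)) = (\<Union>i<8. set (lift_strand x B a i))"
proof -
  have "((\<lambda>z. z + lift_vec x B i) ` (\<Union>i<8. set (a i))) \<inter> frame_section (lift_proportions x B) i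
     = set (lift_strand x B a i)" if i: "i < 8" for i
  proof (intro set_eqI iffI)
    fix z assume "z \<in> ((\<lambda>z. z + lift_vec x B i) ` (\<Union>i<8. set (a i))) \<inter> frame_section (lift_proportions x B) i"
    then obtain j w where j: "j < 8" "w \<in> set (a j)" "z = w + offset x B i"
      "z \<in> frame_section (next_prop x B) i"
      using i by (auto simp: lift_vec_eq lift_proportions_eq)
    then have "j \<in> set (sources x i)"
      using lift_frame_section [of "fst B" "snd B" i j w x] i assms
      by (auto simp: sectioned_def proper_def)
    then show "z \<in> set (lift_strand x B a i)"
      using j by (auto simp: mem_lift_strand)
  next
    fix z assume z: "z \<in> set (lift_strand x B a i)"
    then obtain j where j: "j \<in> set (sources x i)" "z - offset x B i \<in> set (a j)"
      by (auto simp: mem_lift_strand)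
    have "z \<in> frame_section (next_prop x B) i"
      using sectioned_lift_strand [OF assms, of x] z i by (auto simp: sectioned_def)
    moreover have "z = (z - offset x B i) + offset x B i" "j < 8"
      using j sources_less i by auto
    ultimately show "z \<in> ((\<lambda>z. z + lift_vec x B i) ` (\<Union>i<8. set (a i))) \<inter> frame_section (lift_proportions x B) i"
      using j i unfolding lift_vec_eq [OF i] lift_proportions_eq by blast
  qed
  then show ?thesis by (simp add: lift_set_def)
qed

lemma lift_strand_cong:
  assumes "\<And>i. i < 8 \<Longrightarrow> a i = b i" "i < 8"
  shows "lift_strand x B a i = lift_strand x B b i"
proof -
  have "map (\<lambda>j. if reversing x i then rev (a j) else a j) (sources x i) =
    map (\<lambda>j. if reversing x i then rev (b j) else b j) (sources x i)"
    using assms sources_less by (auto intro!: map_cong)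
  then show ?thesis unfolding lift_strand_def by presburger
qed

lemma lift_paths_sets:
  assumes "sectioned (proportions t) a"
  shows "sectioned (proportions (e @ t)) (lift_paths e t a) \<and>
    lift_sets e t (\<Union>i<8. set (a i)) = (\<Union>i<8. set (lift_paths e t a i))"
proof (induction e)
  case Nil
  then show ?case using assms by simp
next
  case (Cons x e)
  let ?B = "proportions (e @ t)"
  have p: "proper ?B" by (rule proper_proportions)
  have B: "proportions ((x # e) @ t) = next_prop x ?B"
    using proportions_append [of "x # e" t] by (simp add: proportions_append)
  have l: "lift_paths (x # e) t a i = lift_strand x ?B (lift_paths e t a) i" if "i < 8" for i
    using that by (simp add: lift_path_eq)
  have "sectioned (next_prop x ?B) (lift_strand x ?B (lift_paths e t a))"
    using Cons p sectioned_lift_strand by blast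
  then have "sectioned (proportions ((x # e) @ t)) (lift_paths (x # e) t a)"
    unfolding B sectioned_def using l by simp
  moreover have "lift_sets (x # e) t (\<Union>i<8. set (a i)) = (\<Union>i<8. set (lift_strand x ?B (lift_paths e t a) i))"
    using Cons lift_set_strands [OF p] by simp
  ultimately show ?case using l by simp
qed

section \<open>Symbolic squares\<close>

text \<open>A pair of integers stands for the linear form with these coefficients.  The pair
  \<open>symbolic\<close> consists of the two indeterminates, that is, of generic proportions.\<close>

abbreviation symbolic :: "(int \<times> int) \<times> (int \<times> int)" where
  "symbolic \<equiv> ((1, 0), (0, 1))"

text \<open>Evaluation at \<open>B\<close> of a linear form, and of a symbolic square coordinatewise.\<close>

definition eval_form :: "int \<times> int \<Rightarrow> int \<times> int \<Rightarrow> int" where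
  "eval_form B X = fst X * fst B + snd X * snd B"

lemma eval_form_additive:
  "eval_form B (X + Y) = eval_form B X + eval_form B Y"
  "eval_form B (X - Y) = eval_form B X - eval_form B Y"
  "eval_form B (- X) = - eval_form B X" "eval_form B 0 = 0"
  by (auto simp: eval_form_def algebra_simps)

definition eval_pair :: "int \<times> int \<Rightarrow> (int \<times> int) \<times> (int \<times> int) \<Rightarrow> int \<times> int" where
  "eval_pair B N = (eval_form B (fst N), eval_form B (snd N))"

lemma eval_pair_additive:
  "eval_pair B (N + M) = eval_pair B N + eval_pair B M"
  "eval_pair B (N - M) = eval_pair B N - eval_pair B M"
  by (simp_all add: eval_pair_def eval_form_additive)

lemma eval_pair_symbolic: "eval_pair B symbolic = B"
  by (simp add: eval_pair_def eval_form_def)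

text \<open>The square with symbolic coordinates \<open>N\<close> in the frame of proportions \<open>B\<close>; the square \<open>c\<close> is
  the place of the symbolic origin.\<close>

definition realise :: "square \<Rightarrow> int \<times> int \<Rightarrow> (int \<times> int) \<times> (int \<times> int) \<Rightarrow> square" where
  "realise c B N = c + eval_pair B N"

lemma realise_diff: "realise c B N - realise c B M = eval_pair B (N - M)"
  by (simp add: realise_def eval_pair_additive)

lemma eval_pair_next_prop: "eval_pair B (next_prop x C) = next_prop x (eval_pair B C)"
  by (cases x; cases C) (simp_all add: eval_pair_def eval_form_def algebra_simps)

lemma eval_pair_props: "eval_pair B (props e C) = props e (eval_pair B C)"
  by (induction e) (simp_all add: eval_pair_next_prop)

lemma eval_pair_along: "i < 8 \<Longrightarrow> eval_pair B (along i c) = along i (eval_form B c)"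
  by (drule less_8_cases) (auto simp: eval_pair_def eval_form_def algebra_simps)

lemma eval_pair_offset: "i < 8 \<Longrightarrow> eval_pair B (offset x C i) = offset x (eval_pair B C) i"
proof -
  assume "i < 8"
  moreover have "eval_form B (offset_coeff x C i) = offset_coeff x (eval_pair B C) i"
    by (cases x; cases C) (simp_all add: eval_pair_def eval_form_def algebra_simps)
  ultimately show ?thesis by (simp add: offset_def eval_pair_along)
qed

lemma eval_pair_start: "i < 8 \<Longrightarrow> eval_pair B (start C i) = start (eval_pair B C) i"
  by (cases C) (simp add: eval_pair_along, simp add: eval_pair_def eval_form_def algebra_simps)

lemma eval_pair_moves: "d \<in> moves C \<Longrightarrow> eval_pair B d \<in> moves (eval_pair B C)"
  by (cases C) (simp add: moves_def, elim disjE; simp add: eval_pair_def eval_form_def)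

lemma eval_pair_left_move: "i < 8 \<Longrightarrow> eval_pair B (left_move C i) = left_move (eval_pair B C) i"
  and eval_pair_right_move: "i < 8 \<Longrightarrow> eval_pair B (right_move C i) = right_move (eval_pair B C) i"
  by (drule less_8_cases, cases C, auto simp: eval_pair_def eval_form_def algebra_simps)+

lemma realise_lift_strand:
  assumes "i < 8"
  shows "map (realise c B) (lift_strand x C a i) =
    lift_strand x (eval_pair B C) (\<lambda>j. map (realise c B) (a j)) i"
  by (auto simp: lift_strand_def map_concat comp_def realise_def eval_pair_additive
      eval_pair_offset [OF assms] add.assoc rev_map intro!: arg_cong [where f = concat])

lemma lift_paths_realise:
  assumes "\<And>i. i < 8 \<Longrightarrow> a i = [realise c (proportions t) (start symbolic i)]" "i < 8"
  shows "lift_paths e t a i = map (realise c (proportions t)) (strands e symbolic i)"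
  using assms(2)
proof (induction e arbitrary: i)
  case Nil
  then show ?case by (simp add: assms(1) del: start.simps)
next
  case (Cons x e)
  let ?B = "proportions t"
  have "lift_paths (x # e) t a i = lift_strand x (proportions (e @ t)) (lift_paths e t a) i"
    using Cons.prems by (simp add: lift_path_eq)
  also have "\<dots> = lift_strand x (proportions (e @ t)) (\<lambda>j. map (realise c ?B) (strands e symbolic j)) i"
    using Cons by (intro lift_strand_cong) auto
  also have "proportions (e @ t) = eval_pair ?B (props e symbolic)"
    by (simp add: eval_pair_props eval_pair_symbolic proportions_append)
  also have "lift_strand x (eval_pair ?B (props e symbolic)) (\<lambda>j. map (realise c ?B) (strands e symbolic j)) i
     = map (realise c ?B) (strands (x # e) symbolic i)"
    by (simp add: realise_lift_strand Cons.prems)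
  finally show ?case .
qed

section \<open>Distinctness\<close>

lemma distinct_concat_map:
  assumes "distinct js" "\<And>j. j \<in> set js \<Longrightarrow> distinct (f j)"
    and "\<And>i j z. i \<in> set js \<Longrightarrow> j \<in> set js \<Longrightarrow> z \<in> set (f i) \<Longrightarrow> z \<in> set (f j) \<Longrightarrow> i = j"
  shows "distinct (concat (map f js))"
  using assms
proof (induction js)
  case (Cons k js)
  have "set (f k) \<inter> set (concat (map f js)) = {}"
  proof (rule ccontr)
    assume "set (f k) \<inter> set (concat (map f js)) \<noteq> {}"
    then obtain z j where "z \<in> set (f k)" "j \<in> set js" "z \<in> set (f j)" by auto
    then have "k = j" using Cons.prems(3) [of k j z] by simp
    then show False using \<open>j \<in> set js\<close> Cons.prems(1) by simp
  qed
  moreover have "distinct (concat (map f js))"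
    using Cons.prems by (intro Cons.IH) auto
  ultimately show ?case using Cons.prems(2) by simp
qed simp

lemma distinct_sources: "i < 8 \<Longrightarrow> distinct (sources x i)"
  by (drule less_8_cases) (cases x; auto)

lemma distinct_lift_strand:
  assumes "\<And>j. j < 8 \<Longrightarrow> distinct (a j)"
    and disj: "\<And>i j z. i < 8 \<Longrightarrow> j < 8 \<Longrightarrow> z \<in> set (a i) \<Longrightarrow> z \<in> set (a j) \<Longrightarrow> i = j" and i: "i < 8"
  shows "distinct (lift_strand x B a i)"
proof -
  have "distinct (concat (map (\<lambda>j. if reversing x i then rev (a j) else a j) (sources x i)))"
  proof (rule distinct_concat_map)
    fix j k z
    assume "j \<in> set (sources x i)" "k \<in> set (sources x i)"
      "z \<in> set (if reversing x i then rev (a j) else a j)"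
      "z \<in> set (if reversing x i then rev (a k) else a k)"
    then show "j = k" using disj [of j k z] sources_less [OF i] by (auto split: if_splits)
  qed (use assms(1) sources_less [OF i] distinct_sources [OF i] in auto)
  then show ?thesis by (simp add: lift_strand_def distinct_map)
qed

lemma distinct_lift_paths:
  assumes "sectioned (proportions t) a" "\<And>i. i < 8 \<Longrightarrow> distinct (a i)" "i < 8"
  shows "distinct (lift_paths e t a i)"
  using assms(3)
proof (induction e arbitrary: i)
  case (Cons x e)
  have "distinct (lift_strand x (proportions (e @ t)) (lift_paths e t a) i)"
    using Cons lift_paths_sets [OF assms(1), of e]
      sectioned_disjoint [OF proper_proportions, of "e @ t" "lift_paths e t a"]
    by (intro distinct_lift_strand) auto
  then show ?case using Cons.prems by (simp add: lift_path_eq)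
qed (use assms in simp)

lemma set_concat_upt_8: "set (concat (map a [0..<8])) = (\<Union>i<8. set (a i))"
  by (auto simp: atLeast0LessThan)

lemma distinct_concat_sectioned:
  assumes "proper B" "sectioned B a" "\<And>i. i < 8 \<Longrightarrow> distinct (a i)"
  shows "distinct (concat (map a [0..<8]))"
  using assms(3) sectioned_disjoint [OF assms(1,2)] by (intro distinct_concat_map) auto

section \<open>Squares at unit distance\<close>

text \<open>The pairs of consecutive elements of a list.\<close>

definition consec :: "'a list \<Rightarrow> ('a \<times> 'a) set" where
  "consec xs = set (zip xs (tl xs))"

lemma consec_simps [simp]:
  "consec [] = {}" "consec [x] = {}" "consec (x # y # xs) = insert (x, y) (consec (y # xs))"
  by (simp_all add: consec_def)

lemma consec_iff: "(z, w) \<in> consec xs \<longleftrightarrow> (\<exists>us vs. xs = us @ z # w # vs)"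
proof (induction xs rule: induct_list012)
  case (3 x y xs)
  show ?case
  proof
    assume "(z, w) \<in> consec (x # y # xs)"
    then consider "z = x" "w = y" | "(z, w) \<in> consec (y # xs)" by auto
    then show "\<exists>us vs. x # y # xs = us @ z # w # vs"
    proof cases
      case 1
      then show ?thesis by (intro exI [of _ "[]"] exI [of _ xs]) simp
    next
      case 2
      then obtain us vs where "y # xs = us @ z # w # vs" using 3 by auto
      then show ?thesis by (intro exI [of _ "x # us"] exI [of _ vs]) simp
    qed
  next
    assume "\<exists>us vs. x # y # xs = us @ z # w # vs"
    then obtain us vs where *: "x # y # xs = us @ z # w # vs" by auto
    show "(z, w) \<in> consec (x # y # xs)"
    proof (cases us)
      case Nil
      then show ?thesis using * by simp
    next
      case (Cons u us')
      then have "\<exists>us vs. y # xs = us @ z # w # vs" using * by auto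
      then show ?thesis using 3 by simp
    qed
  qed
qed (auto simp: Cons_eq_append_conv)

lemma consec_append:
  "consec (xs @ ys) = consec xs \<union> consec ys \<union>
    (if xs = [] \<or> ys = [] then {} else {(last xs, hd ys)})"
proof (induction xs rule: induct_list012)
  case (2 x)
  then show ?case by (cases ys) auto
qed auto

lemma consec_rev: "(z, w) \<in> consec (rev xs) \<longleftrightarrow> (w, z) \<in> consec xs"
proof (induction xs)
  case (Cons x xs)
  have "consec (x # xs) = consec ([x] @ xs)" by simp
  then show ?case
    using Cons by (auto simp: consec_append last_rev hd_rev simp del: append_Cons)
qed simp

lemma consec_map: "consec (map f xs) = (\<lambda>(z, w). (f z, f w)) ` consec xs"
  by (induction xs rule: induct_list012) auto

lemma consec_concat_within:
  assumes "j \<in> set js" "p \<in> consec (f j)"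
  shows "p \<in> consec (concat (map f js))"
  using assms by (induction js) (auto simp: consec_append)

lemma consec_concat_between:
  assumes "(j, k) \<in> consec js" "f j \<noteq> []" "f k \<noteq> []"
  shows "(last (f j), hd (f k)) \<in> consec (concat (map f js))"
proof -
  obtain us vs where "js = us @ j # k # vs" using assms(1) by (auto simp: consec_iff)
  then have "concat (map f js) = (concat (map f us) @ f j) @ (f k @ concat (map f vs))" by simp
  then show ?thesis using assms(2,3) by (simp add: consec_append)
qed

lemma consec_sources:
  assumes "i < 8" "k \<in> set (sources x i)" "(k + 1) mod 8 \<in> set (sources x i)"
  shows "(if reversing x i then ((k + 1) mod 8, k) else (k, (k + 1) mod 8)) \<in> consec (sources x i)"
  using less_8_cases [OF assms(1)] assms(2,3)
  by (cases x; elim disjE; auto simp: reversing_def)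

abbreviation unit_moves :: "square set" where
  "unit_moves \<equiv> moves (0, 1)"

lemma unit_neighbour_sections:
  assumes "0 < m" "m < n" "i < 8" "j < 8" "z \<in> frame_section (m, n) i" "w \<in> frame_section (m, n) j"
    and "w - z \<in> unit_moves" "i \<noteq> j"
  shows "j = (i + 1) mod 8 \<or> i = (j + 1) mod 8"
proof (cases z)
  case (Pair x y)
  obtain u v where w: "w = (u, v)" by (cases w)
  have d: "u = x \<and> v = y + 1 \<or> u = x \<and> v = y - 1 \<or> u = x + 1 \<and> v = y \<or> u = x - 1 \<and> v = y"
    using assms(7) by (auto simp: moves_def Pair w)
  show ?thesis
    using less_8_cases [OF assms(3)] less_8_cases [OF assms(4)] assms(1,2,5,6,8) d
    unfolding Pair w by (elim disjE conjE; simp add: mem_frame_section)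
qed

text \<open>Unit neighbours in the same path are consecutive, and unit neighbours in path \<open>i\<close> and
  path \<open>i + 1\<close> are the last square of the former and the first square of the latter.\<close>

definition tight :: "(nat \<Rightarrow> square list) \<Rightarrow> bool" where
  "tight a \<longleftrightarrow>
     (\<forall>i<8. \<forall>z\<in>set (a i). \<forall>w\<in>set (a i). w - z \<in> unit_moves \<longrightarrow>
        (z, w) \<in> consec (a i) \<or> (w, z) \<in> consec (a i)) \<and>
     (\<forall>i<8. \<forall>z\<in>set (a i). \<forall>w\<in>set (a ((i + 1) mod 8)). w - z \<in> unit_moves \<longrightarrow>
        z = last (a i) \<and> w = hd (a ((i + 1) mod 8)))"

text \<open>The invariants of the eight paths on which the induction for \<open>tight\<close> rests.\<close>

locale tight_strands =
  fixes m n :: int and a :: "nat \<Rightarrow> square list"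
  assumes proper: "proper (m, n)"
    and sec: "sectioned (m, n) a"
    and ne: "\<And>i. i < 8 \<Longrightarrow> a i \<noteq> []"
    and linked: "linked (m, n) a"
    and closed: "closed_strands (m, n) a"
    and turning: "turning a"
    and tight: "tight a"
begin

lemma mn: "0 < m" "m < n"
  using proper by (auto simp: proper_def)

lemma in_sec: "i < 8 \<Longrightarrow> z \<in> set (a i) \<Longrightarrow> z \<in> frame_section (m, n) i"
  using sec by (auto simp: sectioned_def)

lemma neighbour:
  assumes "i < 8" "j < 8" "z \<in> set (a i)" "w \<in> set (a j)" "w - z \<in> unit_moves"
  shows "i = j \<or> j = (i + 1) mod 8 \<or> i = (j + 1) mod 8"
  using unit_neighbour_sections [OF mn assms(1,2) in_sec in_sec] assms by blast

lemma crossing: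
  assumes "i < 8" "z \<in> set (a i)" "w \<in> set (a ((i + 1) mod 8))" "w - z \<in> unit_moves"
  shows "z = last (a i)" "w = hd (a ((i + 1) mod 8))"
  using tight assms by (auto simp: tight_def)

lemma links:
  assumes "i < 8"
  shows "hd (a ((i + 3) mod 8)) = last (a i) + left_move (m, n) i"
    and "last (a ((i + 5) mod 8)) = hd (a i) + right_move (m, n) i"
  using linked assms by (auto simp: linked_def)

lemma lands:
  assumes "i < 8" "z \<in> set (a i)"
  shows "z + left_move (m, n) i \<in> set (a ((i + 3) mod 8)) \<union> set (a ((i + 4) mod 8))"
    and "z + right_move (m, n) i \<in> set (a ((i + 4) mod 8)) \<union> set (a ((i + 5) mod 8))"
  using closed assms by (auto simp: closed_strands_def)

lemma within_lift:
  assumes i: "i < 8" and z: "z \<in> set (lift_strand x (m, n) a i)" and w: "w \<in> set (lift_strand x (m, n) a i)"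
    and d: "w - z \<in> unit_moves"
  shows "(z, w) \<in> consec (lift_strand x (m, n) a i) \<or> (w, z) \<in> consec (lift_strand x (m, n) a i)"
proof -
  let ?o = "offset x (m, n) i"
  let ?f = "\<lambda>j. if reversing x i then rev (a j) else a j"
  let ?c = "consec (concat (map ?f (sources x i)))"
  obtain j where j: "j \<in> set (sources x i)" "z - ?o \<in> set (a j)"
    using z by (auto simp: mem_lift_strand)
  obtain k where k: "k \<in> set (sources x i)" "w - ?o \<in> set (a k)"
    using w by (auto simp: mem_lift_strand)
  have jk: "j < 8" "k < 8" using j k sources_less [OF i] by auto
  have d': "(w - ?o) - (z - ?o) \<in> unit_moves" "(z - ?o) - (w - ?o) \<in> unit_moves"
    using d uminus_moves [OF d] by simp_all
  have between: "(u, v) \<in> ?c \<or> (v, u) \<in> ?c"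
    if "l \<in> set (sources x i)" "(l + 1) mod 8 \<in> set (sources x i)" "u = last (a l)" "v = hd (a ((l + 1) mod 8))"
    for l u v
  proof -
    have l: "l < 8" using that sources_less [OF i] by auto
    show ?thesis
    proof (cases "reversing x i")
      case True
      then have "((l + 1) mod 8, l) \<in> consec (sources x i)"
        using consec_sources [OF i that(1,2)] by simp
      from consec_concat_between [OF this, of ?f] show ?thesis
        using True that(3,4) ne [OF l] ne [of "(l + 1) mod 8"] by (simp add: hd_rev last_rev)
    next
      case False
      then have "(l, (l + 1) mod 8) \<in> consec (sources x i)"
        using consec_sources [OF i that(1,2)] by simp
      from consec_concat_between [OF this, of ?f] show ?thesis
        using False that(3,4) ne [OF l] ne [of "(l + 1) mod 8"] by simp
    qed
  qed
  have "(z - ?o, w - ?o) \<in> ?c \<or> (w - ?o, z - ?o) \<in> ?c"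
    using neighbour [OF jk j(2) k(2) d'(1)]
  proof (elim disjE)
    assume "j = k"
    then have "(z - ?o, w - ?o) \<in> consec (a j) \<or> (w - ?o, z - ?o) \<in> consec (a j)"
      using tight jk j k d' by (auto simp: tight_def)
    then have "(z - ?o, w - ?o) \<in> consec (?f j) \<or> (w - ?o, z - ?o) \<in> consec (?f j)"
      by (auto simp: consec_rev)
    then show ?thesis using consec_concat_within [OF j(1), of _ ?f] by blast
  next
    assume "k = (j + 1) mod 8"
    then show ?thesis using between [of j "z - ?o" "w - ?o"] j k crossing [OF jk(1) j(2) _ d'(1)] by simp
  next
    assume "j = (k + 1) mod 8"
    then show ?thesis using between [of k "w - ?o" "z - ?o"] j k crossing [OF jk(2) k(2) _ d'(2)] by auto
  qed
  then have "(z - ?o + ?o, w - ?o + ?o) \<in> consec (lift_strand x (m, n) a i) \<or>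
    (w - ?o + ?o, z - ?o + ?o) \<in> consec (lift_strand x (m, n) a i)"
    unfolding lift_strand_def consec_map by (auto intro: rev_image_eqI)
  then show ?thesis by simp
qed

text \<open>Let the unit step from \<open>z\<close> to \<open>w\<close> cross the border of sections \<open>0\<close> and \<open>1\<close> of the lifted
  frame, and let \<open>z0\<close> and \<open>w0\<close> be the squares whose copies are \<open>z\<close> and \<open>w\<close>.  The position of the
  border determines the section of the one of \<open>z0\<close>, \<open>w0\<close> whose path is reversed by the lift, and a leaper
  move carries that square to a unit neighbour of the other one, in an adjacent section.\<close>

lemma crossing_lift_E:
  assumes z: "z \<in> set (lift_strand x (m, n) a 0)" and w: "w \<in> set (lift_strand x (m, n) a 1)"
    and d: "w - z \<in> unit_moves"
  shows "z = last (lift_strand x (m, n) a 0) \<and> w = hd (lift_strand x (m, n) a 1)"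
proof -
  obtain M N where MN: "next_prop x (m, n) = (M, N)" by (cases "next_prop x (m, n)")
  have s: "z \<in> frame_section (M, N) 0" "w \<in> frame_section (M, N) 1"
    using sectioned_lift_strand [OF proper sec, of x] z w
    unfolding sectioned_def MN all_less_8 by blast+
  \<comment> \<open>the border is the line \<open>2 y = N - M\<close>\<close>
  have wz: "w = z + (0, 1)" and zh: "2 * snd z = N - M - 1"
    using s d by (cases z; cases w; auto simp: mem_frame_section moves_def)+
  note ends = last_lift_strand [OF ne] hd_lift_strand [OF ne]
  obtain j where j: "j \<in> set (sources x 0)" "z - offset x (m, n) 0 \<in> set (a j)"
    using z by (auto simp: mem_lift_strand)
  obtain k where k: "k \<in> set (sources x 1)" "w - offset x (m, n) 1 \<in> set (a k)"
    using w by (auto simp: mem_lift_strand)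
  have jk: "j < 8" "k < 8" using j k sources_less [of 0] sources_less [of 1] by auto
  show ?thesis
  proof (cases x)
    case Lf
    define z0 where "z0 = z - (m + n, 0)"
    define w0 where "w0 = w - (m, m)"
    have z0: "j = 3 \<or> j = 4 \<or> j = 5" "z0 \<in> set (a j)" and w0: "w0 \<in> set (a 1)"
      using j k by (auto simp: z0_def w0_def Lf)
    have h: "2 * snd z0 = m + n - 1" using zh MN by (auto simp: z0_def Lf)
    have "j = 3"
      using z0 in_sec [OF jk(1) z0(2)] h mn by (cases z0) (auto simp: mem_frame_section)
    then have y: "z0 + (n, - m) \<in> set (a 7) \<union> set (a 0)"
      using lands(2) [of 3 z0] z0 by simp
    have wy: "w0 = (z0 + (n, - m)) + (0, 1)"
      by (simp add: z0_def w0_def wz prod_eq_iff)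
    have u: "w0 - (z0 + (n, - m)) \<in> unit_moves"
      unfolding wy by (simp add: moves_def)
    have "z0 + (n, - m) \<in> set (a 0)"
      using y neighbour [of 7 1 "z0 + (n, - m)" w0] w0 u by auto
    then have "z0 + (n, - m) = last (a 0)" "w0 = hd (a 1)"
      using crossing [of 0 "z0 + (n, - m)" w0] w0 u by auto
    moreover have "hd (a 3) = last (a 0) + (- n, m)" using links(1) [of 0] by simp
    ultimately have "z0 = hd (a 3)" "w0 = hd (a 1)"
      by (simp_all add: prod_eq_iff)
    then show ?thesis
      by (simp add: ends Lf reversing_def) (auto simp: z0_def w0_def diff_eq_eq)
  next
    case Lg
    define z0 where "z0 = z - (n - m, 0)"
    define w0 where "w0 = w - (n, n)"
    have z0: "z0 \<in> set (a 0)" and w0: "k = 4 \<or> k = 5 \<or> k = 6" "w0 \<in> set (a k)"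
      using j k by (auto simp: z0_def w0_def Lg)
    have h: "2 * snd w0 = 1 - m - n" using zh MN by (auto simp: wz w0_def Lg)
    have "k = 5 \<or> k = 6"
      using w0 in_sec [OF jk(2) w0(2)] h mn by (cases w0) (auto simp: mem_frame_section)
    then have y: "w0 + (m, n) \<in> set (a 1) \<union> set (a 2)"
      using lands(2) [of 5 w0] lands(1) [of 6 w0] w0 by auto
    have wy: "w0 + (m, n) = z0 + (0, 1)"
      by (simp add: z0_def w0_def wz prod_eq_iff)
    have u: "w0 + (m, n) - z0 \<in> unit_moves"
      unfolding wy by (simp add: moves_def)
    have "w0 + (m, n) \<in> set (a 1)"
      using y neighbour [of 0 2 z0 "w0 + (m, n)"] z0 u by auto
    then have "z0 = last (a 0)" "w0 + (m, n) = hd (a 1)"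
      using crossing [of 0 z0 "w0 + (m, n)"] z0 u by auto
    moreover have "last (a 6) = hd (a 1) + (- m, - n)" using links(2) [of 1] by simp
    ultimately have "z0 = last (a 0)" "w0 = last (a 6)"
      by (simp_all add: prod_eq_iff)
    then show ?thesis
      by (simp add: ends Lg reversing_def) (auto simp: z0_def w0_def diff_eq_eq)
  next
    case Lh
    define z0 where "z0 = z - (m + n, 0)"
    define w0 where "w0 = w - (n, n)"
    have z0: "j = 2 \<or> j = 3 \<or> j = 4 \<or> j = 5 \<or> j = 6" "z0 \<in> set (a j)"
      and w0: "k = 0 \<or> k = 1 \<or> k = 2" "w0 \<in> set (a k)"
      using j k by (auto simp: z0_def w0_def Lh)
    have h: "2 * snd z0 = m + n - 1" using zh MN by (auto simp: z0_def Lh)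
    have "j = 2 \<or> j = 3"
      using z0 in_sec [OF jk(1) z0(2)] h mn by (cases z0) (auto simp: mem_frame_section)
    then have y: "z0 + (m, - n) \<in> set (a 6) \<union> set (a 7)"
      using lands(2) [of 2 z0] lands(1) [of 3 z0] z0 by auto
    have wy: "w0 = (z0 + (m, - n)) + (0, 1)"
      by (simp add: z0_def w0_def wz prod_eq_iff)
    have u: "w0 - (z0 + (m, - n)) \<in> unit_moves"
      unfolding wy by (simp add: moves_def)
    have "z0 + (m, - n) \<in> set (a 7)" "k = 0"
      using y neighbour [OF _ jk(2) _ w0(2) u, of 7] neighbour [OF _ jk(2) _ w0(2) u, of 6] w0(1) by auto
    then have "z0 + (m, - n) = last (a 7)" "w0 = hd (a 0)"
      using crossing [of 7 "z0 + (m, - n)" w0] w0 u by auto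
    moreover have "hd (a 2) = last (a 7) + (- m, n)" using links(1) [of 7] by simp
    ultimately have "z0 = hd (a 2)" "w0 = hd (a 0)"
      by (simp_all add: prod_eq_iff)
    then show ?thesis
      by (simp add: ends Lh reversing_def) (auto simp: z0_def w0_def diff_eq_eq)
  qed
qed

lemma crossing_lift_NE:
  assumes z: "z \<in> set (lift_strand x (m, n) a 1)" and w: "w \<in> set (lift_strand x (m, n) a 2)"
    and d: "w - z \<in> unit_moves"
  shows "z = last (lift_strand x (m, n) a 1) \<and> w = hd (lift_strand x (m, n) a 2)"
proof -
  obtain M N where MN: "next_prop x (m, n) = (M, N)" by (cases "next_prop x (m, n)")
  have s: "z \<in> frame_section (M, N) 1" "w \<in> frame_section (M, N) 2"
    using sectioned_lift_strand [OF proper sec, of x] z w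
    unfolding sectioned_def MN all_less_8 by blast+
  \<comment> \<open>the border is the line \<open>2 x = N - M\<close>\<close>
  have wz: "z = w + (1, 0)" and wh: "2 * fst w = N - M - 1"
    using s d by (cases z; cases w; auto simp: mem_frame_section moves_def)+
  note ends = last_lift_strand [OF ne] hd_lift_strand [OF ne]
  obtain j where j: "j \<in> set (sources x 1)" "z - offset x (m, n) 1 \<in> set (a j)"
    using z by (auto simp: mem_lift_strand)
  obtain k where k: "k \<in> set (sources x 2)" "w - offset x (m, n) 2 \<in> set (a k)"
    using w by (auto simp: mem_lift_strand)
  have jk: "j < 8" "k < 8" using j k sources_less [of 1] sources_less [of 2] by auto
  show ?thesis
  proof (cases x)
    case Lf
    define z0 where "z0 = z - (m, m)"
    define w0 where "w0 = w - (0, m + n)"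
    have z0: "z0 \<in> set (a 1)" and w0: "k = 5 \<or> k = 6 \<or> k = 7" "w0 \<in> set (a k)"
      using j k by (auto simp: z0_def w0_def Lf)
    have h: "2 * fst w0 = m + n - 1" using wh MN by (auto simp: w0_def Lf)
    have "k = 7"
      using w0 in_sec [OF jk(2) w0(2)] h mn by (cases w0) (auto simp: mem_frame_section)
    then have y: "w0 + (- m, n) \<in> set (a 2) \<union> set (a 3)"
      using lands(1) [of 7 w0] w0 by simp
    have wy: "w0 + (- m, n) = z0 + (- 1, 0)"
      by (simp add: z0_def w0_def wz prod_eq_iff)
    have u: "w0 + (- m, n) - z0 \<in> unit_moves"
      unfolding wy by (simp add: moves_def)
    have "w0 + (- m, n) \<in> set (a 2)"
      using y neighbour [of 1 3 z0 "w0 + (- m, n)"] z0 u by auto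
    then have "z0 = last (a 1)" "w0 + (- m, n) = hd (a 2)"
      using crossing [of 1 z0 "w0 + (- m, n)"] z0 u by auto
    moreover have "last (a 7) = hd (a 2) + (m, - n)" using links(2) [of 2] by simp
    ultimately have "z0 = last (a 1)" "w0 = last (a 7)"
      by (simp_all add: prod_eq_iff)
    then show ?thesis
      by (simp add: ends Lf reversing_def) (auto simp: z0_def w0_def diff_eq_eq)
  next
    case Lg
    define z0 where "z0 = z - (n, n)"
    define w0 where "w0 = w - (0, n - m)"
    have z0: "j = 4 \<or> j = 5 \<or> j = 6" "z0 \<in> set (a j)" and w0: "w0 \<in> set (a 2)"
      using j k by (auto simp: z0_def w0_def Lg)
    have h: "2 * fst z0 = 1 - m - n" using wh MN by (auto simp: wz z0_def Lg)
    have "j = 4 \<or> j = 5"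
      using z0 in_sec [OF jk(1) z0(2)] h mn by (cases z0) (auto simp: mem_frame_section)
    then have y: "z0 + (n, m) \<in> set (a 0) \<union> set (a 1)"
      using lands(2) [of 4 z0] lands(1) [of 5 z0] z0 by auto
    have wy: "w0 = (z0 + (n, m)) + (- 1, 0)"
      by (simp add: z0_def w0_def wz prod_eq_iff)
    have u: "w0 - (z0 + (n, m)) \<in> unit_moves"
      unfolding wy by (simp add: moves_def)
    have "z0 + (n, m) \<in> set (a 1)"
      using y neighbour [of 0 2 "z0 + (n, m)" w0] w0 u by auto
    then have "z0 + (n, m) = last (a 1)" "w0 = hd (a 2)"
      using crossing [of 1 "z0 + (n, m)" w0] w0 u by auto
    moreover have "hd (a 4) = last (a 1) + (- n, - m)" using links(1) [of 1] by simp
    ultimately have "z0 = hd (a 4)" "w0 = hd (a 2)"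
      by (simp_all add: prod_eq_iff)
    then show ?thesis
      by (simp add: ends Lg reversing_def) (auto simp: z0_def w0_def diff_eq_eq)
  next
    case Lh
    define z0 where "z0 = z - (n, n)"
    define w0 where "w0 = w - (0, m + n)"
    have z0: "j = 0 \<or> j = 1 \<or> j = 2" "z0 \<in> set (a j)"
      and w0: "k = 0 \<or> k = 7 \<or> k = 6 \<or> k = 5 \<or> k = 4" "w0 \<in> set (a k)"
      using j k by (auto simp: z0_def w0_def Lh)
    have h: "2 * fst w0 = m + n - 1" using wh MN by (auto simp: w0_def Lh)
    have "k = 0 \<or> k = 7"
      using w0 in_sec [OF jk(2) w0(2)] h mn by (cases w0) (auto simp: mem_frame_section)
    then have y: "w0 + (- n, m) \<in> set (a 3) \<union> set (a 4)"
      using lands(1) [of 0 w0] lands(2) [of 7 w0] w0 by auto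
    have wy: "w0 + (- n, m) = z0 + (- 1, 0)"
      by (simp add: z0_def w0_def wz prod_eq_iff)
    have u: "w0 + (- n, m) - z0 \<in> unit_moves"
      unfolding wy by (simp add: moves_def)
    have "w0 + (- n, m) \<in> set (a 3)" "j = 2"
      using y neighbour [OF jk(1) _ z0(2) _ u, of 3] neighbour [OF jk(1) _ z0(2) _ u, of 4] z0(1) by auto
    then have "z0 = last (a 2)" "w0 + (- n, m) = hd (a 3)"
      using crossing [of 2 z0 "w0 + (- n, m)"] z0 u by auto
    moreover have "last (a 0) = hd (a 3) + (n, - m)" using links(2) [of 3] by simp
    ultimately have "z0 = last (a 2)" "w0 = last (a 0)"
      by (simp_all add: prod_eq_iff)
    then show ?thesis
      by (simp add: ends Lh reversing_def) (auto simp: z0_def w0_def diff_eq_eq)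
  qed
qed

lemma crossing_lift:
  assumes "i < 8" "z \<in> set (lift_strand x (m, n) a i)" "w \<in> set (lift_strand x (m, n) a ((i + 1) mod 8))"
    and "w - z \<in> unit_moves"
  shows "z = last (lift_strand x (m, n) a i) \<and> w = hd (lift_strand x (m, n) a ((i + 1) mod 8))"
  using assms
proof (induction arbitrary: z w rule: turn_induct)
  case even
  then show ?case using crossing_lift_E by simp
next
  case odd
  then show ?case using crossing_lift_NE by simp
next
  case (turn i)
  let ?b = "lift_strand x (m, n) a"
  have b: "?b ((j + 2) mod 8) = map turn (?b j)" if "j < 8" for j
    using turning_lift_strand [OF turning, of x "(m, n)"] that by (simp add: turning_def)
  have i1: "((i + 2) mod 8 + 1) mod 8 = ((i + 1) mod 8 + 2) mod 8"
    by (simp add: mod_simps ac_simps)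
  obtain z' where z': "z = turn z'" "z' \<in> set (?b i)"
    using turn b [of i] by auto
  obtain w' where w': "w = turn w'" "w' \<in> set (?b ((i + 1) mod 8))"
    using turn b [of "(i + 1) mod 8"] by (auto simp: i1)
  have "turn (w' - z') \<in> unit_moves"
    using turn(5) by (simp add: z' w' turn_diff)
  from turn_moves [OF turn_moves [OF turn_moves [OF this]]]
  have "w' - z' \<in> unit_moves" by simp
  then have "z' = last (?b i) \<and> w' = hd (?b ((i + 1) mod 8))"
    using turn z' w' by blast
  moreover have "?b i \<noteq> []" "?b ((i + 1) mod 8) \<noteq> []" using z' w' by auto
  ultimately show ?case
    using b [of i] b [of "(i + 1) mod 8"] turn(1) by (simp add: i1 z' w' last_map hd_map)
qed

lemma tight_lift: "tight (lift_strand x (m, n) a)"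
  unfolding tight_def using within_lift crossing_lift by blast

end

lemma tight_strands_start:
  "tight (strands [] (1, 2))"
  unfolding tight_def by (auto simp: moves_def zero_prod_def dest!: less_8_cases)

lemma sectioned_start: "sectioned (1, 2) (strands [] (1, 2))"
proof -
  have "start (1, 2) i \<in> frame_section (1, 2) i" if "i < 8" for i
    using less_8_cases [OF that] by (elim disjE) (simp_all add: mem_frame_section)
  then show ?thesis by (simp add: sectioned_def)
qed

lemma tight_and_sectioned:
  "sectioned (proportions e) (strands e (1, 2)) \<and> tight (strands e (1, 2))"
proof (induction e)
  case Nil
  then show ?case using tight_strands_start sectioned_start by (simp add: proportions_props)
next
  case (Cons x e)
  obtain m n where B: "proportions e = (m, n)" by (cases "proportions e")
  then have B': "props e (1, 2) = (m, n)" by (simp add: proportions_props)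
  interpret tight_strands m n "strands e (1, 2)"
    using Cons proper_proportions [of e] linked_strands [of e "(1, 2) :: square"] strands_closed [of e "(1, 2) :: square"]
    unfolding B B' by unfold_locales (auto simp: turning_strands strands_ne)
  show ?case
    using tight_lift [of x] sectioned_lift_strand [OF proper sec, of x]
    by (simp add: proportions_props B')
qed

section \<open>Direction matrices\<close>

lemma mat2_mult_vec:
  "mat2 a b c d *v vector [x, y] = vector [a * x + b * y, c * x + d * y]"
  by (simp add: vec_eq_iff forall_2 matrix_vector_mult_def sum_2)

lemma mat2_mult_mat2:
  "mat2 a b c d ** mat2 a' b' c' d' =
    mat2 (a * a' + b * c') (a * b' + b * d') (c * a' + d * c') (c * b' + d * d')"
  by (simp add: vec_eq_iff forall_2 matrix_matrix_mult_def sum_2)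

lemma mat2_eq_iff: "mat2 a b c d = mat2 a' b' c' d' \<longleftrightarrow> a = a' \<and> b = b' \<and> c = c' \<and> d = d'"
  by (auto simp: vec_eq_iff forall_2)

lemma vector2_eq_iff: "(vector [a, b] :: real^2) = vector [c, d] \<longleftrightarrow> a = c \<and> b = d"
  by (auto simp: vec_eq_iff forall_2)

lemma uminus_mat2: "- mat2 a b c d = mat2 (- a) (- b) (- c) (- d)"
  by (simp add: vec_eq_iff forall_2)

lemma dirmat_simps:
  "dirmat 1 = mat2 0 1 1 0" "dirmat 2 = mat2 1 0 0 1" "dirmat 3 = mat2 (-1) 0 0 1"
  "dirmat 4 = mat2 0 (-1) 1 0" "dirmat 5 = mat2 0 (-1) (-1) 0" "dirmat 6 = mat2 (-1) 0 0 (-1)"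
  "dirmat 7 = mat2 1 0 0 (-1)" "dirmat 8 = mat2 0 1 (-1) 0"
  by (simp_all add: dirmat_def uminus_mat2)

lemma one_to_8: "{1..8::nat} = {1, 2, 3, 4, 5, 6, 7, 8}"
  by auto

lemma dirmats: "dirmat ` {1..8} = {mat2 0 1 1 0, mat2 1 0 0 1, mat2 (-1) 0 0 1, mat2 0 (-1) 1 0,
    mat2 0 (-1) (-1) 0, mat2 (-1) 0 0 (-1), mat2 1 0 0 (-1), mat2 0 1 (-1) 0}"
  by (simp only: one_to_8 image_insert image_empty dirmat_simps)

lemma dirmat_inj:
  assumes "i \<in> {1..8}" "j \<in> {1..8}" "0 < r" "r < s"
    and "dirmat i *v vector [r, s] = dirmat j *v vector [r, s]"
  shows "i = j"
  using assms(1,2,5) unfolding one_to_8 insert_iff empty_iff simp_thms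
  by (elim disjE; use assms(3,4) in \<open>simp add: dirmat_simps mat2_mult_vec vector2_eq_iff\<close>)

section \<open>Direction graphs with a potential\<close>

definition pos_vec :: "square \<Rightarrow> real^2" where
  "pos_vec z = vector [real_of_int (fst z), real_of_int (snd z)]"

lemma cyclic_induct:
  fixes P :: "nat \<Rightarrow> bool"
  assumes "i < k" "P i" "\<And>i. i < k \<Longrightarrow> P i \<Longrightarrow> P (Suc i mod k)" "j < k"
  shows "P j"
proof -
  have *: "P ((i + d) mod k)" for d
  proof (induction d)
    case (Suc d)
    then show ?case using assms(1) assms(3) [of "(i + d) mod k"] by (simp add: mod_Suc_eq)
  qed (use assms in simp)
  have "(i + (k - i + j)) mod k = j" using assms by simp
  then show ?thesis using * [of "k - i + j"] by simp
qed

text \<open>A cycle \<open>c\<close> of the skew \<open>(r, s)\<close>-leaper together with a potential, that is, a matrix for each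
  square such that the difference of two matrices yields the difference of the squares when applied
  to \<open>(r, s)\<close>; arcs are the pairs whose difference is a direction matrix.  The graph
  extracted from such a cycle is a coherent connected direction graph, and its distances are the
  differences of the potential.\<close>

locale potential_cycle =
  fixes r s :: int and c :: "square list" and \<pi> :: "square \<Rightarrow> real^2^2"
  assumes rs: "0 < r" "r < s" and dist: "distinct c" and len: "3 \<le> length c"
    and inj: "inj_on \<pi> (set c)"
    and arcs: "\<And>x y. x \<in> set c \<Longrightarrow> y \<in> set c \<Longrightarrow>
      (x, y) \<in> parcs (graph_of (extracted r s c)) \<longleftrightarrow> \<pi> y - \<pi> x \<in> dirmat ` {1..8}"
    and pos: "\<And>x y. x \<in> set c \<Longrightarrow> y \<in> set c \<Longrightarrow>
      (\<pi> y - \<pi> x) *v vector [real_of_int r, real_of_int s] = pos_vec (y - x)"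
begin

abbreviation "\<Gamma> \<equiv> extracted r s c"
abbreviation "G \<equiv> graph_of \<Gamma>"

lemma verts: "pverts G = set c"
  by (simp add: extracted_def)

lemma parcs_def: "(x, y) \<in> parcs G \<longleftrightarrow> (\<exists>i<length c. {x, y} = {c ! i, c ! (Suc i mod length c)})"
  by (simp add: extracted_def)

lemma parcs_verts: "(x, y) \<in> parcs G \<Longrightarrow> x \<in> set c \<and> y \<in> set c"
proof -
  assume "(x, y) \<in> parcs G"
  then obtain i where i: "i < length c" "{x, y} = {c ! i, c ! (Suc i mod length c)}"
    by (auto simp: parcs_def)
  then have "Suc i mod length c < length c" by (intro mod_less_divisor) auto
  then have "c ! i \<in> set c" "c ! (Suc i mod length c) \<in> set c" using i by auto
  then have "{x, y} \<subseteq> set c" unfolding i(2) by auto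
  then show ?thesis by auto
qed

lemma parcs_sym: "(x, y) \<in> parcs G \<longleftrightarrow> (y, x) \<in> parcs G"
  by (simp add: parcs_def insert_commute)

lemma wf: "pair_wf_digraph G"
  by unfold_locales (auto dest: parcs_verts simp: verts)

lemma sym: "pair_sym_digraph G"
proof -
  interpret pair_wf_digraph G by (rule wf)
  show ?thesis
    by unfold_locales (use parcs_sym in \<open>auto simp: symmetric_def sym_def\<close>)
qed

lemma label:
  assumes "(x, y) \<in> parcs G"
  shows "label_of \<Gamma> (x, y) \<in> {1..8}" "dirmat (label_of \<Gamma> (x, y)) = \<pi> y - \<pi> x"
proof -
  have xy: "x \<in> set c" "y \<in> set c" using parcs_verts [OF assms] by auto
  then obtain k where k: "k \<in> {1..8}" "\<pi> y - \<pi> x = dirmat k"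
    using arcs assms by auto
  have v: "vector [real_of_int (fst (y - x)), real_of_int (snd (y - x))] =
      dirmat k *v vector [real_of_int r, real_of_int s]"
    using pos [OF xy] k(2) by (simp add: pos_vec_def)
  have "skew_direction r s (y - x) k"
    using k(1) v by (simp only: skew_direction_def simp_thms)
  moreover have "i = k" if "skew_direction r s (y - x) i" for i
    using dirmat_inj [of i k "real_of_int r" "real_of_int s"] that k(1) v rs
    by (simp only: skew_direction_def of_int_0_less_iff of_int_less_iff)
  ultimately have "(THE i. skew_direction r s (y - x) i) = k" by (rule the_equality)
  then have "label_of \<Gamma> (x, y) = k" by (simp add: extracted_def)
  then show "label_of \<Gamma> (x, y) \<in> {1..8}" "dirmat (label_of \<Gamma> (x, y)) = \<pi> y - \<pi> x"
    using k by auto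
qed

lemma walk_sum_potential:
  assumes "pcas u w v" "set w \<subseteq> parcs G"
  shows "walk_sum \<Gamma> w = \<pi> v - \<pi> u"
  using assms
proof (induction w arbitrary: u)
  case (Cons a w)
  obtain x y where a: "a = (x, y)" by (cases a)
  have "walk_sum \<Gamma> w = \<pi> v - \<pi> y" using Cons a by auto
  moreover have "dirmat (label_of \<Gamma> a) = \<pi> y - \<pi> x" using Cons.prems label a by auto
  ultimately show ?case using Cons.prems a by (simp add: walk_sum_def)
qed (simp add: walk_sum_def)

lemma direction_graph: "direction_graph \<Gamma>"
  unfolding direction_graph_def
proof (intro conjI ballI allI impI)
  show "pair_sym_digraph G" by (rule sym)
  show "label_of \<Gamma> a \<in> {1..8}" if "a \<in> parcs G" for a
    using label(1) [of "fst a" "snd a"] that by simp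
  show "walk_sum \<Gamma> w = 0" if "pre_digraph.cycle (with_proj G) w" for w
    using that walk_sum_potential
    by (auto simp: pre_digraph.cycle_def pre_digraph.awalk_def cas_with_proj_eq)
qed

lemma reachable:
  assumes "x \<in> set c" "y \<in> set c"
  shows "x \<rightarrow>\<^sup>*\<^bsub>with_proj G\<^esub> y"
proof -
  interpret pair_wf_digraph G by (rule wf)
  obtain i where i: "i < length c" "x = c ! i" using assms by (auto simp: in_set_conv_nth)
  obtain j where j: "j < length c" "y = c ! j" using assms by (auto simp: in_set_conv_nth)
  have "x \<rightarrow>\<^sup>*\<^bsub>with_proj G\<^esub> c ! j"
  proof (rule cyclic_induct [OF i(1) _ _ j(1)])
    show "x \<rightarrow>\<^sup>*\<^bsub>with_proj G\<^esub> c ! i" using assms i by (simp add: verts)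
    show "x \<rightarrow>\<^sup>*\<^bsub>with_proj G\<^esub> c ! (Suc i mod length c)"
      if "i < length c" "x \<rightarrow>\<^sup>*\<^bsub>with_proj G\<^esub> c ! i" for i
    proof -
      have "(c ! i, c ! (Suc i mod length c)) \<in> parcs G" using that(1) by (auto simp: parcs_def)
      then show ?thesis using that(2) reachable_adj_trans by simp
    qed
  qed
  then show ?thesis by (simp add: j)
qed

lemma distance_potential:
  assumes "x \<in> set c" "y \<in> set c"
  shows "distance \<Gamma> x y = \<pi> y - \<pi> x"
  unfolding distance_def
proof (rule the_equality)
  interpret pair_wf_digraph G by (rule wf)
  obtain w where "apath x w y" using reachable [OF assms] reachable_apath by blast
  then show "\<exists>w. pre_digraph.apath (with_proj G) x w y \<and> \<pi> y - \<pi> x = walk_sum \<Gamma> w"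
    using walk_sum_potential [of x w y] by (intro exI [of _ w]) (simp add: apath_def awalk_def)
next
  interpret pair_wf_digraph G by (rule wf)
  fix M assume "\<exists>w. pre_digraph.apath (with_proj G) x w y \<and> M = walk_sum \<Gamma> w"
  then obtain w where "apath x w y" "M = walk_sum \<Gamma> w" by auto
  then show "M = \<pi> y - \<pi> x"
    using walk_sum_potential [of x w y] by (simp add: apath_def awalk_def)
qed

lemma coherent: "coherent \<Gamma>"
  unfolding coherent_def
proof (intro allI impI)
  fix x y assume "x \<rightarrow>\<^sup>*\<^bsub>with_proj G\<^esub> y"
  then have xy: "x \<in> set c" "y \<in> set c"
    by (auto elim!: reachable_in_vertsE simp: verts)
  then show "(distance \<Gamma> x y = 0 \<longleftrightarrow> x = y) \<and>
        (distance \<Gamma> x y \<in> dirmat ` {1..8} \<longleftrightarrow> (x, y) \<in> parcs G)"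
    using inj arcs by (auto simp: distance_potential inj_on_def)
qed

lemma connected: "Digraph_Component.connected (with_proj G)"
proof -
  have "mk_symmetric (with_proj G) = G"
    unfolding mk_symmetric_def using parcs_sym by (auto intro!: pair_pre_digraph.equality)
  then show ?thesis
    using reachable len by (auto simp: connected_def strongly_connected_def verts)
qed

end

lemma extracted_iso:
  assumes "distinct c" "distinct d" "length c = length d"
    and wf: "pair_wf_digraph (graph_of (extracted r s c))"
  shows "digraph_iso (with_proj (graph_of (extracted r s c))) (with_proj (graph_of (extracted r' s' d)))"
proof -
  let ?n = "length d"
  define h where "h x = d ! (THE i. i < ?n \<and> c ! i = x)" for x
  have h: "h (c ! i) = d ! i" if "i < ?n" for i
  proof -
    have "(THE j. j < ?n \<and> c ! j = c ! i) = i"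
      using that assms by (intro the_equality) (auto simp: nth_eq_iff_index_eq)
    then show ?thesis by (simp add: h_def)
  qed
  have hinj: "inj_on h (set c)"
  proof (rule inj_onI)
    fix x y assume "x \<in> set c" "y \<in> set c" and e: "h x = h y"
    then obtain i j where i: "i < ?n" "x = c ! i" and j: "j < ?n" "y = c ! j"
      using assms(3) by (metis in_set_conv_nth)
    then have "d ! i = d ! j" using e h by simp
    then show "x = y" using i j assms(2) by (simp add: nth_eq_iff_index_eq)
  qed
  have "h ` set c = (\<lambda>i. h (c ! i)) ` {..<?n}"
    using assms(3) by (auto simp: set_conv_nth)
  also have "\<dots> = (\<lambda>i. d ! i) ` {..<?n}"
    using h by (intro image_cong) auto
  also have "\<dots> = set d" by (auto simp: set_conv_nth)
  finally have himg: "h ` set c = set d" .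
  let ?C = "parcs (graph_of (extracted r s c))" and ?D = "parcs (graph_of (extracted r' s' d))"
  have C: "(x, y) \<in> ?C \<longleftrightarrow> (\<exists>i<?n. (x, y) \<in> {(c ! i, c ! (Suc i mod ?n)), (c ! (Suc i mod ?n), c ! i)})" for x y
    using assms(3) by (auto simp: extracted_def doubleton_eq_iff)
  have D: "(x, y) \<in> ?D \<longleftrightarrow> (\<exists>i<?n. (x, y) \<in> {(d ! i, d ! (Suc i mod ?n)), (d ! (Suc i mod ?n), d ! i)})" for x y
    by (auto simp: extracted_def doubleton_eq_iff)
  have hs: "h (c ! (Suc i mod ?n)) = d ! (Suc i mod ?n)" if "i < ?n" for i
    using that by (intro h) (auto intro: mod_less_divisor)
  have img: "map_prod h h ` ?C = ?D"
  proof (intro set_eqI iffI)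
    fix p assume "p \<in> map_prod h h ` ?C"
    then obtain x y where "(x, y) \<in> ?C" "p = (h x, h y)" by auto
    then show "p \<in> ?D" unfolding C using h hs by (auto simp: D)
  next
    fix p assume "p \<in> ?D"
    then obtain i where i: "i < ?n"
      and "p = (d ! i, d ! (Suc i mod ?n)) \<or> p = (d ! (Suc i mod ?n), d ! i)"
      by (cases p) (auto simp: D)
    then have "p = map_prod h h (c ! i, c ! (Suc i mod ?n)) \<or> p = map_prod h h (c ! (Suc i mod ?n), c ! i)"
      using h hs by auto
    moreover have "(c ! i, c ! (Suc i mod ?n)) \<in> ?C" "(c ! (Suc i mod ?n), c ! i) \<in> ?C"
      using i by (auto simp: C)
    ultimately show "p \<in> map_prod h h ` ?C" by blast
  qed
  have sub: "?C \<subseteq> set c \<times> set c"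
  proof
    fix p assume p: "p \<in> ?C"
    interpret pair_wf_digraph "graph_of (extracted r s c)" by (rule wf)
    show "p \<in> set c \<times> set c"
      using arc_fst_in_verts [OF p] arc_snd_in_verts [OF p]
      by (cases p) (auto simp: extracted_def)
  qed
  let ?f = "\<lparr>iso_verts = h, iso_arcs = map_prod h h, iso_head = snd, iso_tail = fst\<rparr>"
  have "wf_digraph (with_proj (graph_of (extracted r s c)))"
    using wf by (simp add: wf_digraph_wp_iff)
  moreover have "inj_on (map_prod h h) ?C"
    using map_prod_inj_on [OF hinj hinj] sub by (rule inj_on_subset)
  ultimately have "pre_digraph.digraph_isomorphism (with_proj (graph_of (extracted r s c))) ?f"
    using hinj by (simp add: pre_digraph.digraph_isomorphism_def) (simp add: extracted_def)
  moreover have "with_proj (graph_of (extracted r' s' d)) = app_iso ?f (with_proj (graph_of (extracted r s c)))"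
    using himg img by (simp add: app_iso_def with_proj_def) (simp add: extracted_def)
  ultimately show ?thesis unfolding digraph_iso_def by blast
qed

section \<open>Hamiltonian cycles in two-regular graphs\<close>

text \<open>A longest path closes up: both neighbours of its first vertex lie on it, and the one that is not
  the second vertex must be the last one, since an interior vertex would have degree three.\<close>

lemma two_regular_connected_cycle:
  fixes V :: "'a set"
  assumes fin: "finite V" and ne: "V \<noteq> {}" and sym: "\<And>x y. E x y \<Longrightarrow> E y x"
    and reg: "\<And>x. x \<in> V \<Longrightarrow> \<exists>y z. y \<noteq> z \<and> y \<noteq> x \<and> z \<noteq> x \<and> {w\<in>V. E x w} = {y, z}"
    and conn: "\<And>T x y. (\<And>x y. x \<in> V \<Longrightarrow> y \<in> V \<Longrightarrow> E x y \<Longrightarrow> T x \<longleftrightarrow> T y) \<Longrightarrow>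
      x \<in> V \<Longrightarrow> y \<in> V \<Longrightarrow> (T x \<longleftrightarrow> (T y :: bool))"
  shows "\<exists>c. distinct c \<and> set c = V \<and> 3 \<le> length c \<and>
    (\<forall>i<length c. E (c ! i) (c ! (Suc i mod length c)))"
proof -
  define path where "path c \<longleftrightarrow> distinct c \<and> set c \<subseteq> V \<and> c \<noteq> [] \<and> successively E c" for c
  have bound: "length c \<le> card V" if "path c" for c
    using that fin by (metis card_mono distinct_card path_def)
  obtain v where "v \<in> V" using ne by auto
  then have "path [v]" by (simp add: path_def)
  then obtain c where c: "path c" and max: "\<And>d. path d \<Longrightarrow> length d \<le> length c"
    using ex_has_greatest_nat [of path "[v]" length "card V + 1"] bound by (metis less_Suc_eq_le Suc_eq_plus1)
  let ?k = "length c"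
  have dc: "distinct c" "set c \<subseteq> V" "c \<noteq> []" and step: "\<And>i. Suc i < ?k \<Longrightarrow> E (c ! i) (c ! Suc i)"
    using c by (auto simp: path_def successively_conv_nth)
  have inV: "c ! i \<in> V" if "i < ?k" for i using that dc by auto
  have nth_inj: "c ! i = c ! j \<longleftrightarrow> i = j" if "i < ?k" "j < ?k" for i j
    using that dc by (simp add: nth_eq_iff_index_eq)
  have two: "w = y \<or> w = z"
    if xV: "x \<in> V" and E: "y \<in> V" "z \<in> V" "w \<in> V" "E x y" "E x z" "E x w" "y \<noteq> z" for x y z w
  proof -
    obtain y' z' where "{w\<in>V. E x w} = {y', z'}" using reg [OF xV] by blast
    then have "y \<in> {y', z'}" "z \<in> {y', z'}" "w \<in> {y', z'}" using E by blast+
    then show ?thesis using E(7) by auto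
  qed
  have k0: "0 < ?k" using dc by simp
  obtain y z where yz: "y \<noteq> z" "y \<noteq> c ! 0" "z \<noteq> c ! 0" "{w\<in>V. E (c ! 0) w} = {y, z}"
    using reg [OF inV [OF k0]] by blast
  have nb: "w \<in> set c" if w: "w \<in> V" "E (c ! 0) w" for w
  proof (rule ccontr)
    assume "w \<notin> set c"
    moreover have "successively E (w # c)"
      using c w sym by (cases c) (auto simp: path_def)
    ultimately have "path (w # c)" using c w by (auto simp: path_def)
    then show False using max by fastforce
  qed
  have "y \<in> set c" "z \<in> set c" "E (c ! 0) y" "E (c ! 0) z" using yz nb by blast+
  then obtain a b where a: "a < ?k" "y = c ! a" and b: "b < ?k" "z = c ! b"
    by (metis in_set_conv_nth)
  have ab: "a \<noteq> b" "a \<noteq> 0" "b \<noteq> 0" using yz(1-3) a(2) b(2) by metis+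
  \<comment> \<open>the neighbour of the first vertex that does not follow it on the path\<close>
  define j where "j = max a b"
  have j: "2 \<le> j" "j < ?k" "E (c ! 0) (c ! j)"
    using ab a b \<open>E (c ! 0) y\<close> \<open>E (c ! 0) z\<close> by (auto simp: j_def max_def)
  have "Suc j = ?k"
  proof (rule ccontr)
    assume "Suc j \<noteq> ?k"
    then have s: "Suc j < ?k" using j by simp
    have "Suc (j - 1) = j" using j by simp
    then have "E (c ! (j - 1)) (c ! j)" using step [of "j - 1"] j by simp
    moreover have "c ! (j - 1) \<noteq> c ! Suc j" using nth_inj [of "j - 1" "Suc j"] j s by simp
    ultimately have "c ! 0 = c ! (j - 1) \<or> c ! 0 = c ! Suc j"
      using inV [of "j - 1"] inV [OF s] inV [OF j(2)] inV [OF k0] j step [OF s] sym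
      by (intro two [of "c ! j"]) auto
    then show False using nth_inj [of 0 "j - 1"] nth_inj [of 0 "Suc j"] s j k0 by auto
  qed
  then have k: "3 \<le> ?k" and last: "E (c ! j) (c ! 0)" using j sym by auto
  have cyc: "E (c ! i) (c ! (Suc i mod ?k))" if "i < ?k" for i
  proof (cases "Suc i < ?k")
    case False
    then have "i = j" using that \<open>Suc j = ?k\<close> by simp
    then show ?thesis using last \<open>Suc j = ?k\<close> by simp
  qed (use step in simp)
  have "x \<in> set c \<longleftrightarrow> y \<in> set c" if xy: "x \<in> V" "y \<in> V" "E x y" for x y
  proof -
    have "y \<in> set c" if x: "x \<in> set c" and xy: "y \<in> V" "E x y" for x y
    proof -
      obtain i where i: "i < ?k" "x = c ! i" using x by (metis in_set_conv_nth)
      define h where "h = (if i = 0 then ?k - 1 else i - 1)"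
      have h: "h < ?k" "Suc h mod ?k = i" using i k by (auto simp: h_def)
      let ?s = "Suc i mod ?k"
      have s: "?s < ?k" using k by (intro mod_less_divisor) linarith
      have "h \<noteq> ?s" using i k by (auto simp: h_def mod_Suc)
      then have "y = c ! h \<or> y = c ! ?s"
        using two [of x "c ! h" "c ! ?s" y] i h s cyc [OF h(1)] cyc [OF i(1)] sym inV nth_inj xy by simp
      then show ?thesis using h s by auto
    qed
    then show ?thesis using xy sym by blast
  qed
  then have "x \<in> set c \<longleftrightarrow> y \<in> set c" if "x \<in> V" "y \<in> V" for x y
    using conn [of "\<lambda>x. x \<in> set c"] that by blast
  then have "set c = V" using dc inV [OF k0] by (metis subsetI subset_antisym nth_mem k0)
  then show ?thesis using dc k cyc by blast
qed

section \<open>Leaper cycles\<close>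

declare frame.simps [simp del]

lemma frame_subset_board: "frame (m, n) \<subseteq> board m n"
  by (auto simp: frame.simps board_def)

lemma leaper_moves_eq: "leaper_moves p q = moves (p, q)"
  by (auto simp: leaper_moves_def moves_def)

lemma leaper_cycle_iff:
  "leaper_cycle p q S c \<longleftrightarrow> 3 \<le> length c \<and> distinct c \<and> set c \<subseteq> S \<and>
    (\<forall>i<length c. c ! (Suc i mod length c) - c ! i \<in> moves (p, q))"
proof -
  have "c ! (Suc i mod length c) \<in> set c" if "i < length c" for i
    using that by (auto intro!: nth_mem mod_less_divisor)
  then show ?thesis
    unfolding leaper_cycle_def leaper_graph_def leaper_moves_eq by (auto dest: subsetD)
qed

text \<open>As squares of a frame have degree two, every leaper move between squares of a cycle
  joins consecutive squares.\<close>

lemma leaper_cycle_neighbours: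
  assumes p: "proper (m, n)" and c: "leaper_cycle m n S c" and F: "set c \<subseteq> frame (m, n)"
    and i: "i < length c" and d: "d \<in> moves (m, n)" "c ! i + d \<in> frame (m, n)"
  shows "\<exists>h<length c. (h = Suc i mod length c \<or> i = Suc h mod length c) \<and> c ! i + d = c ! h"
proof -
  let ?k = "length c"
  have k: "3 \<le> ?k" "distinct c" and step: "\<And>i. i < ?k \<Longrightarrow> c ! (Suc i mod ?k) - c ! i \<in> moves (m, n)"
    using c by (auto simp: leaper_cycle_iff)
  define h where "h = (if i = 0 then ?k - 1 else i - 1)"
  have h: "h < ?k" "Suc h mod ?k = i" using i k by (auto simp: h_def)
  let ?s = "Suc i mod ?k"
  have s: "?s < ?k" using k by (intro mod_less_divisor) linarith
  have "h \<noteq> ?s" using i k by (auto simp: h_def mod_Suc)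
  then have ne: "c ! h - c ! i \<noteq> c ! ?s - c ! i" using h s k by (simp add: nth_eq_iff_index_eq)
  have mn: "0 < m" "m < n" "odd (m + n)" using p by (auto simp: proper_def)
  have "c ! i \<in> frame (m, n)" using F i by auto
  then obtain l where l: "l < 8" "c ! i \<in> frame_section (m, n) l"
    using frame_eq_sections [OF mn] by auto
  have m1: "e = left_move (m, n) l \<or> e = right_move (m, n) l"
    if "e \<in> moves (m, n)" "c ! i + e \<in> frame (m, n)" for e
    using moves_within_frame [OF mn(1,2) l that] .
  have "c ! ?s - c ! i \<in> moves (m, n)" using step [OF i] .
  moreover have "c ! h - c ! i \<in> moves (m, n)"
    using step [OF h(1)] uminus_moves [of "c ! i - c ! h" "(m, n)"] by (simp add: h(2))
  moreover have "c ! ?s \<in> frame (m, n)" "c ! h \<in> frame (m, n)" using F s h by auto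
  ultimately have "d = c ! ?s - c ! i \<or> d = c ! h - c ! i"
    using m1 [of d] m1 [of "c ! ?s - c ! i"] m1 [of "c ! h - c ! i"] ne d by (metis add_diff_cancel_left' diff_add_cancel add.commute)
  then have "c ! i + d = c ! ?s \<or> c ! i + d = c ! h" by auto
  then show ?thesis using h s by auto
qed

section \<open>Shell cycles\<close>

lemma bex_less_4: "(\<exists>k\<in>{..<4}. P k) \<longleftrightarrow> P 0 \<or> P 1 \<or> P 2 \<or> P (3::nat)"
proof -
  have "{..<4} = {0, 1, 2, 3::nat}" by auto
  then show ?thesis by simp
qed

text \<open>In both cases of the definition, the eight subboards of the shell are translates of one
  another by differences of the vectors \<open>start (m, n) i\<close>.\<close>

lemma shell_decompose:
  assumes "proper (m, n)" "n \<le> 3 * m" "z \<in> shell (m, n)"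
  obtains c i where "i < 8" "z = c + start (m, n) i" "\<And>j. j < 8 \<Longrightarrow> c + start (m, n) j \<in> frame_section (m, n) j"
proof -
  \<comment> \<open>the side of the subboards\<close>
  define b where "b = (if n \<le> 2 * m then n - m else 3 * m - n)"
  have mn: "0 < m" "m < n" using assms(1) by (auto simp: proper_def)
  obtain x y where z: "z = (x, y)" by (cases z)
  have *: "\<exists>u v i. - b < 2 * u \<and> 2 * u < b \<and> - b < 2 * v \<and> 2 * v < b \<and> i < 8 \<and> z = (u, v) + start (m, n) i"
  proof -
    define A where "A = (if n \<le> 2 * m then
        {(x, y). n - m < 2 * x \<and> 2 * x < 3 * (n - m) \<and> 2 * \<bar>y\<bar> < n - m} \<union>
        {(x, y). 3 * m - n < 2 * x \<and> 2 * x < m + n \<and> 3 * m - n < 2 * y \<and> 2 * y < m + n}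
      else
        {(x, y). 3 * n - 5 * m < 2 * x \<and> 2 * x < m + n \<and> 2 * \<bar>y\<bar> < 3 * m - n} \<union>
        {(x, y). n - m < 2 * x \<and> 2 * x < 5 * m - n \<and> n - m < 2 * y \<and> 2 * y < 5 * m - n})"
    have A: "(- b < 2 * (x - (n - m)) \<and> 2 * (x - (n - m)) < b \<and> - b < 2 * y \<and> 2 * y < b) \<or>
        (- b < 2 * (x - m) \<and> 2 * (x - m) < b \<and> - b < 2 * (y - m) \<and> 2 * (y - m) < b)"
      if "(x, y) \<in> A" for x y
      using that by (auto simp: A_def b_def split: if_splits)
    have "z \<in> (\<Union>k<4. (turn ^^ k) ` A)"
      using assms(3) by (simp add: A_def rot90_eq_turn)
    then consider "(x, y) \<in> A" | "(y, - x) \<in> A" | "(- x, - y) \<in> A" | "(- y, x) \<in> A"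
      unfolding UN_iff bex_less_4 z by (auto simp: mem_funpow_turn_image mem_turn_image simp del: funpow_turn)
    then show ?thesis
    proof cases
      case 1
      then show ?thesis
        using A [OF 1] by (elim disjE)
          (intro exI [of _ "x - (n - m)"] exI [of _ y] exI [of _ 0], simp add: z,
           intro exI [of _ "x - m"] exI [of _ "y - m"] exI [of _ 1], simp add: z)
    next
      case 2
      then show ?thesis
        using A [OF 2] by (elim disjE)
          (intro exI [of _ x] exI [of _ "y - (n - m)"] exI [of _ 2], simp add: z,
           intro exI [of _ "x + m"] exI [of _ "y - m"] exI [of _ 3], simp add: z)
    next
      case 3
      then show ?thesis
        using A [OF 3] by (elim disjE)
          (intro exI [of _ "x + (n - m)"] exI [of _ y] exI [of _ 4], simp add: z,
           intro exI [of _ "x + m"] exI [of _ "y + m"] exI [of _ 5], simp add: z)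
    next
      case 4
      then show ?thesis
        using A [OF 4] by (elim disjE)
          (intro exI [of _ x] exI [of _ "y + (n - m)"] exI [of _ 6], simp add: z,
           intro exI [of _ "x - m"] exI [of _ "y + m"] exI [of _ 7], simp add: z)
    qed
  qed
  then obtain u v i where uv: "- b < 2 * u" "2 * u < b" "- b < 2 * v" "2 * v < b"
    and i: "i < 8" "z = (u, v) + start (m, n) i" by blast
  have "(u, v) + start (m, n) j \<in> frame_section (m, n) j" if "j < 8" for j
    using less_8_cases [OF that] uv mn assms(2) unfolding b_def
    by (elim disjE; simp add: mem_frame_section split: if_splits)
  then show ?thesis using that i by blast
qed

lemma start_left_move: "i < 8 \<Longrightarrow> start B i + left_move B i = start B ((i + 3) mod 8)"
  by (drule less_8_cases, cases B) auto

text \<open>A cycle within the shell contains with a square all its neighbours in the frame, hence the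
  eight squares around one centre \<open>c\<close>; it has no other squares, having length eight.\<close>

lemma shell_cycle_shape:
  assumes p: "proper (m, n)" and c': "shell_cycle (m, n) c'"
  obtains c where "set c' = (\<lambda>i. c + start (m, n) i) ` {..<8}"
    "\<And>i. i < 8 \<Longrightarrow> c + start (m, n) i \<in> frame_section (m, n) i"
    "\<And>i. i < 8 \<Longrightarrow> shell_paths (m, n) c' i = [c + start (m, n) i]"
proof -
  have mn: "0 < m" "m < n" "odd (m + n)" using p by (auto simp: proper_def)
  have l: "leaper_cycle m n (frame (m, n)) c'" "length c' = 8" "n \<le> 3 * m" "set c' \<subseteq> shell (m, n)"
    using c' by auto
  have "c' ! 0 \<in> set c'" using l(2) by simp
  then have "c' ! 0 \<in> shell (m, n)" using l(4) by blast
  then obtain c i where i: "i < 8" "c' ! 0 = c + start (m, n) i"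
    and s: "\<And>j. j < 8 \<Longrightarrow> c + start (m, n) j \<in> frame_section (m, n) j"
    using shell_decompose [OF p l(3)] by metis
  let ?z = "\<lambda>j. c + start (m, n) j"
  have F: "set c' \<subseteq> frame (m, n)" using l(1) by (simp add: leaper_cycle_iff)
  have zF: "?z j \<in> frame (m, n)" if "j < 8" for j
    using s [OF that] that frame_eq_sections [OF mn] by blast
  have step: "?z ((j + 3) mod 8) \<in> set c'" if j: "j < 8" "?z j \<in> set c'" for j
  proof -
    obtain h where h: "h < length c'" "?z j = c' ! h" using j by (metis in_set_conv_nth)
    have "c' ! h + left_move (m, n) j = ?z ((j + 3) mod 8)"
      using start_left_move [OF j(1), of "(m, n)"] by (simp add: add.assoc del: start.simps flip: h(2))
    moreover have "?z ((j + 3) mod 8) \<in> frame (m, n)" by (rule zF) simp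
    ultimately show ?thesis
      using leaper_cycle_neighbours [OF p l(1) F h(1) left_move_in_moves [OF j(1)]]
      by (metis nth_mem)
  qed
  have it: "?z ((i + 3 * k) mod 8) \<in> set c'" for k
  proof (induction k)
    case 0
    then show ?case using i l(2) \<open>c' ! 0 \<in> set c'\<close> by simp
  next
    case (Suc k)
    have "(i + 3 * Suc k) mod 8 = ((i + 3 * k) mod 8 + 3) mod 8"
      by (simp add: mod_simps ac_simps)
    then show ?case using step [OF _ Suc] by simp
  qed
  have sub: "?z j \<in> set c'" if "j < 8" for j
  proof -
    have "(i + 3 * (3 * (j + 8 - i))) mod 8 = j"
      using less_8_cases [OF i(1)] less_8_cases [OF that] by (elim disjE; simp)
    then show ?thesis using it [of "3 * (j + 8 - i)"] by simp
  qed
  have inj: "inj_on ?z {..<8}"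
    using s frame_section_disjoint [OF mn(2)] by (intro inj_onI) (metis lessThan_iff)
  have "card (?z ` {..<8}) = 8" using inj by (simp add: card_image)
  moreover have "card (set c') = 8" using l(1,2) by (simp add: leaper_cycle_iff distinct_card)
  ultimately have eq: "?z ` {..<8} = set c'"
    using sub by (intro card_subset_eq) auto
  moreover have "shell_paths (m, n) c' j = [?z j]" if j: "j < 8" for j
  proof -
    have "(THE z. z \<in> set c' \<and> z \<in> frame_section (m, n) j) = ?z j"
    proof (rule the_equality)
      show "?z j \<in> set c' \<and> ?z j \<in> frame_section (m, n) j" using sub s j by blast
      show "z = ?z j" if "z \<in> set c' \<and> z \<in> frame_section (m, n) j" for z
        using that s frame_section_disjoint [OF mn(2) _ j] unfolding eq [symmetric] by blast
    qed
    then show ?thesis by (simp add: shell_paths_def)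
  qed
  ultimately show ?thesis using that s by metis
qed

section \<open>Existence of lifted cycles\<close>

lemma strands_connected:
  assumes "sectioned B (strands [] B)" "proper B"
  shows "sectioned (props e B) (strands e B) \<and> proper (props e B) \<and>
    connected_strands (props e B) (strands e B)"
proof (induction e)
  case Nil
  then show ?case using assms connected_start [of B] by simp
next
  case (Cons x e)
  obtain m n where B: "props e B = (m, n)" by (cases "props e B")
  have "connected_strands (next_prop x (m, n)) (lift_strand x (m, n) (strands e B))"
    using Cons strands_closed [of e B] sectioned_disjoint [of "(m, n)" "strands e B"]
    by (intro connected_lift_strand) (auto simp: B)
  then show ?case using Cons sectioned_lift_strand proper_next_prop by (simp add: B)
qed

lemma strands_cycle:
  assumes "sectioned B (strands [] B)" "proper B"
  shows "\<exists>c. leaper_cycle (fst (props e B)) (snd (props e B)) (frame (props e B)) c \<and>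
    set c = (\<Union>i<8. set (strands e B i))"
proof -
  obtain m n where B: "props e B = (m, n)" by (cases "props e B")
  have s: "sectioned (m, n) (strands e B)" and p: "proper (m, n)"
    and conn: "connected_strands (m, n) (strands e B)"
    using strands_connected [OF assms, of e] by (auto simp: B)
  have cl: "closed_strands (m, n) (strands e B)" using strands_closed [of e B] by (simp add: B)
  have mn: "0 < m" "m < n" "odd (m + n)" using p by (auto simp: proper_def)
  let ?V = "\<Union>i<8. set (strands e B i)"
  have lands: "z + left_move (m, n) i \<in> ?V" "z + right_move (m, n) i \<in> ?V"
    if "i < 8" "z \<in> set (strands e B i)" for i z
  proof -
    have "(i + 3) mod 8 < 8" "(i + 4) mod 8 < 8" "(i + 5) mod 8 < 8" by simp_all
    then show "z + left_move (m, n) i \<in> ?V" "z + right_move (m, n) i \<in> ?V"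
      using cl that unfolding closed_strands_def by blast+
  qed
  have V: "?V \<subseteq> frame (m, n)"
    using s unfolding frame_eq_sections [OF mn] sectioned_def by blast
  have "\<exists>c. distinct c \<and> set c = ?V \<and> 3 \<le> length c \<and>
    (\<forall>i<length c. c ! (Suc i mod length c) - c ! i \<in> moves (m, n))"
  proof (rule two_regular_connected_cycle [where E = "\<lambda>z w. w - z \<in> moves (m, n)"])
    show "finite ?V" by simp
    show "?V \<noteq> {}" using strands_ne [of 0 e B] by (metis UN_I all_not_in_conv lessThan_iff set_empty zero_less_numeral)
    show "x - y \<in> moves (m, n)" if "y - x \<in> moves (m, n)" for x y :: square
      using uminus_moves [OF that] by simp
    show "\<exists>y z. y \<noteq> z \<and> y \<noteq> x \<and> z \<noteq> x \<and> {w \<in> ?V. w - x \<in> moves (m, n)} = {y, z}" if "x \<in> ?V" for x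
    proof -
      obtain i where i: "i < 8" "x \<in> set (strands e B i)" using \<open>x \<in> ?V\<close> by auto
      let ?l = "left_move (m, n) i" and ?r = "right_move (m, n) i"
      have "?l \<noteq> ?r" "?l \<noteq> 0" "?r \<noteq> 0"
        using less_8_cases [OF i(1)] mn by (auto simp: zero_prod_def)
      moreover have "{w \<in> ?V. w - x \<in> moves (m, n)} = {x + ?l, x + ?r}"
      proof (intro set_eqI iffI)
        fix w assume w: "w \<in> {w \<in> ?V. w - x \<in> moves (m, n)}"
        have "w - x = ?l \<or> w - x = ?r"
          using moves_within_frame [OF mn(1,2) i(1), of x "w - x"] w V s i by (auto simp: sectioned_def)
        then show "w \<in> {x + ?l, x + ?r}" by (auto simp: algebra_simps)
      next
        fix w assume "w \<in> {x + ?l, x + ?r}"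
        then show "w \<in> {w \<in> ?V. w - x \<in> moves (m, n)}"
          using lands [OF i] left_move_in_moves [OF i(1)] right_move_in_moves [OF i(1)] by auto
      qed
      ultimately show ?thesis
        by (intro exI [of _ "x + ?l"] exI [of _ "x + ?r"]) simp
    qed
    show "T x = T y"
      if T: "\<And>x y. x \<in> ?V \<Longrightarrow> y \<in> ?V \<Longrightarrow> y - x \<in> moves (m, n) \<Longrightarrow> T x = T y"
        and xy: "x \<in> ?V" "y \<in> ?V" for T :: "square \<Rightarrow> bool" and x y
    proof -
      have "invariant_along (m, n) (strands e B) T"
        unfolding invariant_along_def
      proof (intro allI impI ballI conjI)
        fix i z assume i: "i < (8::nat)" and z: "z \<in> set (strands e B i)"
        then have zV: "z \<in> ?V" by auto
        show "T z = T (z + left_move (m, n) i)"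
          using T [OF zV lands(1) [OF i z]] left_move_in_moves [OF i, of "(m, n)"] by simp
        show "T z = T (z + right_move (m, n) i)"
          using T [OF zV lands(2) [OF i z]] right_move_in_moves [OF i, of "(m, n)"] by simp
      qed
      then show ?thesis using conn xy unfolding connected_strands_def by blast
    qed
  qed
  then obtain c where "distinct c" "set c = ?V" "3 \<le> length c"
    "\<forall>i<length c. c ! (Suc i mod length c) - c ! i \<in> moves (m, n)" by blast
  then show ?thesis using V by (intro exI [of _ c]) (simp add: leaper_cycle_iff B)
qed

text \<open>Witnesses are the shell cycles centred at the origin in the frames of proportions \<open>(2, 3)\<close>
  and \<open>(2, 5)\<close>.\<close>

lemma lifted_shell_cycle_exists:
  assumes "ot \<in> {Lg, Lh}"
  shows "\<exists>p q c' c. lifted_shell_cycle p q e [ot] c' c"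
proof -
  let ?B = "proportions [ot]"
  let ?c' = "map (start ?B) [0, 3, 6, 1, 4, 7, 2, 5]"
  have B: "?B = (2, if ot = Lg then 3 else 5)"
    using assms by (auto simp: proportions_props)
  have sec: "start ?B i \<in> frame_section ?B i" if "i < 8" for i
    using less_8_cases [OF that] by (elim disjE; simp add: B mem_frame_section)
  have s: "sectioned ?B (strands [] ?B)" using sec by (simp add: sectioned_def)
  have p: "proper ?B" by (rule proper_proportions)
  obtain c where c: "leaper_cycle (fst (props e ?B)) (snd (props e ?B)) (frame (props e ?B)) c"
    "set c = (\<Union>i<8. set (strands e ?B i))"
    using strands_cycle [OF s p] by blast
  obtain p q where pq: "props e ?B = (p, q)" by (cases "props e ?B")
  have "leaper_descent p q (e @ [ot])"
    using pq by (intro leaper_descent_proportions) (simp add: proportions_append)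
  moreover have "leaper_cycle p q (board p q) c"
    using c(1) frame_subset_board [of p q] by (auto simp: pq leaper_cycle_iff)
  moreover have "set c = lift_sets e [ot] (set ?c')"
  proof -
    have eight: "{..<8} = {0, 3, 6, 1, 4, 7, 2, 5::nat}" using less_8_cases by auto
    have "(\<Union>i<8. set (strands [] ?B i)) = set ?c'"
      unfolding eight by (simp del: start.simps add: insert_commute)
    then have "lift_sets e [ot] (set ?c') = (\<Union>i<8. set (lift_paths e [ot] (strands [] ?B) i))"
      using lift_paths_sets [OF s, of e] by metis
    moreover have "lift_paths e [ot] (strands [] ?B) i = strands e ?B i" if "i < 8" for i
      using that
    proof (induction e arbitrary: i)
      case (Cons x e)
      have "lift_paths (x # e) [ot] (strands [] ?B) i =
          lift_strand x (props e ?B) (lift_paths e [ot] (strands [] ?B)) i"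
        using Cons.prems by (simp add: lift_path_eq proportions_append)
      also have "\<dots> = lift_strand x (props e ?B) (strands e ?B) i"
        using Cons by (intro lift_strand_cong) auto
      finally show ?case by simp
    qed simp
    ultimately show ?thesis using c(2) by simp
  qed
  moreover have "shell_cycle ?B ?c'"
  proof -
    have "set ?c' \<subseteq> frame ?B" "set ?c' \<subseteq> shell ?B"
      by (auto simp: B mem_frame rot90_eq_turn bex_less_4 mem_funpow_turn_image mem_turn_image simp del: funpow_turn)
    moreover have "distinct ?c'" by (simp add: B)
    moreover have "\<forall>i<8. ?c' ! (Suc i mod 8) - ?c' ! i \<in> moves ?B"
      unfolding all_less_8 by (simp add: B moves_def nth_Cons_numeral)
    ultimately show ?thesis
      by (cases ?B) (use B in \<open>auto simp: leaper_cycle_iff split: if_splits\<close>)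
  qed
  ultimately show ?thesis unfolding lifted_shell_cycle_def by blast
qed

section \<open>Symbolic squares as matrices\<close>

definition form_matrix :: "(int \<times> int) \<times> (int \<times> int) \<Rightarrow> real^2^2" where
  "form_matrix N = mat2 (real_of_int (fst (fst N))) (real_of_int (snd (fst N)))
     (real_of_int (fst (snd N))) (real_of_int (snd (snd N)))"

lemma form_matrix_Pair [simp]:
  "form_matrix ((a, b), (c, d)) = mat2 (real_of_int a) (real_of_int b) (real_of_int c) (real_of_int d)"
  by (simp add: form_matrix_def)

lemma form_matrix_diff: "form_matrix (N - M) = form_matrix N - form_matrix M"
  by (simp add: form_matrix_def vec_eq_iff forall_2)

lemma form_matrix_eq_iff: "form_matrix N = form_matrix M \<longleftrightarrow> N = M"
  by (auto simp: form_matrix_def mat2_eq_iff prod_eq_iff)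

lemma form_matrix_vec: "form_matrix N *v pos_vec B = pos_vec (eval_pair B N)"
  by (cases N; cases B) (auto simp: pos_vec_def mat2_mult_vec eval_pair_def eval_form_def)

lemma lifting_matrix_form_matrix: "lifting_matrix x ** form_matrix C = form_matrix (next_prop x C)"
proof -
  obtain a b c d where C: "C = ((a, b), (c, d))" by (cases C) auto
  show ?thesis by (cases x) (simp_all add: C mat2_mult_mat2 mat2_eq_iff)
qed

lemma string_matrix_eq: "string_matrix e = form_matrix (props e symbolic)"
proof (induction e)
  case Nil
  have "(mat 1 :: real^2^2) = mat2 1 0 0 1" by (simp add: vec_eq_iff forall_2 mat_def)
  then show ?case by (simp add: string_matrix_def)
next
  case (Cons x e)
  then show ?case by (simp add: string_matrix_def lifting_matrix_form_matrix)
qed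

lemma string_matrix_vec: "string_matrix e *v pos_vec B = pos_vec (props e B)"
  by (simp add: string_matrix_eq form_matrix_vec eval_pair_props eval_pair_symbolic)

lemma lifting_matrix_vec: "lifting_matrix x *v pos_vec B = pos_vec (next_prop x B)"
  using string_matrix_vec [of "[x]" B] by (simp add: string_matrix_def)

lemma invertible_lifting_matrix: "invertible (lifting_matrix x)"
  by (cases x) (simp_all add: invertible_det_nz det_2)

lemma invertible_string_matrix: "invertible (string_matrix e)"
proof (induction e)
  case Nil
  then show ?case by (simp add: string_matrix_def invertible_det_nz)
next
  case (Cons x e)
  have "string_matrix (x # e) = lifting_matrix x ** string_matrix e" by (simp add: string_matrix_def)
  then show ?case using Cons invertible_lifting_matrix invertible_mult by metis
qed

lemma form_matrix_mem_image: "form_matrix N \<in> form_matrix ` S \<longleftrightarrow> N \<in> S"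
  by (auto simp: image_iff form_matrix_eq_iff)

lemma form_matrix_moves:
  "form_matrix D \<in> (\<lambda>k. dirmat k ** form_matrix C) ` {1..8} \<longleftrightarrow> D \<in> moves C"
proof -
  obtain a b c d where C: "C = ((a, b), (c, d))" by (cases C) auto
  have "(\<lambda>k. dirmat k ** form_matrix C) ` {1..8} = form_matrix ` moves C"
    by (simp only: one_to_8 image_insert image_empty dirmat_simps C form_matrix_Pair mat2_mult_mat2
        moves_def case_prod_conv) (simp add: insert_commute)
  then show ?thesis by (simp only: form_matrix_mem_image)
qed

lemma form_matrix_second_moves:
  assumes "ot \<in> {Lg, Lh}"
  shows "form_matrix D ** lifting_matrix ot \<in> dirmat ` {1..8} \<longleftrightarrow> D \<in> moves ((2, -1), (1, 0))"
proof -
  obtain a b c d where D: "D = ((a, b), (c, d))" by (cases D) auto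
  let ?g = "((- b, a + 2 * b), (- d, c + 2 * d))" and ?h = "((b, a + 2 * b), (d, c + 2 * d))"
  have gh: "form_matrix D ** lifting_matrix Lg = form_matrix ?g"
    "form_matrix D ** lifting_matrix Lh = form_matrix ?h"
    by (simp_all add: D mat2_mult_mat2 mat2_eq_iff)
  have d: "dirmat ` {1..8} = form_matrix ` moves ((1, 0), (0, 1))"
    by (simp add: dirmats moves_def insert_commute)
  have "?g \<in> moves ((1, 0), (0, 1)) \<longleftrightarrow> D \<in> moves ((2, -1), (1, 0))"
    "?h \<in> moves ((1, 0), (0, 1)) \<longleftrightarrow> D \<in> moves ((2, -1), (1, 0))"
    unfolding D moves_def by (simp_all, presburger+)
  then show ?thesis
    using assms unfolding insert_iff empty_iff simp_thms
    by (elim disjE) (simp_all only: gh d form_matrix_mem_image)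
qed

lemma matrix_inv_mult:
  fixes A :: "real^2^2"
  assumes "invertible A"
  shows "A ** matrix_inv A = mat 1" "matrix_inv A ** A = mat 1"
  using someI_ex [OF assms [unfolded invertible_def]] by (simp_all add: matrix_inv_def)

lemma mult_image_iff:
  assumes "invertible (A :: real^2^2)"
  shows "M ** matrix_inv A \<in> S \<longleftrightarrow> M \<in> (\<lambda>X. X ** A) ` S"
proof
  assume "M ** matrix_inv A \<in> S"
  moreover have "M = (M ** matrix_inv A) ** A"
    using assms by (simp add: matrix_inv_mult flip: matrix_mul_assoc)
  ultimately show "M \<in> (\<lambda>X. X ** A) ` S" by blast
next
  assume "M \<in> (\<lambda>X. X ** A) ` S"
  then obtain X where "X \<in> S" "M = X ** A" by blast
  then show "M ** matrix_inv A \<in> S"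
    using assms by (simp add: matrix_inv_mult flip: matrix_mul_assoc)
qed

section \<open>Cycles of a given descent\<close>

text \<open>The symbolic squares of a cycle of descent \<open>e\<close>, in the order of the canonical second leaper
  cycle.\<close>

abbreviation word :: "lifting list \<Rightarrow> ((int \<times> int) \<times> (int \<times> int)) list" where
  "word e \<equiv> concat (map (strands e symbolic) [0..<8])"

lemma realised_strands:
  assumes sec: "\<And>i. i < 8 \<Longrightarrow> c + start (proportions t) i \<in> frame_section (proportions t) i"
    and a: "\<And>i. i < 8 \<Longrightarrow> a i = [c + start (proportions t) i]"
  defines "\<rho> \<equiv> realise c (proportions t)"
  shows "\<And>i. i < 8 \<Longrightarrow> lift_paths e t a i = map \<rho> (strands e symbolic i)"
    and "\<And>i z. i < 8 \<Longrightarrow> z \<in> set (strands e symbolic i) \<Longrightarrow> \<rho> z \<in> frame_section (proportions (e @ t)) i"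
    and "concat (map (lift_paths e t a) [0..<8]) = map \<rho> (word e)"
    and "distinct (map \<rho> (word e))"
    and "lift_sets e t ((\<lambda>i. c + start (proportions t) i) ` {..<8}) = \<rho> ` set (word e)"
proof -
  have a': "a i = [realise c (proportions t) (start symbolic i)]" if "i < 8" for i
    using a that by (simp add: realise_def eval_pair_start eval_pair_symbolic del: start.simps)
  show l: "lift_paths e t a i = map \<rho> (strands e symbolic i)" if "i < 8" for i
    unfolding \<rho>_def using lift_paths_realise [OF a' that] .
  have s: "sectioned (proportions t) a" using sec a by (simp add: sectioned_def del: start.simps)
  note ls = lift_paths_sets [OF s, of e]
  show "\<rho> z \<in> frame_section (proportions (e @ t)) i"
    if "i < 8" "z \<in> set (strands e symbolic i)" for i z
    using ls l that by (auto simp: sectioned_def)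
  have "concat (map (lift_paths e t a) [0..<8]) = concat (map (\<lambda>i. map \<rho> (strands e symbolic i)) [0..<8])"
    using l by (intro arg_cong [where f = concat] map_cong) auto
  also have "\<dots> = map \<rho> (word e)" by (simp add: map_concat comp_def)
  finally show w: "concat (map (lift_paths e t a) [0..<8]) = map \<rho> (word e)" .
  have "distinct (concat (map (lift_paths e t a) [0..<8]))"
    using ls distinct_lift_paths [OF s] a
    by (intro distinct_concat_sectioned [OF proper_proportions]) auto
  then show "distinct (map \<rho> (word e))" by (simp only: w)
  have "(\<Union>i<8. set (a i)) = (\<lambda>i. c + start (proportions t) i) ` {..<8}"
    using a by (auto simp del: start.simps)
  moreover have "(\<Union>i<8. set (lift_paths e t a i)) = \<rho> ` set (word e)"
    unfolding set_concat_upt_8 image_UN using l by simp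
  ultimately show "lift_sets e t ((\<lambda>i. c + start (proportions t) i) ` {..<8}) = \<rho> ` set (word e)"
    using ls by metis
qed

text \<open>A lifted shell cycle and the canonical second leaper cycle over it are realisations of
  \<open>word e\<close>; for the former only as a set, since the cyclic order is a different one.\<close>

lemma lifted_shell_cycleE:
  assumes "lifted_shell_cycle p q e t c' c"
  obtains \<rho> where "\<And>N M. \<rho> M - \<rho> N = eval_pair (proportions t) (M - N)"
    and "(p, q) = props e (proportions t)" "leaper_cycle p q (board p q) c"
    and "set c = \<rho> ` set (word e)" "distinct (map \<rho> (word e))"
    and "\<And>i z. i < 8 \<Longrightarrow> z \<in> set (strands e symbolic i) \<Longrightarrow> \<rho> z \<in> frame_section (p, q) i"
    and "concat (map (lift_paths e t (shell_paths (proportions t) c')) [0..<8]) = map \<rho> (word e)"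
proof -
  have l: "leaper_descent p q (e @ t)" "shell_cycle (proportions t) c'"
      "leaper_cycle p q (board p q) c" "set c = lift_sets e t (set c')"
    using assms by (auto simp: lifted_shell_cycle_def)
  obtain m n where B: "proportions t = (m, n)" by (cases "proportions t")
  obtain x where x: "set c' = (\<lambda>i. x + start (proportions t) i) ` {..<8}"
    "\<And>i. i < 8 \<Longrightarrow> x + start (proportions t) i \<in> frame_section (proportions t) i"
    "\<And>i. i < 8 \<Longrightarrow> shell_paths (proportions t) c' i = [x + start (proportions t) i]"
    using shell_cycle_shape [of m n c'] proper_proportions [of t] l(2) unfolding B by blast
  have pq: "proportions (e @ t) = (p, q)" using l(1) by (rule leaper_descentD)
  note r = realised_strands [OF x(2,3), where e = e]
  show ?thesis
  proof (rule that [of "realise x (proportions t)"])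
    show "(p, q) = props e (proportions t)" using pq by (simp add: proportions_append)
    show "set c = realise x (proportions t) ` set (word e)" using r(5) l(4) x(1) by simp
    show "realise x (proportions t) z \<in> frame_section (p, q) i"
      if "i < 8" "z \<in> set (strands e symbolic i)" for i z
      using r(2) [OF _ _ that] pq by simp
  qed (use r l realise_diff in \<open>auto simp: realise_diff\<close>)
qed

lemma consec_concat:
  assumes "\<And>j. j \<in> set js \<Longrightarrow> f j \<noteq> []"
  shows "consec (concat (map f js)) =
    (\<Union>j\<in>set js. consec (f j)) \<union> (\<lambda>(j, k). (last (f j), hd (f k))) ` consec js"
  using assms
proof (induction js rule: induct_list012)
  case (3 j k js)
  have "hd (concat (map f (k # js))) = hd (f k)" using 3 by simp
  then show ?case using 3 by (auto simp: consec_append)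
qed simp_all

text \<open>The pairs of cyclically consecutive elements of a list.\<close>

definition cyclic_consec :: "'a list \<Rightarrow> ('a \<times> 'a) set" where
  "cyclic_consec xs = {(xs ! i, xs ! (Suc i mod length xs)) | i. i < length xs}"

lemma cyclic_consec_eq:
  assumes "xs \<noteq> []"
  shows "cyclic_consec xs = insert (last xs, hd xs) (consec xs)"
proof -
  have c: "consec xs = {(xs ! i, xs ! Suc i) | i. Suc i < length xs}"
    by (cases xs) (auto simp: consec_def set_zip)
  have l: "last xs = xs ! (length xs - 1)" "hd xs = xs ! 0"
    using assms by (auto simp: last_conv_nth hd_conv_nth)
  show ?thesis
  proof (intro set_eqI iffI)
    fix p assume "p \<in> cyclic_consec xs"
    then obtain i where i: "i < length xs" "p = (xs ! i, xs ! (Suc i mod length xs))"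
      by (auto simp: cyclic_consec_def)
    show "p \<in> insert (last xs, hd xs) (consec xs)"
    proof (cases "Suc i < length xs")
      case False
      then have "Suc i = length xs" using i by simp
      then show ?thesis using i l by (metis diff_Suc_1 insertI1 mod_self)
    qed (use i c in auto)
  next
    fix p assume "p \<in> insert (last xs, hd xs) (consec xs)"
    then consider "p = (last xs, hd xs)" | i where "Suc i < length xs" "p = (xs ! i, xs ! Suc i)"
      using c by auto
    then show "p \<in> cyclic_consec xs"
    proof cases
      case 1
      have "Suc (length xs - 1) mod length xs = 0" using assms by simp
      then show ?thesis unfolding cyclic_consec_def 1 l
        using assms by (intro CollectI exI [of _ "length xs - 1"]) simp
    next
      case 2
      then show ?thesis by (auto simp: cyclic_consec_def intro!: exI [of _ i])
    qed
  qed
qed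

lemma cyclic_consec_strands:
  assumes ne: "\<And>i. i < 8 \<Longrightarrow> f i \<noteq> []"
  shows "cyclic_consec (concat (map f [0..<8])) =
    (\<Union>i<8. consec (f i)) \<union> {(last (f i), hd (f ((i + 1) mod 8))) | i. i < 8}"
proof -
  have u: "[0..<8] = [0, 1, 2, 3, 4, 5, 6, 7::nat]"
    by (simp add: upt_rec numeral_eq_Suc One_nat_def)
  have c8: "consec [0..<8] = {(0, 1), (1, 2), (2, 3), (3, 4), (4, 5), (5, 6), (6, 7::nat)}"
    by (simp add: u)
  have ne': "concat (map f [0..<8]) \<noteq> []" using ne [of 0] by (auto intro!: bexI [of _ 0])
  have "hd (concat (map f [0..<8])) = hd (f 0)" "last (concat (map f [0..<8])) = last (f 7)"
    using ne [of 0] ne [of 7] by (simp_all add: u)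
  moreover have "{(last (f i), hd (f ((i + 1) mod 8))) | i. i < 8} =
    insert (last (f 7), hd (f 0)) ((\<lambda>(j, k). (last (f j), hd (f k))) ` consec [0..<8])"
  proof -
    have "{(last (f i), hd (f ((i + 1) mod 8))) | i. i < 8} = (\<lambda>i. (last (f i), hd (f ((i + 1) mod 8)))) ` {..<8}"
      by auto
    then show ?thesis by (simp add: lessThan_8 c8 insert_commute)
  qed
  moreover have "consec (concat (map f [0..<8])) =
      (\<Union>i<8. consec (f i)) \<union> (\<lambda>(j, k). (last (f j), hd (f k))) ` consec [0..<8]"
    by (subst consec_concat) (use ne in \<open>auto simp: atLeast0LessThan\<close>)
  ultimately show ?thesis
    by (simp only: cyclic_consec_eq [OF ne'] Un_insert_right)
qed

lemma extracted_arcs: "(x, y) \<in> parcs (graph_of (extracted r s c)) \<longleftrightarrow>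
    (x, y) \<in> cyclic_consec c \<or> (y, x) \<in> cyclic_consec c"
  by (auto simp: extracted_def cyclic_consec_def doubleton_eq_iff)

lemma cyclic_consec_image:
  "cyclic_consec xs = (\<lambda>i. (xs ! i, xs ! (Suc i mod length xs))) ` {..<length xs}"
  by (auto simp: cyclic_consec_def)

lemma cyclic_consec_map: "cyclic_consec (map f xs) = (\<lambda>(x, y). (f x, f y)) ` cyclic_consec xs"
proof -
  have m: "Suc i mod length xs < length xs" if "i < length xs" for i
    using that by (intro mod_less_divisor) linarith
  show ?thesis
    unfolding cyclic_consec_image image_image by (intro image_cong) (auto simp: m)
qed

lemma cyclic_consec_map_iff:
  assumes "inj_on f (set xs)" "x \<in> set xs" "y \<in> set xs"
  shows "(f x, f y) \<in> cyclic_consec (map f xs) \<longleftrightarrow> (x, y) \<in> cyclic_consec xs"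
proof
  assume "(f x, f y) \<in> cyclic_consec (map f xs)"
  then obtain u v where uv: "(u, v) \<in> cyclic_consec xs" "f x = f u" "f y = f v"
    by (auto simp: cyclic_consec_map)
  have "Suc i mod length xs < length xs" if "i < length xs" for i
    using that by (intro mod_less_divisor) linarith
  then have "u \<in> set xs" "v \<in> set xs"
    using uv(1) by (auto simp: cyclic_consec_def)
  then have "x = u" "y = v" using uv(2,3) assms by (auto dest: inj_onD)
  then show "(x, y) \<in> cyclic_consec xs" using uv(1) by simp
next
  assume "(x, y) \<in> cyclic_consec xs"
  then show "(f x, f y) \<in> cyclic_consec (map f xs)"
    unfolding cyclic_consec_map by (rule rev_image_eqI) simp
qed

text \<open>Two symbolic squares of \<open>word e\<close> differ by a symbolic move of the second leaper if and only if
  they are cyclically consecutive.  For the converse direction the indeterminates are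
  specialised to \<open>(1, 2)\<close>, which turns these moves into unit moves.\<close>

lemma word_steps:
  assumes "N \<in> set (word e)" "M \<in> set (word e)"
  shows "(N, M) \<in> cyclic_consec (word e) \<or> (M, N) \<in> cyclic_consec (word e) \<longleftrightarrow>
    M - N \<in> moves ((2, -1), (1, 0))"
proof
  assume *: "(N, M) \<in> cyclic_consec (word e) \<or> (M, N) \<in> cyclic_consec (word e)"
  have s: "steps_in (moves ((2, -1), (1, 0))) (strands e symbolic)"
    using steps_in_strands [of "(1, 0) :: int \<times> int" "(0, 1)" e] by simp
  have eq: "cyclic_consec (word e) = (\<Union>i<8. consec (strands e symbolic i)) \<union>
      {(last (strands e symbolic i), hd (strands e symbolic ((i + 1) mod 8))) | i. i < 8}"
    by (rule cyclic_consec_strands) (rule strands_ne)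
  have st: "M' - N' \<in> moves ((2, -1), (1, 0))" if "(N', M') \<in> cyclic_consec (word e)" for N' M'
  proof -
    have "(\<exists>i<8. (N', M') \<in> consec (strands e symbolic i)) \<or>
      (\<exists>i<8. N' = last (strands e symbolic i) \<and> M' = hd (strands e symbolic ((i + 1) mod 8)))"
      using that [unfolded eq] by auto
    moreover have "M' - N' \<in> moves ((2, -1), (1, 0))"
      if "i < 8" "(N', M') \<in> consec (strands e symbolic i)" for i
      using s that by (auto simp: steps_in_def consec_iff successively_append_iff dest!: spec [of _ i])
    ultimately show ?thesis using s by (auto simp: steps_in_def)
  qed
  from * show "M - N \<in> moves ((2, -1), (1, 0))"
  proof
    assume "(M, N) \<in> cyclic_consec (word e)"
    from uminus_moves [OF st [OF this]] show ?thesis by simp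
  qed (rule st)
next
  assume d: "M - N \<in> moves ((2, -1), (1, 0))"
  let ?\<rho> = "realise 0 (proportions [])"
  have B: "proportions [] = (1, 2)" by (simp add: proportions_props)
  have sec: "0 + start (proportions []) i \<in> frame_section (proportions []) i" if "i < 8" for i
    using sectioned_start that by (simp add: B sectioned_def del: start.simps)
  have \<rho>: "?\<rho> = eval_pair (1, 2)" by (simp add: B realise_def fun_eq_iff)
  have r: "distinct (map (eval_pair (1, 2)) (word e))"
    unfolding \<rho> [symmetric]
    by (rule realised_strands(4) [where a = "\<lambda>i. [0 + start (proportions []) i]", OF sec refl])
  have l: "strands e (1, 2) i = map (eval_pair (1, 2)) (strands e symbolic i)" if "i < 8" for i
    using that
  proof (induction e arbitrary: i)
    case Nil
    then show ?case by (simp add: eval_pair_start eval_pair_symbolic del: start.simps)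
  next
    case (Cons x e)
    have "map (eval_pair (1, 2)) (strands (x # e) symbolic i) =
      lift_strand x (props e (1, 2)) (\<lambda>j. map (eval_pair (1, 2)) (strands e symbolic j)) i"
      using realise_lift_strand [OF Cons.prems, of 0 "(1, 2)" x "props e symbolic" "strands e symbolic"]
      by (simp add: realise_def [abs_def] eval_pair_props eval_pair_symbolic)
    also have "\<dots> = lift_strand x (props e (1, 2)) (strands e (1, 2)) i"
      using Cons by (intro lift_strand_cong) auto
    finally show ?case by simp
  qed
  obtain i where i: "i < 8" "N \<in> set (strands e symbolic i)" using assms(1) by auto
  obtain j where j: "j < 8" "M \<in> set (strands e symbolic j)" using assms(2) by auto
  let ?N = "eval_pair (1, 2) N" and ?M = "eval_pair (1, 2) M"
  have u: "?M - ?N \<in> unit_moves" "?N - ?M \<in> unit_moves"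
    using eval_pair_moves [OF d, of "(1, 2)"] uminus_moves [of "?M - ?N" "(0, 1)"]
    by (simp_all add: eval_pair_additive) (simp_all add: eval_pair_def eval_form_def)
  have in_s: "?N \<in> set (strands e (1, 2) i)" "?M \<in> set (strands e (1, 2) j)"
    using i j l by auto
  have t: "sectioned (proportions e) (strands e (1, 2))" "tight (strands e (1, 2))"
    using tight_and_sectioned by blast+
  let ?c = "(\<Union>i<8. consec (strands e (1, 2) i)) \<union>
    {(last (strands e (1, 2) i), hd (strands e (1, 2) ((i + 1) mod 8))) | i. i < 8}"
  have "i = j \<or> j = (i + 1) mod 8 \<or> i = (j + 1) mod 8"
  proof -
    obtain m n where mn: "proportions e = (m, n)" by (cases "proportions e")
    show ?thesis
      using unit_neighbour_sections [of m n i j ?N ?M] t(1) u in_s i(1) j(1) proper_proportions [of e]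
      by (auto simp: mn proper_def sectioned_def)
  qed
  then have "(?N, ?M) \<in> ?c \<or> (?M, ?N) \<in> ?c"
  proof (elim disjE)
    assume "i = j"
    then have "(?N, ?M) \<in> consec (strands e (1, 2) i) \<or> (?M, ?N) \<in> consec (strands e (1, 2) i)"
      using t(2) in_s u(1) i(1) by (auto simp: tight_def)
    then show ?thesis using i(1) by blast
  next
    assume "j = (i + 1) mod 8"
    then have "?N = last (strands e (1, 2) i)" "?M = hd (strands e (1, 2) ((i + 1) mod 8))"
      using t(2) in_s u(1) i(1) by (auto simp: tight_def)
    then show ?thesis using i(1) by blast
  next
    assume "i = (j + 1) mod 8"
    then have "?M = last (strands e (1, 2) j)" "?N = hd (strands e (1, 2) ((j + 1) mod 8))"
      using t(2) in_s u(2) j(1) by (auto simp: tight_def)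
    then show ?thesis using j(1) by blast
  qed
  then have nb: "(?N, ?M) \<in> cyclic_consec (concat (map (strands e (1, 2)) [0..<8])) \<or>
      (?M, ?N) \<in> cyclic_consec (concat (map (strands e (1, 2)) [0..<8]))"
    by (simp only: cyclic_consec_strands [of "strands e (1, 2)", OF strands_ne])
  have w: "concat (map (strands e (1, 2)) [0..<8]) = map (eval_pair (1, 2)) (word e)"
  proof -
    have "concat (map (strands e (1, 2)) [0..<8]) = concat (map (\<lambda>i. map (eval_pair (1, 2)) (strands e symbolic i)) [0..<8])"
      using l by (intro arg_cong [where f = concat] map_cong) auto
    then show ?thesis by (simp add: map_concat comp_def)
  qed
  have inj: "inj_on (eval_pair (1, 2)) (set (word e))"
    using r by (simp only: distinct_map)
  show "(N, M) \<in> cyclic_consec (word e) \<or> (M, N) \<in> cyclic_consec (word e)"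
    using nb unfolding w cyclic_consec_map_iff [OF inj assms] cyclic_consec_map_iff [OF inj assms(2,1)] .
qed

section \<open>Potentials of the fundamental direction cycles\<close>

lemma matrix_mult_diff_left:
  fixes A B C :: "real^2^2"
  shows "A ** C - B ** C = (A - B) ** C"
  by (simp add: vec_eq_iff matrix_matrix_mult_def sum_subtractf left_diff_distrib)

lemma matrix_mult_cancel_right:
  fixes A B C :: "real^2^2"
  assumes "invertible C"
  shows "A ** C = B ** C \<longleftrightarrow> A = B"
  using assms by (metis matrix_inv_mult(1) matrix_mul_assoc matrix_mul_rid)

lemma invertible_matrix_inv:
  fixes A :: "real^2^2"
  assumes "invertible A"
  shows "invertible (matrix_inv A)"
  using matrix_inv_mult [OF assms] by (auto simp: invertible_def)

lemma potential_inj: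
  fixes C :: "real^2^2"
  assumes "invertible C" "inj_on \<nu> S"
  shows "inj_on (\<lambda>z. form_matrix (\<nu> z) ** C) S"
  using assms(2) unfolding inj_on_def matrix_mult_cancel_right [OF assms(1)] form_matrix_eq_iff .

text \<open>The potential of the square with symbolic coordinates \<open>N\<close> is \<open>N A\<^sub>e\<^sup>-\<^sup>1\<close>.\<close>

lemma fundamental_potential:
  assumes l: "lifted_shell_cycle p q e t c' c"
  obtains \<rho> where "inj_on \<rho> (set (word e))" "set c = \<rho> ` set (word e)"
    "potential_cycle p q c
       (\<lambda>z. form_matrix (inv_into (set (word e)) \<rho> z) ** matrix_inv (string_matrix e))"
proof -
  let ?I = "set (word e)" and ?A = "string_matrix e" and ?B = "proportions t"
  let ?C = "props e symbolic"
  obtain \<rho> where \<rho>: "\<And>N M. \<rho> M - \<rho> N = eval_pair ?B (M - N)"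
    and pq: "(p, q) = props e ?B" and c: "leaper_cycle p q (board p q) c" "set c = \<rho> ` ?I"
    and d: "distinct (map \<rho> (word e))"
    and sec: "\<And>i z. i < 8 \<Longrightarrow> z \<in> set (strands e symbolic i) \<Longrightarrow> \<rho> z \<in> frame_section (p, q) i"
    using lifted_shell_cycleE [OF l] by metis
  have inj: "inj_on \<rho> ?I" using d by (simp only: distinct_map)
  define \<nu> where "\<nu> = inv_into ?I \<rho>"
  have \<nu>: "\<nu> (\<rho> N) = N" if "N \<in> ?I" for N using inj that by (simp add: \<nu>_def)
  have pr: "proper (p, q)" unfolding pq proportions_append [symmetric] by (rule proper_proportions)
  then have pos: "0 < p" "p < q" "odd (p + q)" by (auto simp: proper_def)
  have inv: "invertible ?A" by (rule invertible_string_matrix)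
  have evC: "eval_pair ?B ?C = (p, q)" by (simp add: eval_pair_props eval_pair_symbolic pq)
  have strand: "\<exists>i<8. N \<in> set (strands e symbolic i)" if "N \<in> ?I" for N
    using that by auto
  have F: "set c \<subseteq> frame (p, q)"
    unfolding c(2) frame_eq_sections [OF pos] using strand sec by blast
  have step: "M - N \<in> moves ?C \<longleftrightarrow> (\<rho> N, \<rho> M) \<in> cyclic_consec c \<or> (\<rho> M, \<rho> N) \<in> cyclic_consec c"
    if NM: "N \<in> ?I" "M \<in> ?I" for N M
  proof
    assume "M - N \<in> moves ?C"
    then have m: "\<rho> M - \<rho> N \<in> moves (p, q)"
      using eval_pair_moves [of "M - N" ?C ?B] by (simp add: \<rho> evC)
    have "\<rho> N \<in> set c" "\<rho> M \<in> set c" using NM c(2) by auto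
    then obtain i where i: "i < length c" "\<rho> N = c ! i" by (metis in_set_conv_nth)
    have "c ! i + (\<rho> M - \<rho> N) = \<rho> M" by (simp flip: i(2))
    then obtain h where "h < length c" "h = Suc i mod length c \<or> i = Suc h mod length c" "\<rho> M = c ! h"
      using leaper_cycle_neighbours [OF pr c(1) F i(1) m] \<open>\<rho> M \<in> set c\<close> F by auto
    then show "(\<rho> N, \<rho> M) \<in> cyclic_consec c \<or> (\<rho> M, \<rho> N) \<in> cyclic_consec c"
      using i unfolding cyclic_consec_def by auto
  next
    assume "(\<rho> N, \<rho> M) \<in> cyclic_consec c \<or> (\<rho> M, \<rho> N) \<in> cyclic_consec c"
    moreover have "y - x \<in> moves (p, q)" if "(x, y) \<in> cyclic_consec c" for x y
      using that c(1) by (auto simp: cyclic_consec_def leaper_cycle_iff)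
    ultimately have m: "\<rho> M - \<rho> N \<in> moves (p, q)"
      using uminus_moves [of "\<rho> N - \<rho> M" "(p, q)"] by (metis minus_diff_eq)
    obtain i where i: "i < 8" "N \<in> set (strands e symbolic i)" using strand NM by blast
    have "\<rho> N + (\<rho> M - \<rho> N) \<in> frame (p, q)" using F c(2) NM by auto
    then have "\<rho> M - \<rho> N = left_move (p, q) i \<or> \<rho> M - \<rho> N = right_move (p, q) i"
      using moves_within_frame [OF pos(1,2) i(1) sec [OF i] m] by blast
    then obtain D where D: "D = left_move ?C i \<or> D = right_move ?C i" "\<rho> M - \<rho> N = eval_pair ?B D"
      using eval_pair_left_move [OF i(1), of ?B ?C] eval_pair_right_move [OF i(1), of ?B ?C] evC by metis
    have "(i + 3) mod 8 < 8" "(i + 4) mod 8 < 8" "(i + 5) mod 8 < 8" by simp_all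
    then have "N + D \<in> ?I"
      using strands_closed [of e symbolic] i D(1) unfolding closed_strands_def set_concat_upt_8 by blast
    moreover have "\<rho> (N + D) = \<rho> M"
    proof -
      have "\<rho> (N + D) - \<rho> N = \<rho> M - \<rho> N" unfolding \<rho> D(2) [unfolded \<rho>] by simp
      then show ?thesis by simp
    qed
    ultimately have "N + D = M" using inj NM by (auto dest: inj_onD)
    then have "M - N = D" by auto
    then show "M - N \<in> moves ?C"
      using D(1) left_move_in_moves [OF i(1)] right_move_in_moves [OF i(1)] by metis
  qed
  let ?\<pi> = "\<lambda>z. form_matrix (\<nu> z) ** matrix_inv ?A"
  have diff: "?\<pi> (\<rho> M) - ?\<pi> (\<rho> N) = form_matrix (M - N) ** matrix_inv ?A" if "N \<in> ?I" "M \<in> ?I" for N M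
    using that by (simp add: \<nu> matrix_mult_diff_left form_matrix_diff)
  have "potential_cycle p q c ?\<pi>"
  proof
    show "0 < p" "p < q" by (rule pos)+
    show "distinct c" "3 \<le> length c" using c(1) by (auto simp: leaper_cycle_iff)
    have "inj_on \<nu> (set c)" unfolding \<nu>_def c(2) by (rule inj_on_inv_into) simp
    then show "inj_on ?\<pi> (set c)"
      by (rule potential_inj [OF invertible_matrix_inv [OF inv]])
    fix x y assume "x \<in> set c" "y \<in> set c"
    then obtain N M where N: "N \<in> ?I" "x = \<rho> N" and M: "M \<in> ?I" "y = \<rho> M"
      unfolding c(2) by blast
    have "?\<pi> y - ?\<pi> x \<in> dirmat ` {1..8} \<longleftrightarrow> form_matrix (M - N) \<in> (\<lambda>k. dirmat k ** ?A) ` {1..8}"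
      unfolding N M diff [OF N(1) M(1)] mult_image_iff [OF inv] image_image ..
    also have "\<dots> \<longleftrightarrow> M - N \<in> moves ?C"
      unfolding string_matrix_eq by (rule form_matrix_moves)
    also have "\<dots> \<longleftrightarrow> (x, y) \<in> parcs (graph_of (extracted p q c))"
      unfolding step [OF N(1) M(1)] extracted_arcs N M ..
    finally show "(x, y) \<in> parcs (graph_of (extracted p q c)) \<longleftrightarrow> ?\<pi> y - ?\<pi> x \<in> dirmat ` {1..8}" ..
    have "(?\<pi> y - ?\<pi> x) *v pos_vec (p, q) = (form_matrix (M - N) ** matrix_inv ?A) *v (?A *v pos_vec ?B)"
      unfolding N M diff [OF N(1) M(1)] string_matrix_vec pq [symmetric] ..
    also have "\<dots> = form_matrix (M - N) *v pos_vec ?B"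
      by (simp add: matrix_vector_mul_assoc matrix_inv_mult [OF inv] flip: matrix_mul_assoc)
    also have "\<dots> = pos_vec (y - x)" by (simp add: form_matrix_vec N M \<rho>)
    finally show "(?\<pi> y - ?\<pi> x) *v vector [real_of_int p, real_of_int q] = pos_vec (y - x)"
      by (simp add: pos_vec_def)
  qed
  then show ?thesis using that inj c(2) unfolding \<nu>_def by blast
qed

lemma length_word: "3 \<le> length (word e)"
proof -
  have "0 < length (strands e symbolic i)" if "i < 8" for i :: nat using strands_ne [OF that] by simp
  from this [of 0] this [of 1] this [of 2]
  have "3 \<le> length (strands e symbolic 0) + length (strands e symbolic 1) + length (strands e symbolic 2)"
    by linarith
  moreover have "[0..<8] = 0 # 1 # 2 # [3..<8::nat]"
    by (simp add: upt_rec numeral_eq_Suc One_nat_def)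
  ultimately show ?thesis by simp
qed

text \<open>The potential of the square with symbolic coordinates \<open>N\<close> is \<open>N A\<^sub>o\<close>.\<close>

lemma second_fundamental_potential:
  assumes o: "ot \<in> {Lg, Lh}" and D: "canonical_second_cycle e ot r s D"
  obtains \<rho> where "inj_on \<rho> (set (word e))" "D = map \<rho> (word e)"
    "potential_cycle r s D (\<lambda>z. form_matrix (inv_into (set (word e)) \<rho> z) ** lifting_matrix ot)"
proof -
  let ?I = "set (word e)" and ?A = "lifting_matrix ot"
  obtain p q t c' c where l: "lifted_shell_cycle p q e (ot # t) c' c" and rs: "leaper_descent r s t"
    and De: "D = concat (map (lift_paths e (ot # t) (shell_paths (proportions (ot # t)) c')) [0..<8])"
    using D unfolding canonical_second_cycle_def by blast
  let ?B = "proportions (ot # t)"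
  obtain \<rho> where \<rho>: "\<And>N M. \<rho> M - \<rho> N = eval_pair ?B (M - N)"
    and d: "distinct (map \<rho> (word e))" and De': "D = map \<rho> (word e)"
    using lifted_shell_cycleE [OF l] De by metis
  have inj: "inj_on \<rho> ?I" using d by (simp only: distinct_map)
  define \<nu> where "\<nu> = inv_into ?I \<rho>"
  have \<nu>: "\<nu> (\<rho> N) = N" if "N \<in> ?I" for N using inj that by (simp add: \<nu>_def)
  have t: "proportions t = (r, s)" using rs by (rule leaper_descentD)
  then have pos: "0 < r" "r < s" using proper_proportions [of t] by (auto simp: proper_def)
  have B: "?B = next_prop ot (r, s)" using proportions_append [of "[ot]" t] t by simp
  have setD: "set D = \<rho> ` ?I" unfolding De' by (rule set_map)
  let ?\<pi> = "\<lambda>z. form_matrix (\<nu> z) ** ?A"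
  have diff: "?\<pi> (\<rho> M) - ?\<pi> (\<rho> N) = form_matrix (M - N) ** ?A" if "N \<in> ?I" "M \<in> ?I" for N M
    using that by (simp add: \<nu> matrix_mult_diff_left form_matrix_diff)
  have "potential_cycle r s D ?\<pi>"
  proof
    show "0 < r" "r < s" by (rule pos)+
    show "distinct D" using d De' by simp
    show "3 \<le> length D" using length_word [of e] unfolding De' length_map by linarith
    have "inj_on \<nu> (set D)" unfolding \<nu>_def setD by (rule inj_on_inv_into) simp
    then show "inj_on ?\<pi> (set D)"
      by (rule potential_inj [OF invertible_lifting_matrix])
    fix x y assume "x \<in> set D" "y \<in> set D"
    then obtain N M where N: "N \<in> ?I" "x = \<rho> N" and M: "M \<in> ?I" "y = \<rho> M"
      unfolding setD by blast
    have cc: "(\<rho> N, \<rho> M) \<in> cyclic_consec D \<longleftrightarrow> (N, M) \<in> cyclic_consec (word e)"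
      if "N \<in> ?I" "M \<in> ?I" for N M
      unfolding De' by (rule cyclic_consec_map_iff [OF inj that])
    have "?\<pi> y - ?\<pi> x \<in> dirmat ` {1..8} \<longleftrightarrow> M - N \<in> moves ((2, -1), (1, 0))"
      unfolding N M diff [OF N(1) M(1)] by (rule form_matrix_second_moves [OF o])
    also have "\<dots> \<longleftrightarrow> (x, y) \<in> parcs (graph_of (extracted r s D))"
      unfolding word_steps [OF N(1) M(1), symmetric] extracted_arcs N M cc [OF N(1) M(1)] cc [OF M(1) N(1)] ..
    finally show "(x, y) \<in> parcs (graph_of (extracted r s D)) \<longleftrightarrow> ?\<pi> y - ?\<pi> x \<in> dirmat ` {1..8}" ..
    have "(?\<pi> y - ?\<pi> x) *v pos_vec (r, s) = form_matrix (M - N) *v (?A *v pos_vec (r, s))"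
      unfolding N M diff [OF N(1) M(1)] by (simp add: matrix_vector_mul_assoc)
    also have "\<dots> = pos_vec (y - x)" by (simp add: lifting_matrix_vec form_matrix_vec N M \<rho> B)
    finally show "(?\<pi> y - ?\<pi> x) *v vector [real_of_int r, real_of_int s] = pos_vec (y - x)"
      by (simp add: pos_vec_def)
  qed
  then show ?thesis using that inj De' unfolding \<nu>_def by blast
qed

section \<open>Duality\<close>

lemma complement_withI:
  assumes "potential_cycle r s D \<pi>" "potential_cycle p q c \<pi>'" "length D = length c"
    and "A \<notin> dirmat ` {1..8}" "bij_betw \<eta> (set D) (set c)"
    and "\<And>x y. x \<in> set D \<Longrightarrow> y \<in> set D \<Longrightarrow> \<pi> y - \<pi> x = (\<pi>' (\<eta> y) - \<pi>' (\<eta> x)) ** A"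
  shows "complement_with A (extracted r s D) (extracted p q c)"
proof -
  interpret D: potential_cycle r s D \<pi> by fact
  interpret c: potential_cycle p q c \<pi>' by fact
  have "distance (extracted r s D) x y = dirmat (label_of (extracted p q c) (\<eta> x, \<eta> y)) ** A"
    if "x \<in> set D" "y \<in> set D" "(\<eta> x, \<eta> y) \<in> parcs (graph_of (extracted p q c))" for x y
    using that assms(6) D.distance_potential c.label(2) by simp
  then show ?thesis
    unfolding complement_with_def D.verts c.verts
    using D.direction_graph c.direction_graph D.coherent c.coherent D.connected c.connected assms(4,5)
      extracted_iso [OF D.dist c.dist assms(3) D.wf] by blast
qed

lemma snd_props_mono: "proper B \<Longrightarrow> proper (props e B) \<and> snd B \<le> snd (props e B)"
proof (induction e)
  case (Cons x e)
  obtain m n where B: "props e B = (m, n)" by (cases "props e B")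
  then have "snd (props e B) \<le> snd (next_prop x (props e B))"
    using Cons by (cases x) (auto simp: proper_def)
  then show ?case using Cons proper_next_prop by auto
qed simp

text \<open>The matrix \<open>A\<^sub>e A\<^sub>o\<close> maps \<open>(1, 2)\<close> to the proportions of a larger leaper, whereas direction
  matrices preserve the set of absolute values of the coordinates.\<close>

lemma duality_matrix_not_direction:
  assumes "ot \<in> {Lg, Lh}"
  shows "string_matrix e ** lifting_matrix ot \<notin> dirmat ` {1..8}"
    and "matrix_inv (string_matrix e ** lifting_matrix ot) \<notin> dirmat ` {1..8}"
proof -
  let ?A = "string_matrix e ** lifting_matrix ot"
  obtain p q where pq: "props e (next_prop ot (1, 2)) = (p, q :: int)"
    by (cases "props e (next_prop ot (1, 2 :: int))")
  have "proper (next_prop ot (1, 2))" "3 \<le> snd (next_prop ot (1, 2) :: square)"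
    using assms by (auto simp: proper_def)
  then have q: "3 \<le> q" using snd_props_mono [of "next_prop ot (1, 2)" e] pq by auto
  have inv: "invertible ?A"
    using invertible_mult invertible_string_matrix invertible_lifting_matrix by blast
  have 1: "?A *v pos_vec (1, 2) = pos_vec (p, q)"
    by (simp add: lifting_matrix_vec string_matrix_vec pq flip: matrix_vector_mul_assoc)
  have 2: "matrix_inv ?A *v pos_vec (p, q) = pos_vec (1, 2)"
    unfolding 1 [symmetric] by (simp add: matrix_vector_mul_assoc matrix_inv_mult [OF inv])
  have k: "k = 1 \<or> k = 2 \<or> k = 3 \<or> k = 4 \<or> k = 5 \<or> k = 6 \<or> k = 7 \<or> k = 8" if "k \<in> {1..8}" for k :: nat
    using that by auto
  show "?A \<notin> dirmat ` {1..8}"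
  proof
    assume "?A \<in> dirmat ` {1..8}"
    then obtain j where j: "j \<in> {1..8}" "?A = dirmat j" by blast
    have "dirmat j *v pos_vec (1, 2) = pos_vec (p, q)" using 1 j(2) by simp
    then show False using k [OF j(1)] q
      by (elim disjE; simp add: dirmat_simps pos_vec_def mat2_mult_vec vector2_eq_iff)
  qed
  show "matrix_inv ?A \<notin> dirmat ` {1..8}"
  proof
    assume "matrix_inv ?A \<in> dirmat ` {1..8}"
    then obtain j where j: "j \<in> {1..8}" "matrix_inv ?A = dirmat j" by blast
    have "dirmat j *v pos_vec (p, q) = pos_vec (1, 2)" using 2 j(2) by simp
    then show False using k [OF j(1)] q
      by (elim disjE; simp add: dirmat_simps pos_vec_def mat2_mult_vec vector2_eq_iff)
  qed
qed

theorem theorem18: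
  fixes e :: "lifting list" and ot :: lifting
  assumes "ot \<in> {Lg, Lh}"
  shows "(\<exists>\<Phi>. fundamental_direction_cycle e \<Phi>) \<and>
    (\<exists>\<Psi>. second_fundamental_direction_cycle ot e \<Psi>) \<and>
    invertible (string_matrix e ** lifting_matrix ot) \<and>
    (\<forall>\<Phi> \<Psi>. fundamental_direction_cycle e \<Phi> \<and> second_fundamental_direction_cycle ot e \<Psi> \<longrightarrow>
       dual_graph \<Phi> \<and> dual_graph \<Psi> \<and>
       complement_with (string_matrix e ** lifting_matrix ot) \<Psi> \<Phi> \<and>
       complement_with (matrix_inv (string_matrix e ** lifting_matrix ot)) \<Phi> \<Psi>)"
proof -
  let ?E = "string_matrix e" and ?O = "lifting_matrix ot" and ?I = "set (word e)"
  have invE: "invertible ?E" by (rule invertible_string_matrix)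
  have inv: "invertible (?E ** ?O)"
    using invertible_mult invE invertible_lifting_matrix by blast
  have compl: "complement_with (?E ** ?O) \<Psi> \<Phi> \<and> complement_with (matrix_inv (?E ** ?O)) \<Phi> \<Psi>"
    if \<Phi>: "fundamental_direction_cycle e \<Phi>" and \<Psi>: "second_fundamental_direction_cycle ot e \<Psi>" for \<Phi> \<Psi>
  proof -
    obtain p q c t c' where "lifted_shell_cycle p q e t c' c" and \<Phi>e: "\<Phi> = extracted p q c"
      using \<Phi> unfolding fundamental_direction_cycle_def cycle_descent_def by blast
    then obtain \<rho> where \<rho>: "inj_on \<rho> ?I" "set c = \<rho> ` ?I"
      and pc: "potential_cycle p q c (\<lambda>z. form_matrix (inv_into ?I \<rho> z) ** matrix_inv ?E)"
      using fundamental_potential by metis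
    obtain r s D where "canonical_second_cycle e ot r s D" and \<Psi>e: "\<Psi> = extracted r s D"
      using \<Psi> unfolding second_fundamental_direction_cycle_def by blast
    then obtain \<sigma> where \<sigma>: "inj_on \<sigma> ?I" "D = map \<sigma> (word e)"
      and pD: "potential_cycle r s D (\<lambda>z. form_matrix (inv_into ?I \<sigma> z) ** ?O)"
      using second_fundamental_potential [OF assms] by metis
    have setD: "set D = \<sigma> ` ?I" unfolding \<sigma>(2) by (rule set_map)
    have b: "bij_betw \<rho> ?I (set c)" "bij_betw \<sigma> ?I (set D)"
      using \<rho> \<sigma>(1) setD by (simp_all add: bij_betw_def)
    have len: "length D = length c"
      using bij_betw_same_card [OF b(1)] bij_betw_same_card [OF b(2)]
        potential_cycle.dist [OF pc] potential_cycle.dist [OF pD] by (simp add: distinct_card)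
    have X: "X ** ?O = (X ** matrix_inv ?E) ** (?E ** ?O)" for X :: "real^2^2"
      using matrix_inv_mult(2) [OF invE] by (metis matrix_mul_assoc matrix_mul_rid)
    have Y: "X ** matrix_inv ?E = (X ** ?O) ** matrix_inv (?E ** ?O)" for X :: "real^2^2"
      using X [of X] matrix_inv_mult(1) [OF inv] by (metis matrix_mul_assoc matrix_mul_rid)
    have "complement_with (?E ** ?O) \<Psi> \<Phi>"
      unfolding \<Phi>e \<Psi>e
    proof (rule complement_withI [OF pD pc len duality_matrix_not_direction(1) [OF assms]])
      show "bij_betw (\<rho> \<circ> inv_into ?I \<sigma>) (set D) (set c)"
        using bij_betw_trans [OF bij_betw_inv_into [OF b(2)] b(1)] .
      show "form_matrix (inv_into ?I \<sigma> y) ** ?O - form_matrix (inv_into ?I \<sigma> x) ** ?O =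
         (form_matrix (inv_into ?I \<rho> ((\<rho> \<circ> inv_into ?I \<sigma>) y)) ** matrix_inv ?E -
          form_matrix (inv_into ?I \<rho> ((\<rho> \<circ> inv_into ?I \<sigma>) x)) ** matrix_inv ?E) ** (?E ** ?O)"
        if "x \<in> set D" "y \<in> set D" for x y
      proof -
        have "inv_into ?I \<sigma> x \<in> ?I" "inv_into ?I \<sigma> y \<in> ?I"
          using that setD by (simp_all only: inv_into_into)
        then have "inv_into ?I \<rho> ((\<rho> \<circ> inv_into ?I \<sigma>) x) = inv_into ?I \<sigma> x"
          "inv_into ?I \<rho> ((\<rho> \<circ> inv_into ?I \<sigma>) y) = inv_into ?I \<sigma> y"
          using \<rho>(1) by (simp_all only: comp_apply inv_into_f_f)
        then show ?thesis
          using X [of "form_matrix (inv_into ?I \<sigma> y) - form_matrix (inv_into ?I \<sigma> x)"]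
          by (simp only: matrix_mult_diff_left)
      qed
    qed
    moreover have "complement_with (matrix_inv (?E ** ?O)) \<Phi> \<Psi>"
      unfolding \<Phi>e \<Psi>e
    proof (rule complement_withI [OF pc pD len [symmetric] duality_matrix_not_direction(2) [OF assms]])
      show "bij_betw (\<sigma> \<circ> inv_into ?I \<rho>) (set c) (set D)"
        using bij_betw_trans [OF bij_betw_inv_into [OF b(1)] b(2)] .
      show "form_matrix (inv_into ?I \<rho> y) ** matrix_inv ?E - form_matrix (inv_into ?I \<rho> x) ** matrix_inv ?E =
         (form_matrix (inv_into ?I \<sigma> ((\<sigma> \<circ> inv_into ?I \<rho>) y)) ** ?O -
          form_matrix (inv_into ?I \<sigma> ((\<sigma> \<circ> inv_into ?I \<rho>) x)) ** ?O) ** matrix_inv (?E ** ?O)"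
        if "x \<in> set c" "y \<in> set c" for x y
      proof -
        have "inv_into ?I \<rho> x \<in> ?I" "inv_into ?I \<rho> y \<in> ?I"
          using that \<rho>(2) by (simp_all only: inv_into_into)
        then have "inv_into ?I \<sigma> ((\<sigma> \<circ> inv_into ?I \<rho>) x) = inv_into ?I \<rho> x"
          "inv_into ?I \<sigma> ((\<sigma> \<circ> inv_into ?I \<rho>) y) = inv_into ?I \<rho> y"
          using \<sigma>(1) by (simp_all only: comp_apply inv_into_f_f)
        then show ?thesis
          using Y [of "form_matrix (inv_into ?I \<rho> y) - form_matrix (inv_into ?I \<rho> x)"]
          by (simp only: matrix_mult_diff_left)
      qed
    qed
    ultimately show ?thesis by blast
  qed
  obtain p q c' c where l: "lifted_shell_cycle p q e [ot] c' c"
    using lifted_shell_cycle_exists [OF assms] by blast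
  then have \<Phi>: "\<exists>\<Phi>. fundamental_direction_cycle e \<Phi>"
    unfolding fundamental_direction_cycle_def cycle_descent_def by blast
  have "leaper_descent 1 2 []"
    by (rule leaper_descent_proportions) (simp add: proportions_def)
  then have "\<exists>D. canonical_second_cycle e ot 1 2 D"
    using l unfolding canonical_second_cycle_def by blast
  then have \<Psi>: "\<exists>\<Psi>. second_fundamental_direction_cycle ot e \<Psi>"
    unfolding second_fundamental_direction_cycle_def by blast
  show ?thesis
    using \<Phi> \<Psi> inv compl unfolding dual_graph_def by blast
qed

end
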